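(* Let $k$ be a field. Let $\mathcal{C}$ be a $\operatorname{Hom}$-finite, Krull-Schmidt, triangulated $k$-category that has a Serre functor, and assume $R$ is a rigid object of $\mathcal{C}$. Let $\mathcal{R}$ be the class of regular morphisms in $\mathcal{C}/[\mathcal{X}_{R}]$ and let $L_{\mathcal{R}}\colon\mathcal{C}/[\mathcal{X}_{R}]\to(\mathcal{C}/[\mathcal{X}_{R}])_{\mathcal{R}}$ be the (Gabriel-Zisman) localisation functor. Then there is an additive functor $F\colon\mathcal{C}(R)/[\operatorname{add}\Sigma R]\to\mathcal{C}/[\mathcal{X}_{R}]$ such that the composition $$L_{\mathcal{R}}\circ F\colon\mathcal{C}(R)/[\operatorname{add}\Sigma R]\longrightarrow(\mathcal{C}/[\mathcal{X}_{R}])_{\mathcal{R}}$$ is an equivalence.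
   Context: $\Sigma$ is the suspension functor of $\mathcal{C}$ and $\operatorname{Ext}^{1}_{\mathcal{C}}(X,Y)=\operatorname{Hom}_{\mathcal{C}}(X,\Sigma Y)$. An object $R$ is rigid if $\operatorname{Ext}^{1}_{\mathcal{C}}(R,R)=0$. $\operatorname{add}X$ is the full subcategory of objects isomorphic to direct summands of finite direct sums of copies of $X$. $\mathcal{X}_{R}$ is the full subcategory of objects $Y$ of $\mathcal{C}$ with $\operatorname{Hom}_{\mathcal{C}}(R,Y)=0$. $\mathcal{C}(R)=(\operatorname{add}R)*(\operatorname{add}\Sigma R)$ is the full subcategory of objects $X$ for which there is a distinguished triangle $R_{0}\to X\to \Sigma R_{1}\to\Sigma R_{0}$ with $R_{0},R_{1}\in\operatorname{add}R$. For a subcategory $\mathcal{A}$ closed under finite direct sums, $[\mathcal{A}]$ is the ideal of morphisms factoring through an object of $\mathcal{A}$. $\mathcal{C}$ is $\operatorname{Hom}$-finite if all its $\operatorname{Hom}$-spaces are finite-dimensional over $k$. A Serre functor is a triangle autoequivalence $\nu\colon\mathcal{C}\to\mathcal{C}$ with isomorphisms $\operatorname{Hom}_{\mathcal{C}}(X,Y)\cong D\operatorname{Hom}_{\mathcal{C}}(Y,\nu X)$ functorial in both arguments, where $D=\operatorname{Hom}_{k}(-,k)$. A morphism is regular if it is both a monomorphism and an epimorphism. The localisation $(\mathcal{C}/[\mathcal{X}_{R}])_{\mathcal{R}}$ is obtained by formally inverting the morphisms in $\mathcal{R}$ (a priori possibly requiring passage to a higher universe). *)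

theory Defs
  imports "HOL-Algebra.AbelCoset" "Jordan_Normal_Form.Missing_VectorSpace"
begin

section \<open>Categories and functors\<close>

text \<open>
  Hom-sets are not required to be disjoint. Composition and functors therefore take the objects
  as explicit arguments: \<open>Comp C X Y Z g f\<close> is the composite of \<open>f : X \<rightarrow> Y\<close> and \<open>g : Y \<rightarrow> Z\<close>.
  All operations are meaningful only on the objects in \<open>Obj C\<close> and the morphisms in the
  indicated Hom-sets.
\<close>

record ('o, 'm) cat =
  Obj :: "'o set"
  Hom :: "'o \<Rightarrow> 'o \<Rightarrow> 'm set"
  Comp :: "'o \<Rightarrow> 'o \<Rightarrow> 'o \<Rightarrow> 'm \<Rightarrow> 'm \<Rightarrow> 'm"
  Id :: "'o \<Rightarrow> 'm"

definition is_category :: "('o, 'm, 'z) cat_scheme \<Rightarrow> bool" where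
  "is_category C \<longleftrightarrow>
     (\<forall>X\<in>Obj C. Id C X \<in> Hom C X X) \<and>
     (\<forall>X\<in>Obj C. \<forall>Y\<in>Obj C. \<forall>Z\<in>Obj C. \<forall>f\<in>Hom C X Y. \<forall>g\<in>Hom C Y Z.
        Comp C X Y Z g f \<in> Hom C X Z) \<and>
     (\<forall>X\<in>Obj C. \<forall>Y\<in>Obj C. \<forall>f\<in>Hom C X Y.
        Comp C X X Y f (Id C X) = f \<and> Comp C X Y Y (Id C Y) f = f) \<and>
     (\<forall>W\<in>Obj C. \<forall>X\<in>Obj C. \<forall>Y\<in>Obj C. \<forall>Z\<in>Obj C.
        \<forall>f\<in>Hom C W X. \<forall>g\<in>Hom C X Y. \<forall>h\<in>Hom C Y Z.
        Comp C W X Z (Comp C X Y Z h g) f = Comp C W Y Z h (Comp C W X Y g f))"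

definition is_iso :: "('o, 'm, 'z) cat_scheme \<Rightarrow> 'o \<Rightarrow> 'o \<Rightarrow> 'm \<Rightarrow> bool" where
  "is_iso C X Y f \<longleftrightarrow> f \<in> Hom C X Y \<and>
     (\<exists>g\<in>Hom C Y X. Comp C X Y X g f = Id C X \<and> Comp C Y X Y f g = Id C Y)"

definition is_mono :: "('o, 'm, 'z) cat_scheme \<Rightarrow> 'o \<Rightarrow> 'o \<Rightarrow> 'm \<Rightarrow> bool" where
  "is_mono C X Y f \<longleftrightarrow> f \<in> Hom C X Y \<and>
     (\<forall>W\<in>Obj C. \<forall>g\<in>Hom C W X. \<forall>h\<in>Hom C W X. Comp C W X Y f g = Comp C W X Y f h \<longrightarrow> g = h)"

definition is_epi :: "('o, 'm, 'z) cat_scheme \<Rightarrow> 'o \<Rightarrow> 'o \<Rightarrow> 'm \<Rightarrow> bool" where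
  "is_epi C X Y f \<longleftrightarrow> f \<in> Hom C X Y \<and>
     (\<forall>Z\<in>Obj C. \<forall>g\<in>Hom C Y Z. \<forall>h\<in>Hom C Y Z. Comp C X Y Z g f = Comp C X Y Z h f \<longrightarrow> g = h)"

definition regular_morphisms :: "('o, 'm, 'z) cat_scheme \<Rightarrow> ('o \<times> 'o \<times> 'm) set" where
  "regular_morphisms C =
     {(X, Y, f). X \<in> Obj C \<and> Y \<in> Obj C \<and> is_mono C X Y f \<and> is_epi C X Y f}"

definition zero_object :: "('o, 'm, 'z) cat_scheme \<Rightarrow> 'o \<Rightarrow> bool" where
  "zero_object C Z \<longleftrightarrow> Z \<in> Obj C \<and>
     (\<forall>X\<in>Obj C. (\<exists>!f. f \<in> Hom C X Z) \<and> (\<exists>!f. f \<in> Hom C Z X))"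

record ('a, 'b, 'c, 'd) cfunctor =
  FObj :: "'a \<Rightarrow> 'c"
  FMor :: "'a \<Rightarrow> 'a \<Rightarrow> 'b \<Rightarrow> 'd"

definition is_functor ::
  "('a, 'b, 'z1) cat_scheme \<Rightarrow> ('c, 'd, 'z2) cat_scheme \<Rightarrow> ('a, 'b, 'c, 'd) cfunctor \<Rightarrow> bool" where
  "is_functor A B F \<longleftrightarrow> is_category A \<and> is_category B \<and>
     (\<forall>X\<in>Obj A. FObj F X \<in> Obj B) \<and>
     (\<forall>X\<in>Obj A. \<forall>Y\<in>Obj A. \<forall>f\<in>Hom A X Y. FMor F X Y f \<in> Hom B (FObj F X) (FObj F Y)) \<and>
     (\<forall>X\<in>Obj A. FMor F X X (Id A X) = Id B (FObj F X)) \<and>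
     (\<forall>X\<in>Obj A. \<forall>Y\<in>Obj A. \<forall>Z\<in>Obj A. \<forall>f\<in>Hom A X Y. \<forall>g\<in>Hom A Y Z.
        FMor F X Z (Comp A X Y Z g f) =
        Comp B (FObj F X) (FObj F Y) (FObj F Z) (FMor F Y Z g) (FMor F X Y f))"

definition id_functor :: "('a, 'b, 'a, 'b) cfunctor" where
  "id_functor = \<lparr>FObj = (\<lambda>X. X), FMor = (\<lambda>X Y f. f)\<rparr>"

definition comp_functor ::
  "('c, 'd, 'e, 'f) cfunctor \<Rightarrow> ('a, 'b, 'c, 'd) cfunctor \<Rightarrow> ('a, 'b, 'e, 'f) cfunctor" where
  "comp_functor G F =
     \<lparr>FObj = (\<lambda>X. FObj G (FObj F X)),
      FMor = (\<lambda>X Y f. FMor G (FObj F X) (FObj F Y) (FMor F X Y f))\<rparr>"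

definition natural_iso ::
  "('a, 'b, 'z1) cat_scheme \<Rightarrow> ('c, 'd, 'z2) cat_scheme \<Rightarrow>
   ('a, 'b, 'c, 'd) cfunctor \<Rightarrow> ('a, 'b, 'c, 'd) cfunctor \<Rightarrow> ('a \<Rightarrow> 'd) \<Rightarrow> bool" where
  "natural_iso A B F G \<eta> \<longleftrightarrow> is_functor A B F \<and> is_functor A B G \<and>
     (\<forall>X\<in>Obj A. is_iso B (FObj F X) (FObj G X) (\<eta> X)) \<and>
     (\<forall>X\<in>Obj A. \<forall>Y\<in>Obj A. \<forall>f\<in>Hom A X Y.
        Comp B (FObj F X) (FObj F Y) (FObj G Y) (\<eta> Y) (FMor F X Y f) =
        Comp B (FObj F X) (FObj G X) (FObj G Y) (FMor G X Y f) (\<eta> X))"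

definition is_equivalence ::
  "('a, 'b, 'z1) cat_scheme \<Rightarrow> ('c, 'd, 'z2) cat_scheme \<Rightarrow> ('a, 'b, 'c, 'd) cfunctor \<Rightarrow> bool" where
  "is_equivalence A B F \<longleftrightarrow> is_functor A B F \<and>
     (\<exists>G \<eta> \<epsilon>. is_functor B A G \<and>
        natural_iso A A id_functor (comp_functor G F) \<eta> \<and>
        natural_iso B B (comp_functor F G) id_functor \<epsilon>)"


section \<open>Preadditive, linear and additive categories\<close>

record ('o, 'm, 'k) lincat = "('o, 'm) cat" +
  HAdd :: "'o \<Rightarrow> 'o \<Rightarrow> 'm \<Rightarrow> 'm \<Rightarrow> 'm"
  HZero :: "'o \<Rightarrow> 'o \<Rightarrow> 'm"
  HSmult :: "'o \<Rightarrow> 'o \<Rightarrow> 'k \<Rightarrow> 'm \<Rightarrow> 'm"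

text \<open>The fields \<open>mult\<close> and \<open>one\<close> of a module record are irrelevant for the module axioms.\<close>

definition hom_mod :: "('o, 'm, 'k, 'z) lincat_scheme \<Rightarrow> 'o \<Rightarrow> 'o \<Rightarrow> ('k, 'm) module" where
  "hom_mod C X Y =
     \<lparr>carrier = Hom C X Y, mult = undefined, one = undefined,
      zero = HZero C X Y, add = HAdd C X Y, smult = HSmult C X Y\<rparr>"

definition preadditive_category :: "('o, 'm, 'k, 'z) lincat_scheme \<Rightarrow> bool" where
  "preadditive_category C \<longleftrightarrow> is_category C \<and>
     (\<forall>X\<in>Obj C. \<forall>Y\<in>Obj C. abelian_group (hom_mod C X Y)) \<and>
     (\<forall>X\<in>Obj C. \<forall>Y\<in>Obj C. \<forall>Z\<in>Obj C. \<forall>f\<in>Hom C X Y. \<forall>g\<in>Hom C Y Z. \<forall>g'\<in>Hom C Y Z.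
        Comp C X Y Z (HAdd C Y Z g g') f = HAdd C X Z (Comp C X Y Z g f) (Comp C X Y Z g' f)) \<and>
     (\<forall>X\<in>Obj C. \<forall>Y\<in>Obj C. \<forall>Z\<in>Obj C. \<forall>f\<in>Hom C X Y. \<forall>f'\<in>Hom C X Y. \<forall>g\<in>Hom C Y Z.
        Comp C X Y Z g (HAdd C X Y f f') = HAdd C X Z (Comp C X Y Z g f) (Comp C X Y Z g f'))"

definition linear_category :: "'k ring \<Rightarrow> ('o, 'm, 'k, 'z) lincat_scheme \<Rightarrow> bool" where
  "linear_category K C \<longleftrightarrow> preadditive_category C \<and>
     (\<forall>X\<in>Obj C. \<forall>Y\<in>Obj C. vectorspace K (hom_mod C X Y)) \<and>
     (\<forall>X\<in>Obj C. \<forall>Y\<in>Obj C. \<forall>Z\<in>Obj C. \<forall>f\<in>Hom C X Y. \<forall>g\<in>Hom C Y Z. \<forall>a\<in>carrier K.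
        Comp C X Y Z (HSmult C Y Z a g) f = HSmult C X Z a (Comp C X Y Z g f) \<and>
        Comp C X Y Z g (HSmult C X Y a f) = HSmult C X Z a (Comp C X Y Z g f))"

definition additive_functor ::
  "('a, 'b, 'k, 'z1) lincat_scheme \<Rightarrow> ('c, 'd, 'k, 'z2) lincat_scheme \<Rightarrow>
   ('a, 'b, 'c, 'd) cfunctor \<Rightarrow> bool" where
  "additive_functor A B F \<longleftrightarrow>
     preadditive_category A \<and> preadditive_category B \<and> is_functor A B F \<and>
     (\<forall>X\<in>Obj A. \<forall>Y\<in>Obj A. \<forall>f\<in>Hom A X Y. \<forall>g\<in>Hom A X Y.
        FMor F X Y (HAdd A X Y f g) =
        HAdd B (FObj F X) (FObj F Y) (FMor F X Y f) (FMor F X Y g))"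

definition linear_functor ::
  "'k ring \<Rightarrow> ('a, 'b, 'k, 'z1) lincat_scheme \<Rightarrow> ('c, 'd, 'k, 'z2) lincat_scheme \<Rightarrow>
   ('a, 'b, 'c, 'd) cfunctor \<Rightarrow> bool" where
  "linear_functor K A B F \<longleftrightarrow> additive_functor A B F \<and>
     (\<forall>X\<in>Obj A. \<forall>Y\<in>Obj A. \<forall>f\<in>Hom A X Y. \<forall>a\<in>carrier K.
        FMor F X Y (HSmult A X Y a f) = HSmult B (FObj F X) (FObj F Y) a (FMor F X Y f))"

text \<open>
  \<open>S\<close> is a direct sum (biproduct) of the finite family \<open>Xs\<close>, up to isomorphism; a direct sum of
  the empty family is a zero object.
\<close>

definition is_direct_sum :: "('o, 'm, 'k, 'z) lincat_scheme \<Rightarrow> 'o list \<Rightarrow> 'o \<Rightarrow> bool" where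
  "is_direct_sum C Xs S \<longleftrightarrow> set Xs \<subseteq> Obj C \<and> S \<in> Obj C \<and>
     (\<exists>\<iota> \<pi>.
        (\<forall>i<length Xs. \<iota> i \<in> Hom C (Xs ! i) S \<and> \<pi> i \<in> Hom C S (Xs ! i)) \<and>
        (\<forall>i<length Xs. \<forall>j<length Xs.
           Comp C (Xs ! i) S (Xs ! j) (\<pi> j) (\<iota> i) =
           (if i = j then Id C (Xs ! i) else HZero C (Xs ! i) (Xs ! j))) \<and>
        finsum (hom_mod C S S) (\<lambda>i. Comp C S (Xs ! i) S (\<iota> i) (\<pi> i)) {..<length Xs} = Id C S)"

definition additive_category :: "('o, 'm, 'k, 'z) lincat_scheme \<Rightarrow> bool" where
  "additive_category C \<longleftrightarrow> preadditive_category C \<and>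
     (\<forall>Xs. set Xs \<subseteq> Obj C \<longrightarrow> (\<exists>S. is_direct_sum C Xs S))"

definition hom_finite :: "'k ring \<Rightarrow> ('o, 'm, 'k, 'z) lincat_scheme \<Rightarrow> bool" where
  "hom_finite K C \<longleftrightarrow> (\<forall>X\<in>Obj C. \<forall>Y\<in>Obj C. vectorspace.fin_dim K (hom_mod C X Y))"

definition End_ring :: "('o, 'm, 'k, 'z) lincat_scheme \<Rightarrow> 'o \<Rightarrow> 'm ring" where
  "End_ring C X =
     \<lparr>carrier = Hom C X X, mult = Comp C X X X, one = Id C X,
      zero = HZero C X X, add = HAdd C X X\<rparr>"

text \<open>Local rings, not necessarily commutative: the sum of two non-units is a non-unit.\<close>

definition local_ring :: "'a ring \<Rightarrow> bool" where
  "local_ring A \<longleftrightarrow> ring A \<and> \<one>\<^bsub>A\<^esub> \<noteq> \<zero>\<^bsub>A\<^esub> \<and>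
     (\<forall>a\<in>carrier A. \<forall>b\<in>carrier A.
        a \<notin> Units A \<longrightarrow> b \<notin> Units A \<longrightarrow> a \<oplus>\<^bsub>A\<^esub> b \<notin> Units A)"

definition krull_schmidt :: "('o, 'm, 'k, 'z) lincat_scheme \<Rightarrow> bool" where
  "krull_schmidt C \<longleftrightarrow> additive_category C \<and>
     (\<forall>X\<in>Obj C. \<exists>Xs. is_direct_sum C Xs X \<and> (\<forall>Y\<in>set Xs. local_ring (End_ring C Y)))"

definition add_closure :: "('o, 'm, 'k, 'z) lincat_scheme \<Rightarrow> 'o \<Rightarrow> 'o set" where
  "add_closure C X =
     {Y. \<exists>n S Y'. is_direct_sum C (replicate n X) S \<and> is_direct_sum C [Y, Y'] S}"

definition full_subcategory ::
  "('o, 'm, 'k, 'z) lincat_scheme \<Rightarrow> 'o set \<Rightarrow> ('o, 'm, 'k) lincat" where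
  "full_subcategory C S = (lincat.truncate C)\<lparr>Obj := Obj C \<inter> S\<rparr>"


section \<open>Ideal quotients\<close>

definition factor_ideal ::
  "('o, 'm, 'k, 'z) lincat_scheme \<Rightarrow> 'o set \<Rightarrow> 'o \<Rightarrow> 'o \<Rightarrow> 'm set" where
  "factor_ideal C A X Y =
     {Comp C X Z Y g f | Z f g. Z \<in> Obj C \<and> Z \<in> A \<and> f \<in> Hom C X Z \<and> g \<in> Hom C Z Y}"

text \<open>
  The category \<open>C/[A]\<close>. Its morphisms are cosets of \<open>[A](X, Y)\<close>; composition and scalar
  multiplication are written as unions over all representatives, which are again single cosets.
\<close>

definition quotient_category ::
  "('o, 'm, 'k, 'z) lincat_scheme \<Rightarrow> 'o set \<Rightarrow> ('o, 'm set, 'k) lincat" where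
  "quotient_category C A =
     \<lparr>Obj = Obj C,
      Hom = (\<lambda>X Y. a_rcosets\<^bsub>hom_mod C X Y\<^esub> (factor_ideal C A X Y)),
      Comp = (\<lambda>X Y Z G F. \<Union>g\<in>G. \<Union>f\<in>F.
                factor_ideal C A X Z +>\<^bsub>hom_mod C X Z\<^esub> Comp C X Y Z g f),
      Id = (\<lambda>X. factor_ideal C A X X +>\<^bsub>hom_mod C X X\<^esub> Id C X),
      HAdd = (\<lambda>X Y F G. F <+>\<^bsub>hom_mod C X Y\<^esub> G),
      HZero = (\<lambda>X Y. factor_ideal C A X Y),
      HSmult = (\<lambda>X Y a F. \<Union>f\<in>F. factor_ideal C A X Y +>\<^bsub>hom_mod C X Y\<^esub> HSmult C X Y a f)\<rparr>"


section \<open>Gabriel-Zisman localisation\<close>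

text \<open>
  Morphisms of the localisation at a class \<open>W\<close> of morphisms (given together with their source
  and target) are finite composable words, in diagrammatic order, of morphisms \<open>f\<close> of \<open>C\<close> and
  formal inverses of elements \<open>s\<close> of \<open>W\<close>, modulo the congruence generated by the relations of
  \<open>C\<close> and by requiring that the formal inverse of \<open>s\<close> is a two-sided inverse of \<open>s\<close>. Both
  \<open>Fwd X Y f\<close> and \<open>Bwd X Y s\<close> record the source \<open>X\<close> and target \<open>Y\<close> of the given morphism, so
  that \<open>Bwd X Y s\<close> is a letter from \<open>Y\<close> to \<open>X\<close>.
\<close>

datatype ('o, 'm) letter = Fwd 'o 'o 'm | Bwd 'o 'o 'm

fun is_word ::
  "('o, 'm, 'z) cat_scheme \<Rightarrow> ('o \<times> 'o \<times> 'm) set \<Rightarrow> 'o \<Rightarrow> 'o \<Rightarrow> ('o, 'm) letter list \<Rightarrow> bool" where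
  "is_word C W X Y [] \<longleftrightarrow> X \<in> Obj C \<and> X = Y"
| "is_word C W X Y (Fwd A B f # p) \<longleftrightarrow>
     X = A \<and> A \<in> Obj C \<and> B \<in> Obj C \<and> f \<in> Hom C A B \<and> is_word C W B Y p"
| "is_word C W X Y (Bwd A B s # p) \<longleftrightarrow>
     X = B \<and> A \<in> Obj C \<and> B \<in> Obj C \<and> s \<in> Hom C A B \<and> (A, B, s) \<in> W \<and> is_word C W A Y p"

inductive word_step ::
  "('o, 'm, 'z) cat_scheme \<Rightarrow> ('o \<times> 'o \<times> 'm) set \<Rightarrow>
   ('o, 'm) letter list \<Rightarrow> ('o, 'm) letter list \<Rightarrow> bool"
  for C W where
  ident: "word_step C W [Fwd X X (Id C X)] []"
| comp: "word_step C W [Fwd X Y f, Fwd Y Z g] [Fwd X Z (Comp C X Y Z g f)]"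
| inv_right: "word_step C W [Fwd X Y s, Bwd X Y s] []"
| inv_left: "word_step C W [Bwd X Y s, Fwd X Y s] []"

inductive word_eq ::
  "('o, 'm, 'z) cat_scheme \<Rightarrow> ('o \<times> 'o \<times> 'm) set \<Rightarrow> 'o \<Rightarrow> 'o \<Rightarrow>
   ('o, 'm) letter list \<Rightarrow> ('o, 'm) letter list \<Rightarrow> bool"
  for C W X Y where
  step: "word_step C W l r \<Longrightarrow> is_word C W X Y (p @ l @ q) \<Longrightarrow> is_word C W X Y (p @ r @ q) \<Longrightarrow>
           word_eq C W X Y (p @ l @ q) (p @ r @ q)"
| refl: "is_word C W X Y p \<Longrightarrow> word_eq C W X Y p p"
| sym: "word_eq C W X Y p q \<Longrightarrow> word_eq C W X Y q p"
| trans: "word_eq C W X Y p q \<Longrightarrow> word_eq C W X Y q r \<Longrightarrow> word_eq C W X Y p r"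

definition word_class ::
  "('o, 'm, 'z) cat_scheme \<Rightarrow> ('o \<times> 'o \<times> 'm) set \<Rightarrow> 'o \<Rightarrow> 'o \<Rightarrow>
   ('o, 'm) letter list \<Rightarrow> ('o, 'm) letter list set" where
  "word_class C W X Y p = {q. word_eq C W X Y p q}"

definition localisation ::
  "('o, 'm, 'z) cat_scheme \<Rightarrow> ('o \<times> 'o \<times> 'm) set \<Rightarrow> ('o, ('o, 'm) letter list set) cat" where
  "localisation C W =
     \<lparr>Obj = Obj C,
      Hom = (\<lambda>X Y. word_class C W X Y ` {p. is_word C W X Y p}),
      Comp = (\<lambda>X Y Z G F. \<Union>q\<in>G. \<Union>p\<in>F. word_class C W X Z (p @ q)),
      Id = (\<lambda>X. word_class C W X X [])\<rparr>"

definition localisation_functor ::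
  "('o, 'm, 'z) cat_scheme \<Rightarrow> ('o \<times> 'o \<times> 'm) set \<Rightarrow>
   ('o, 'm, 'o, ('o, 'm) letter list set) cfunctor" where
  "localisation_functor C W =
     \<lparr>FObj = (\<lambda>X. X), FMor = (\<lambda>X Y f. word_class C W X Y [Fwd X Y f])\<rparr>"


section \<open>Triangulated categories\<close>

text \<open>
  \<open>(X, Y, Z, u, v, w) \<in> Tri C\<close> stands for a distinguished triangle
  \<open>X \<rightarrow> Y \<rightarrow> Z \<rightarrow> \<Sigma>X\<close> with morphisms \<open>u\<close>, \<open>v\<close>, \<open>w\<close>.
\<close>

record ('o, 'm, 'k) tricat = "('o, 'm, 'k) lincat" +
  Susp :: "('o, 'm, 'o, 'm) cfunctor"
  Tri :: "('o \<times> 'o \<times> 'o \<times> 'm \<times> 'm \<times> 'm) set"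

abbreviation SObj :: "('o, 'm, 'k, 'z) tricat_scheme \<Rightarrow> 'o \<Rightarrow> 'o" where
  "SObj C X \<equiv> FObj (Susp C) X"

abbreviation SMor :: "('o, 'm, 'k, 'z) tricat_scheme \<Rightarrow> 'o \<Rightarrow> 'o \<Rightarrow> 'm \<Rightarrow> 'm" where
  "SMor C X Y f \<equiv> FMor (Susp C) X Y f"

definition candidate_triangle ::
  "('o, 'm, 'k, 'z) tricat_scheme \<Rightarrow> 'o \<times> 'o \<times> 'o \<times> 'm \<times> 'm \<times> 'm \<Rightarrow> bool" where
  "candidate_triangle C = (\<lambda>(X, Y, Z, u, v, w).
     X \<in> Obj C \<and> Y \<in> Obj C \<and> Z \<in> Obj C \<and>
     u \<in> Hom C X Y \<and> v \<in> Hom C Y Z \<and> w \<in> Hom C Z (SObj C X))"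

definition triangle_morphism ::
  "('o, 'm, 'k, 'z) tricat_scheme \<Rightarrow> 'o \<times> 'o \<times> 'o \<times> 'm \<times> 'm \<times> 'm \<Rightarrow>
   'o \<times> 'o \<times> 'o \<times> 'm \<times> 'm \<times> 'm \<Rightarrow> 'm \<times> 'm \<times> 'm \<Rightarrow> bool" where
  "triangle_morphism C = (\<lambda>(X, Y, Z, u, v, w) (X', Y', Z', u', v', w') (a, b, c).
     a \<in> Hom C X X' \<and> b \<in> Hom C Y Y' \<and> c \<in> Hom C Z Z' \<and>
     Comp C X Y Y' b u = Comp C X X' Y' u' a \<and>
     Comp C Y Z Z' c v = Comp C Y Y' Z' v' b \<and>
     Comp C Z (SObj C X) (SObj C X') (SMor C X X' a) w =
     Comp C Z Z' (SObj C X') w' c)"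

definition triangles_iso_closed :: "('o, 'm, 'k, 'z) tricat_scheme \<Rightarrow> bool" where
  "triangles_iso_closed C \<longleftrightarrow>
     (\<forall>X Y Z u v w X' Y' Z' u' v' w' a b c.
        (X, Y, Z, u, v, w) \<in> Tri C \<longrightarrow> candidate_triangle C (X', Y', Z', u', v', w') \<longrightarrow>
        triangle_morphism C (X, Y, Z, u, v, w) (X', Y', Z', u', v', w') (a, b, c) \<longrightarrow>
        is_iso C X X' a \<longrightarrow> is_iso C Y Y' b \<longrightarrow> is_iso C Z Z' c \<longrightarrow>
        (X', Y', Z', u', v', w') \<in> Tri C)"

definition triangles_TR1 :: "('o, 'm, 'k, 'z) tricat_scheme \<Rightarrow> bool" where
  "triangles_TR1 C \<longleftrightarrow>
     (\<forall>X\<in>Obj C. \<forall>N. zero_object C N \<longrightarrow>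
        (X, X, N, Id C X, HZero C X N, HZero C N (SObj C X)) \<in> Tri C) \<and>
     (\<forall>X\<in>Obj C. \<forall>Y\<in>Obj C. \<forall>u\<in>Hom C X Y. \<exists>Z v w. (X, Y, Z, u, v, w) \<in> Tri C)"

definition triangles_TR2 :: "('o, 'm, 'k, 'z) tricat_scheme \<Rightarrow> bool" where
  "triangles_TR2 C \<longleftrightarrow>
     (\<forall>X Y Z u v w. candidate_triangle C (X, Y, Z, u, v, w) \<longrightarrow>
        ((X, Y, Z, u, v, w) \<in> Tri C \<longleftrightarrow>
         (Y, Z, SObj C X, v, w, a_inv (hom_mod C (SObj C X) (SObj C Y)) (SMor C X Y u)) \<in> Tri C))"

definition triangles_TR3 :: "('o, 'm, 'k, 'z) tricat_scheme \<Rightarrow> bool" where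
  "triangles_TR3 C \<longleftrightarrow>
     (\<forall>X Y Z u v w X' Y' Z' u' v' w' a b.
        (X, Y, Z, u, v, w) \<in> Tri C \<longrightarrow> (X', Y', Z', u', v', w') \<in> Tri C \<longrightarrow>
        a \<in> Hom C X X' \<longrightarrow> b \<in> Hom C Y Y' \<longrightarrow>
        Comp C X Y Y' b u = Comp C X X' Y' u' a \<longrightarrow>
        (\<exists>c. triangle_morphism C (X, Y, Z, u, v, w) (X', Y', Z', u', v', w') (a, b, c)))"

text \<open>The octahedral axiom for the composable pair \<open>u : X \<rightarrow> Y\<close>, \<open>v : Y \<rightarrow> Z\<close>.\<close>

definition triangles_TR4 :: "('o, 'm, 'k, 'z) tricat_scheme \<Rightarrow> bool" where
  "triangles_TR4 C \<longleftrightarrow>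
     (\<forall>X Y Z X' Y' Z' u i i' v j j' k k'.
        (X, Y, Z', u, i, i') \<in> Tri C \<longrightarrow>
        (Y, Z, X', v, j, j') \<in> Tri C \<longrightarrow>
        (X, Z, Y', Comp C X Y Z v u, k, k') \<in> Tri C \<longrightarrow>
        (\<exists>f\<in>Hom C Z' Y'. \<exists>g\<in>Hom C Y' X'.
           (Z', Y', X', f, g, Comp C X' (SObj C Y) (SObj C Z') (SMor C Y Z' i) j') \<in> Tri C \<and>
           Comp C Y Z' Y' f i = Comp C Y Z Y' k v \<and>
           Comp C Z' Y' (SObj C X) k' f = i' \<and>
           Comp C Z Y' X' g k = j \<and>
           Comp C Y' X' (SObj C Y) j' g = Comp C Y' (SObj C X) (SObj C Y) (SMor C X Y u) k'))"

definition triangulated_category :: "'k ring \<Rightarrow> ('o, 'm, 'k, 'z) tricat_scheme \<Rightarrow> bool" where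
  "triangulated_category K C \<longleftrightarrow>
     linear_category K C \<and> additive_category C \<and>
     linear_functor K C C (Susp C) \<and> is_equivalence C C (Susp C) \<and>
     (\<forall>T\<in>Tri C. candidate_triangle C T) \<and>
     triangles_iso_closed C \<and> triangles_TR1 C \<and> triangles_TR2 C \<and>
     triangles_TR3 C \<and> triangles_TR4 C"

definition triangle_functor ::
  "('a, 'b, 'k, 'z1) tricat_scheme \<Rightarrow> ('c, 'd, 'k, 'z2) tricat_scheme \<Rightarrow>
   ('a, 'b, 'c, 'd) cfunctor \<Rightarrow> bool" where
  "triangle_functor C D F \<longleftrightarrow> additive_functor C D F \<and>
     (\<exists>\<phi>. natural_iso C D (comp_functor F (Susp C)) (comp_functor (Susp D) F) \<phi> \<and>
        (\<forall>X Y Z u v w. (X, Y, Z, u, v, w) \<in> Tri C \<longrightarrow>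
           (FObj F X, FObj F Y, FObj F Z, FMor F X Y u, FMor F Y Z v,
            Comp D (FObj F Z) (FObj F (SObj C X)) (SObj D (FObj F X))
              (\<phi> X) (FMor F Z (SObj C X) w)) \<in> Tri D))"

definition dual_space :: "'k ring \<Rightarrow> ('k, 'v) module \<Rightarrow> ('k, 'v \<Rightarrow> 'k) module" where
  "dual_space K V =
     \<lparr>carrier = {\<phi> \<in> carrier V \<rightarrow>\<^sub>E carrier K.
        (\<forall>x\<in>carrier V. \<forall>y\<in>carrier V. \<phi> (x \<oplus>\<^bsub>V\<^esub> y) = \<phi> x \<oplus>\<^bsub>K\<^esub> \<phi> y) \<and>
        (\<forall>a\<in>carrier K. \<forall>x\<in>carrier V. \<phi> (a \<odot>\<^bsub>V\<^esub> x) = a \<otimes>\<^bsub>K\<^esub> \<phi> x)},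
      mult = undefined, one = undefined,
      zero = (\<lambda>x\<in>carrier V. \<zero>\<^bsub>K\<^esub>),
      add = (\<lambda>\<phi> \<psi>. \<lambda>x\<in>carrier V. \<phi> x \<oplus>\<^bsub>K\<^esub> \<psi> x),
      smult = (\<lambda>a \<phi>. \<lambda>x\<in>carrier V. a \<otimes>\<^bsub>K\<^esub> \<phi> x)\<rparr>"

text \<open>
  In \<open>serre_functor\<close> the last clause is naturality of \<open>\<eta>\<^sub>X\<^sub>,\<^sub>Y : Hom(X, Y) \<rightarrow> D Hom(Y, \<nu>X)\<close> in both
  arguments at once, for \<open>f : X' \<rightarrow> X\<close> and \<open>g : Y \<rightarrow> Y'\<close>.
\<close>

definition serre_functor ::
  "'k ring \<Rightarrow> ('o, 'm, 'k, 'z) tricat_scheme \<Rightarrow> ('o, 'm, 'o, 'm) cfunctor \<Rightarrow> bool" where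
  "serre_functor K C \<nu> \<longleftrightarrow> triangle_functor C C \<nu> \<and> is_equivalence C C \<nu> \<and>
     (\<exists>\<eta>.
        (\<forall>X\<in>Obj C. \<forall>Y\<in>Obj C.
           \<eta> X Y \<in> module_hom K (hom_mod C X Y) (dual_space K (hom_mod C Y (FObj \<nu> X))) \<and>
           bij_betw (\<eta> X Y) (Hom C X Y) (carrier (dual_space K (hom_mod C Y (FObj \<nu> X))))) \<and>
        (\<forall>X\<in>Obj C. \<forall>X'\<in>Obj C. \<forall>Y\<in>Obj C. \<forall>Y'\<in>Obj C.
           \<forall>f\<in>Hom C X' X. \<forall>g\<in>Hom C Y Y'. \<forall>h\<in>Hom C X Y. \<forall>t\<in>Hom C Y' (FObj \<nu> X').
             \<eta> X' Y' (Comp C X' Y Y' g (Comp C X' X Y h f)) t =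
             \<eta> X Y h (Comp C Y (FObj \<nu> X') (FObj \<nu> X) (FMor \<nu> X' X f)
                         (Comp C Y Y' (FObj \<nu> X') t g))))"

definition Ext1 :: "('o, 'm, 'k, 'z) tricat_scheme \<Rightarrow> 'o \<Rightarrow> 'o \<Rightarrow> 'm set" where
  "Ext1 C X Y = Hom C X (SObj C Y)"

definition rigid :: "('o, 'm, 'k, 'z) tricat_scheme \<Rightarrow> 'o \<Rightarrow> bool" where
  "rigid C R \<longleftrightarrow> R \<in> Obj C \<and> Ext1 C R R = {HZero C R (SObj C R)}"

text \<open>\<open>hom_perp C R\<close> is $\mathcal{X}_R$ and \<open>two_term C R\<close> is $\mathcal{C}(R)$.\<close>

definition hom_perp :: "('o, 'm, 'k, 'z) lincat_scheme \<Rightarrow> 'o \<Rightarrow> 'o set" where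
  "hom_perp C R = {Y \<in> Obj C. Hom C R Y = {HZero C R Y}}"

definition two_term :: "('o, 'm, 'k, 'z) tricat_scheme \<Rightarrow> 'o \<Rightarrow> 'o set" where
  "two_term C R =
     {X \<in> Obj C. \<exists>R0\<in>add_closure C R. \<exists>R1\<in>add_closure C R. \<exists>u v w.
        (R0, X, SObj C R1, u, v, w) \<in> Tri C}"

end

theory Submission
  imports Defs
begin

text \<open>
  Everything is controlled by the functor \<open>Hom(R, -)\<close>. Call a morphism \<open>f : X \<rightarrow> Y\<close> a ghost if
  \<open>f t = 0\<close> for every \<open>t : R \<rightarrow> X\<close>. Finite-dimensional Hom-spaces give every \<open>X\<close> a map \<open>R\<^sub>0 \<rightarrow> X\<close>
  with \<open>R\<^sub>0\<close> in \<open>add R\<close> through which all maps \<open>R \<rightarrow> X\<close> factor. By rigidity the cone of such a map lies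
  in \<open>\<X>\<^sub>R\<close>, and every ghost out of \<open>X\<close> factors through this cone. Hence the ideal \<open>[\<X>\<^sub>R]\<close> consists
  exactly of the ghosts (\<open>factor_ideal_hom_perp\<close>). If \<open>X\<close> lies in \<open>\<C>(R)\<close>, the triangle
  \<open>R\<^sub>0 \<rightarrow> X \<rightarrow> \<Sigma>R\<^sub>1 \<rightarrow> \<Sigma>R\<^sub>0\<close> shows that a ghost out of \<open>X\<close> already factors through \<open>\<Sigma>R\<^sub>1\<close>
  (\<open>factor_ideal_two_term\<close>). Both quotients therefore kill the same morphisms between objects of
  \<open>\<C>(R)\<close>, so \<open>\<C>(R)/[add \<Sigma>R]\<close> is, coset by coset, the full subcategory of \<open>\<C>/[\<X>\<^sub>R]\<close> on \<open>\<C>(R)\<close>, and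
  \<open>F\<close> is the inclusion.

  The regular morphisms of \<open>\<C>/[\<X>\<^sub>R]\<close> are exactly the classes of those \<open>f\<close> for which \<open>Hom(R, f)\<close> is
  bijective (\<open>regular_iff\<close>). The decisive point is that, for the cone \<open>c\<close> of an epimorphism \<open>f\<close>, the
  relation \<open>c f = 0\<close> makes \<open>c\<close> a ghost, and exactness of \<open>Hom(R, -)\<close> then makes \<open>Hom(R, f)\<close> surjective.

  Two facts remain. Every object \<open>X\<close> receives a regular morphism from an object of \<open>\<C>(R)\<close>
  (\<open>two_term_coreflection\<close>), obtained from a two-step approximation of \<open>X\<close> by \<open>add R\<close>. And objects \<open>W\<close>
  of \<open>\<C>(R)\<close>, being presented by \<open>R\<^sub>1 \<rightarrow> R\<^sub>0 \<rightarrow> W\<close>, do not distinguish the two ends of a regular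
  morphism: it induces bijections on \<open>Hom(W, -)\<close> in the quotient (\<open>two_term_lift\<close>). So the inclusion
  has a right adjoint that inverts the regular morphisms and whose counit consists of regular
  morphisms. That the localisation is then equivalent to the subcategory is a general statement
  about categories (\<open>localisation_equivalence\<close>).
\<close>

section \<open>Categories and functors\<close>

lemma
  assumes "is_category C"
  shows category_Id: "X \<in> Obj C \<Longrightarrow> Id C X \<in> Hom C X X"
    and category_Comp: "\<lbrakk>f \<in> Hom C X Y; g \<in> Hom C Y Z; X \<in> Obj C; Y \<in> Obj C; Z \<in> Obj C\<rbrakk>
      \<Longrightarrow> Comp C X Y Z g f \<in> Hom C X Z"
    and category_Id_right: "\<lbrakk>f \<in> Hom C X Y; X \<in> Obj C; Y \<in> Obj C\<rbrakk> \<Longrightarrow> Comp C X X Y f (Id C X) = f"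
    and category_Id_left: "\<lbrakk>f \<in> Hom C X Y; X \<in> Obj C; Y \<in> Obj C\<rbrakk> \<Longrightarrow> Comp C X Y Y (Id C Y) f = f"
    and category_assoc: "\<lbrakk>f \<in> Hom C W X; g \<in> Hom C X Y; h \<in> Hom C Y Z;
        W \<in> Obj C; X \<in> Obj C; Y \<in> Obj C; Z \<in> Obj C\<rbrakk>
      \<Longrightarrow> Comp C W X Z (Comp C X Y Z h g) f = Comp C W Y Z h (Comp C W X Y g f)"
  using assms unfolding is_category_def by blast+

lemma
  assumes "is_functor A B F"
  shows functor_Obj: "X \<in> Obj A \<Longrightarrow> FObj F X \<in> Obj B"
    and functor_Hom: "\<lbrakk>f \<in> Hom A X Y; X \<in> Obj A; Y \<in> Obj A\<rbrakk>
      \<Longrightarrow> FMor F X Y f \<in> Hom B (FObj F X) (FObj F Y)"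
    and functor_Id: "X \<in> Obj A \<Longrightarrow> FMor F X X (Id A X) = Id B (FObj F X)"
    and functor_Comp: "\<lbrakk>f \<in> Hom A X Y; g \<in> Hom A Y Z; X \<in> Obj A; Y \<in> Obj A; Z \<in> Obj A\<rbrakk>
      \<Longrightarrow> FMor F X Z (Comp A X Y Z g f) =
        Comp B (FObj F X) (FObj F Y) (FObj F Z) (FMor F Y Z g) (FMor F X Y f)"
    and functor_source: "is_category A"
    and functor_target: "is_category B"
  using assms unfolding is_functor_def by blast+

lemma id_functor_simps [simp]: "FObj id_functor X = X" "FMor id_functor X Y f = f"
  by (simp_all add: id_functor_def)

lemma is_functor_id: "is_category A \<Longrightarrow> is_functor A A id_functor"
  by (simp add: is_functor_def id_functor_def)

lemma is_functor_comp:
  assumes "is_functor A B F" "is_functor B D G"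
  shows "is_functor A D (comp_functor G F)"
  unfolding is_functor_def comp_functor_def
  using functor_source[OF assms(1)] functor_target[OF assms(2)]
    functor_Obj[OF assms(1)] functor_Hom[OF assms(1)] functor_Id[OF assms(1)] functor_Comp[OF assms(1)]
    functor_Obj[OF assms(2)] functor_Hom[OF assms(2)] functor_Id[OF assms(2)] functor_Comp[OF assms(2)]
  by simp

definition inverse_morphism :: "('o, 'm, 'z) cat_scheme \<Rightarrow> 'o \<Rightarrow> 'o \<Rightarrow> 'm \<Rightarrow> 'm" where
  "inverse_morphism C X Y f = (SOME g. g \<in> Hom C Y X \<and>
     Comp C X Y X g f = Id C X \<and> Comp C Y X Y f g = Id C Y)"

lemma
  assumes "is_iso C X Y f"
  shows inverse_morphism_Hom: "inverse_morphism C X Y f \<in> Hom C Y X"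
    and inverse_morphism_left: "Comp C X Y X (inverse_morphism C X Y f) f = Id C X"
    and inverse_morphism_right: "Comp C Y X Y f (inverse_morphism C X Y f) = Id C Y"
  using someI_ex[of "\<lambda>g. g \<in> Hom C Y X \<and> Comp C X Y X g f = Id C X \<and> Comp C Y X Y f g = Id C Y"]
    assms
  unfolding is_iso_def inverse_morphism_def by blast+

lemma iso_cancel_right:
  assumes "is_category C" "is_iso C X Y f" "X \<in> Obj C" "Y \<in> Obj C" "Z \<in> Obj C"
    "g \<in> Hom C Y Z" "h \<in> Hom C Y Z" "Comp C X Y Z g f = Comp C X Y Z h f"
  shows "g = h"
proof -
  let ?i = "inverse_morphism C X Y f"
  have f: "f \<in> Hom C X Y" using assms(2) by (simp add: is_iso_def)
  have "g = Comp C Y X Z (Comp C X Y Z g f) ?i" "h = Comp C Y X Z (Comp C X Y Z h f) ?i"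
    using assms(1,3-7) f inverse_morphism_Hom[OF assms(2)] inverse_morphism_right[OF assms(2)]
    by (simp_all add: category_assoc category_Id_right)
  then show ?thesis using assms(8) by simp
qed

lemma iso_cancel_left:
  assumes "is_category C" "is_iso C Y Z f" "X \<in> Obj C" "Y \<in> Obj C" "Z \<in> Obj C"
    "g \<in> Hom C X Y" "h \<in> Hom C X Y" "Comp C X Y Z f g = Comp C X Y Z f h"
  shows "g = h"
proof -
  let ?i = "inverse_morphism C Y Z f"
  have f: "f \<in> Hom C Y Z" using assms(2) by (simp add: is_iso_def)
  have i: "Comp C X Z Y ?i (Comp C X Y Z f k) = k" if k: "k \<in> Hom C X Y" for k
    using category_assoc[OF assms(1) k f inverse_morphism_Hom[OF assms(2)]] assms(3-5)
      inverse_morphism_left[OF assms(2)] category_Id_left[OF assms(1) k] by simp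
  show ?thesis using HOL.trans[OF i[OF assms(6), unfolded assms(8), symmetric] i[OF assms(7)]] .
qed

text \<open>A functor isomorphic to the identity is faithful because the components of the isomorphism
  cancel; the two cases are the unit and the counit of an equivalence.\<close>

lemma natural_iso_id_faithful:
  assumes "natural_iso A A id_functor G \<eta> \<or> natural_iso A A G id_functor \<eta>"
    and "f \<in> Hom A X Y" "g \<in> Hom A X Y" "X \<in> Obj A" "Y \<in> Obj A" "FMor G X Y f = FMor G X Y g"
  shows "f = g"
  using assms(1)
proof
  assume n: "natural_iso A A id_functor G \<eta>"
  then have F: "is_functor A A G" and iso: "is_iso A Y (FObj G Y) (\<eta> Y)"
    and nat: "Comp A X Y (FObj G Y) (\<eta> Y) f = Comp A X (FObj G X) (FObj G Y) (FMor G X Y f) (\<eta> X)"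
      "Comp A X Y (FObj G Y) (\<eta> Y) g = Comp A X (FObj G X) (FObj G Y) (FMor G X Y g) (\<eta> X)"
    using assms(2-5) by (simp_all add: natural_iso_def)
  show ?thesis
    by (rule iso_cancel_left[OF functor_source[OF F] iso assms(4,5) _ assms(2,3)])
      (use nat assms(5,6) functor_Obj[OF F] in simp_all)
next
  assume n: "natural_iso A A G id_functor \<eta>"
  then have F: "is_functor A A G" and iso: "is_iso A (FObj G X) X (\<eta> X)"
    and nat: "Comp A (FObj G X) (FObj G Y) Y (\<eta> Y) (FMor G X Y f) = Comp A (FObj G X) X Y f (\<eta> X)"
      "Comp A (FObj G X) (FObj G Y) Y (\<eta> Y) (FMor G X Y g) = Comp A (FObj G X) X Y g (\<eta> X)"
    using assms(2-5) by (simp_all add: natural_iso_def)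
  show ?thesis
    by (rule iso_cancel_right[OF functor_source[OF F] iso _ assms(4,5,2,3)])
      (use nat assms(4,6) functor_Obj[OF F] in simp_all)
qed

text \<open>Fullness transports \<open>h\<close> along the unit: the candidate preimage \<open>f\<close> satisfies \<open>G F f = G h\<close>, and \<open>G\<close>
  is faithful because of the counit.\<close>

lemma equivalence_fully_faithful:
  assumes "is_equivalence A B F" "X \<in> Obj A" "Y \<in> Obj A"
  shows "bij_betw (FMor F X Y) (Hom A X Y) (Hom B (FObj F X) (FObj F Y))"
proof -
  obtain G \<eta> \<epsilon> where F: "is_functor A B F" and G: "is_functor B A G"
    and \<eta>: "natural_iso A A id_functor (comp_functor G F) \<eta>"
    and \<epsilon>: "natural_iso B B (comp_functor F G) id_functor \<epsilon>"
    using assms(1) unfolding is_equivalence_def by blast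
  note A = functor_source[OF F]
  have faithful: "f = g" if "f \<in> Hom A X Y" "g \<in> Hom A X Y" "FMor F X Y f = FMor F X Y g" for f g
    using natural_iso_id_faithful[OF disjI1[OF \<eta>] that(1,2) assms(2,3)] that(3)
    by (simp add: comp_functor_def)
  have o: "FObj F X \<in> Obj B" "FObj F Y \<in> Obj B" using functor_Obj[OF F] assms by simp_all
  have o': "FObj G (FObj F X) \<in> Obj A" "FObj G (FObj F Y) \<in> Obj A"
    using functor_Obj[OF G] o by simp_all
  have iX: "is_iso A X (FObj G (FObj F X)) (\<eta> X)" and iY: "is_iso A Y (FObj G (FObj F Y)) (\<eta> Y)"
    using \<eta> assms(2,3) by (simp_all add: natural_iso_def comp_functor_def)
  have full: "h \<in> FMor F X Y ` Hom A X Y" if h: "h \<in> Hom B (FObj F X) (FObj F Y)" for h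
  proof -
    let ?j = "inverse_morphism A Y (FObj G (FObj F Y)) (\<eta> Y)"
    let ?Gh = "FMor G (FObj F X) (FObj F Y) h"
    let ?k = "Comp A X (FObj G (FObj F X)) (FObj G (FObj F Y)) ?Gh (\<eta> X)"
    let ?f = "Comp A X (FObj G (FObj F Y)) Y ?j ?k"
    have \<eta>X: "\<eta> X \<in> Hom A X (FObj G (FObj F X))" and \<eta>Y: "\<eta> Y \<in> Hom A Y (FObj G (FObj F Y))"
      using iX iY by (simp_all add: is_iso_def)
    have Gh: "?Gh \<in> Hom A (FObj G (FObj F X)) (FObj G (FObj F Y))" using functor_Hom[OF G h o] .
    have k: "?k \<in> Hom A X (FObj G (FObj F Y))" using category_Comp[OF A \<eta>X Gh] o' assms by simp
    have f: "?f \<in> Hom A X Y" using category_Comp[OF A k inverse_morphism_Hom[OF iY]] o' assms by simp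
    have GFf: "FMor G (FObj F X) (FObj F Y) (FMor F X Y ?f)
        \<in> Hom A (FObj G (FObj F X)) (FObj G (FObj F Y))"
      using functor_Hom[OF G functor_Hom[OF F f assms(2,3)] o] .
    have "Comp A X Y (FObj G (FObj F Y)) (\<eta> Y) ?f = ?k"
      using category_assoc[OF A k inverse_morphism_Hom[OF iY] \<eta>Y] inverse_morphism_right[OF iY]
        category_Id_left[OF A k] assms o' by simp
    moreover have "Comp A X Y (FObj G (FObj F Y)) (\<eta> Y) ?f = Comp A X (FObj G (FObj F X))
        (FObj G (FObj F Y)) (FMor G (FObj F X) (FObj F Y) (FMor F X Y ?f)) (\<eta> X)"
      using \<eta> f assms(2,3) unfolding natural_iso_def by (simp add: comp_functor_def)
    ultimately have "FMor G (FObj F X) (FObj F Y) (FMor F X Y ?f) = ?Gh"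
      using iso_cancel_right[OF A iX assms(2) o' GFf Gh] by simp
    then have "FMor F X Y ?f = h"
      using natural_iso_id_faithful[OF disjI2[OF \<epsilon>] functor_Hom[OF F f assms(2,3)] h o]
      by (simp add: comp_functor_def)
    then show ?thesis using image_eqI[OF _ f, of h "FMor F X Y"] by simp
  qed
  show ?thesis
    unfolding bij_betw_def inj_on_def
    using faithful full functor_Hom[OF F _ assms(2,3)] by blast
qed

section \<open>Gabriel-Zisman localisation\<close>

lemma is_word_objects: "is_word C W X Y p \<Longrightarrow> X \<in> Obj C \<and> Y \<in> Obj C"
  by (induction C W X Y p rule: is_word.induct) auto

lemma is_word_append:
  "is_word C W X Z (p @ q) \<longleftrightarrow> (\<exists>Y. is_word C W X Y p \<and> is_word C W Y Z q)"
proof (induction p arbitrary: X)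
  case Nil
  then show ?case by (auto dest: is_word_objects)
next
  case (Cons l p)
  then show ?case by (cases l) auto
qed

lemma word_eq_is_word: "word_eq C W X Y p q \<Longrightarrow> is_word C W X Y p \<and> is_word C W X Y q"
  by (induction rule: word_eq.induct) simp_all

lemma word_eq_append_left:
  assumes "word_eq C W X Y p q" "is_word C W V X r"
  shows "word_eq C W V Y (r @ p) (r @ q)"
  using assms
proof (induction rule: word_eq.induct)
  case (step l r' p q)
  then have "is_word C W V Y ((r @ p) @ l @ q)" "is_word C W V Y ((r @ p) @ r' @ q)"
    by (metis append_assoc is_word_append)+
  from word_eq.step[OF step(1) this] show ?case by simp
next
  case (refl p)
  then have "is_word C W V Y (r @ p)" by (auto simp: is_word_append)
  then show ?case by (rule word_eq.refl)
next
  case (sym p q)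
  then show ?case by (simp add: word_eq.sym)
next
  case (trans p q r')
  then show ?case using word_eq.trans by meson
qed

lemma word_eq_append_right:
  assumes "word_eq C W X Y p q" "is_word C W Y V r"
  shows "word_eq C W X V (p @ r) (q @ r)"
  using assms
proof (induction rule: word_eq.induct)
  case (step l r' p q)
  then have "is_word C W X V (p @ l @ q @ r)" "is_word C W X V (p @ r' @ q @ r)"
    by (metis append_assoc is_word_append)+
  from word_eq.step[OF step(1) this] show ?case by simp
next
  case (refl p)
  then have "is_word C W X V (p @ r)" by (auto simp: is_word_append)
  then show ?case by (rule word_eq.refl)
next
  case (sym p q)
  then show ?case by (simp add: word_eq.sym)
next
  case (trans p q r')
  then show ?case using word_eq.trans by meson
qed

lemma word_class_eqI:
  assumes "word_eq C W X Y p q"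
  shows "word_class C W X Y p = word_class C W X Y q"
  unfolding word_class_def
  using word_eq.trans[OF assms] word_eq.trans[OF word_eq.sym[OF assms]] by auto

lemma localisation_simps [simp]:
  "Obj (localisation C W) = Obj C"
  "Hom (localisation C W) X Y = word_class C W X Y ` {p. is_word C W X Y p}"
  "Id (localisation C W) X = word_class C W X X []"
  by (simp_all add: localisation_def)

text \<open>The union in the definition of composition is over all representatives. It is a single class
  because the congruence is compatible with concatenation on both sides.\<close>

lemma localisation_Comp:
  assumes "is_word C W X Y p" "is_word C W Y Z q"
  shows "Comp (localisation C W) X Y Z (word_class C W Y Z q) (word_class C W X Y p)
    = word_class C W X Z (p @ q)"
proof -
  have "word_class C W X Z (p' @ q') = word_class C W X Z (p @ q)"
    if "q' \<in> word_class C W Y Z q" "p' \<in> word_class C W X Y p" for p' q'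
  proof -
    have p': "word_eq C W X Y p p'" and q': "word_eq C W Y Z q q'"
      using that by (simp_all add: word_class_def)
    have "word_eq C W X Z (p @ q) (p' @ q)"
      using word_eq_append_right[OF p' assms(2)] .
    moreover have "word_eq C W X Z (p' @ q) (p' @ q')"
      using word_eq_append_left[OF q'] word_eq_is_word[OF p'] by blast
    ultimately show ?thesis by (simp add: word_class_eqI)
  qed
  moreover have "p \<in> word_class C W X Y p" "q \<in> word_class C W Y Z q"
    using assms by (simp_all add: word_class_def word_eq.refl)
  ultimately have "(\<Union>q'\<in>word_class C W Y Z q. \<Union>p'\<in>word_class C W X Y p. word_class C W X Z (p' @ q'))
      = word_class C W X Z (p @ q)" by blast
  then show ?thesis by (simp add: localisation_def)
qed

lemma is_category_localisation: "is_category (localisation C W)"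
  unfolding is_category_def
proof (intro conjI ballI)
  fix X Y Z f g assume "f \<in> Hom (localisation C W) X Y" "g \<in> Hom (localisation C W) Y Z"
  then show "Comp (localisation C W) X Y Z g f \<in> Hom (localisation C W) X Z"
    by (force simp: localisation_Comp is_word_append)
next
  fix X Y f assume XY: "X \<in> Obj (localisation C W)" "Y \<in> Obj (localisation C W)"
    and "f \<in> Hom (localisation C W) X Y"
  then obtain p where p: "is_word C W X Y p" and f: "f = word_class C W X Y p" by auto
  show "Comp (localisation C W) X X Y f (Id (localisation C W) X) = f"
    "Comp (localisation C W) X Y Y (Id (localisation C W) Y) f = f"
    using localisation_Comp[of C W X X "[]" Y p] localisation_Comp[of C W X Y p Y "[]"] p XY
    by (simp_all add: f)
next
  fix V X Y Z f g h assume "f \<in> Hom (localisation C W) V X"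
    "g \<in> Hom (localisation C W) X Y" "h \<in> Hom (localisation C W) Y Z"
  then obtain p q r where w: "is_word C W V X p" "is_word C W X Y q" "is_word C W Y Z r"
    and [simp]: "f = word_class C W V X p" "g = word_class C W X Y q" "h = word_class C W Y Z r"
    by auto
  have "is_word C W V Y (p @ q)" "is_word C W X Z (q @ r)"
    using w unfolding is_word_append by blast+
  then show "Comp (localisation C W) V X Z (Comp (localisation C W) X Y Z h g) f =
      Comp (localisation C W) V Y Z h (Comp (localisation C W) V X Y g f)"
    using w by (simp add: localisation_Comp)
qed simp

lemma localisation_functor_simps [simp]:
  "FObj (localisation_functor C W) X = X"
  "FMor (localisation_functor C W) X Y f = word_class C W X Y [Fwd X Y f]"
  by (simp_all add: localisation_functor_def)

lemma is_functor_localisation_functor: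
  assumes C: "is_category C"
  shows "is_functor C (localisation C W) (localisation_functor C W)"
proof -
  have id: "word_class C W X X [Fwd X X (Id C X)] = word_class C W X X []" if "X \<in> Obj C" for X
    using word_eq.step[OF word_step.ident, of C W X X "[]" X "[]"] that category_Id[OF C that]
    by (auto intro!: word_class_eqI)
  have comp: "word_class C W X Z [Fwd X Z (Comp C X Y Z g f)]
      = word_class C W X Z [Fwd X Y f, Fwd Y Z g]"
    if "X \<in> Obj C" "Y \<in> Obj C" "Z \<in> Obj C" "f \<in> Hom C X Y" "g \<in> Hom C Y Z" for X Y Z f g
    using word_eq.step[OF word_step.comp, of C W X Z "[]" X Y f Z g "[]"] that
      category_Comp[OF C that(4,5,1-3)]
    by (auto intro!: word_class_eqI[symmetric])
  have "Comp (localisation C W) X Y Z (word_class C W Y Z [Fwd Y Z g]) (word_class C W X Y [Fwd X Y f])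
      = word_class C W X Z [Fwd X Y f, Fwd Y Z g]"
    if "X \<in> Obj C" "Y \<in> Obj C" "Z \<in> Obj C" "f \<in> Hom C X Y" "g \<in> Hom C Y Z" for X Y Z f g
    using localisation_Comp[of C W X Y "[Fwd X Y f]" Z "[Fwd Y Z g]"] that by simp
  then show ?thesis
    unfolding is_functor_def using C is_category_localisation id comp by auto
qed

lemma
  assumes "(X, Y, s) \<in> W" "X \<in> Obj C" "Y \<in> Obj C" "s \<in> Hom C X Y"
  shows localisation_inverse_left: "Comp (localisation C W) X Y X
      (word_class C W Y X [Bwd X Y s]) (word_class C W X Y [Fwd X Y s]) = word_class C W X X []"
    and localisation_inverse_right: "Comp (localisation C W) Y X Y
      (word_class C W X Y [Fwd X Y s]) (word_class C W Y X [Bwd X Y s]) = word_class C W Y Y []"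
proof -
  have "word_eq C W X X [Fwd X Y s, Bwd X Y s] []"
    using word_eq.step[OF word_step.inv_right, of C W X X "[]" X Y s "[]"] assms by simp
  then show "Comp (localisation C W) X Y X
      (word_class C W Y X [Bwd X Y s]) (word_class C W X Y [Fwd X Y s]) = word_class C W X X []"
    using localisation_Comp[of C W X Y "[Fwd X Y s]" X "[Bwd X Y s]"] assms
    by (simp add: word_class_eqI)
  have "word_eq C W Y Y [Bwd X Y s, Fwd X Y s] []"
    using word_eq.step[OF word_step.inv_left, of C W Y Y "[]" X Y s "[]"] assms by simp
  then show "Comp (localisation C W) Y X Y
      (word_class C W X Y [Fwd X Y s]) (word_class C W Y X [Bwd X Y s]) = word_class C W Y Y []"
    using localisation_Comp[of C W Y X "[Bwd X Y s]" Y "[Fwd X Y s]"] assms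
    by (simp add: word_class_eqI)
qed

lemma localisation_inverts:
  assumes "(X, Y, s) \<in> W" "X \<in> Obj C" "Y \<in> Obj C" "s \<in> Hom C X Y"
  shows "is_iso (localisation C W) X Y (FMor (localisation_functor C W) X Y s)"
proof -
  have "word_class C W Y X [Bwd X Y s] \<in> Hom (localisation C W) Y X" using assms by simp
  moreover have "word_class C W X Y [Fwd X Y s] \<in> Hom (localisation C W) X Y" using assms by simp
  ultimately show ?thesis
    unfolding is_iso_def localisation_functor_simps
    using localisation_inverse_left[OF assms] localisation_inverse_right[OF assms]
    by (metis localisation_simps(3))
qed

text \<open>The value in \<open>D\<close> of a word ending at \<open>Y\<close>, when \<open>G\<close> sends the formally inverted morphisms to
  isomorphisms. The target is a parameter because the empty word does not record it.\<close>

fun word_value ::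
  "('c, 'd, 'z) cat_scheme \<Rightarrow> ('o, 'm, 'c, 'd) cfunctor \<Rightarrow> 'o \<Rightarrow> ('o, 'm) letter list \<Rightarrow> 'd" where
  "word_value D G Y [] = Id D (FObj G Y)"
| "word_value D G Y (Fwd A B f # p) =
     Comp D (FObj G A) (FObj G B) (FObj G Y) (word_value D G Y p) (FMor G A B f)"
| "word_value D G Y (Bwd A B s # p) =
     Comp D (FObj G B) (FObj G A) (FObj G Y) (word_value D G Y p)
       (inverse_morphism D (FObj G A) (FObj G B) (FMor G A B s))"

text \<open>The existence half of the universal property. Evaluating words respects each of the four
  generating relations, so the value depends only on the class of the word.\<close>

lemma localisation_extension:
  assumes G: "is_functor C D G"
    and inv: "\<And>X Y s. \<lbrakk>(X, Y, s) \<in> W; X \<in> Obj C; Y \<in> Obj C; s \<in> Hom C X Y\<rbrakk>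
      \<Longrightarrow> is_iso D (FObj G X) (FObj G Y) (FMor G X Y s)"
  obtains H where "is_functor (localisation C W) D H"
    "\<And>X. FObj H X = FObj G X"
    "\<And>X Y f. \<lbrakk>X \<in> Obj C; Y \<in> Obj C; f \<in> Hom C X Y\<rbrakk>
      \<Longrightarrow> FMor H X Y (FMor (localisation_functor C W) X Y f) = FMor G X Y f"
proof -
  note C = functor_source[OF G] and D = functor_target[OF G]
  note dc = category_Id[OF D] category_Comp[OF D] category_Id_left[OF D] category_Id_right[OF D]
    functor_Obj[OF G] functor_Hom[OF G]
  have hom: "word_value D G Y p \<in> Hom D (FObj G X) (FObj G Y)" if "is_word C W X Y p" for X Y p
    using that
  proof (induction p arbitrary: X)
    case Nil
    then show ?case using dc by auto
  next
    case (Cons l p)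
    show ?case
    proof (cases l)
      case (Fwd A B f)
      then show ?thesis using Cons is_word_objects[of C W B Y p] by (auto intro!: dc)
    next
      case (Bwd A B s)
      then show ?thesis
        using Cons is_word_objects[of C W A Y p] by (auto intro!: dc inverse_morphism_Hom inv)
    qed
  qed
  have append: "word_value D G Z (p @ q) = Comp D (FObj G X) (FObj G Y) (FObj G Z)
      (word_value D G Z q) (word_value D G Y p)"
    if "is_word C W X Y p" "is_word C W Y Z q" for X Y Z p q
    using that
  proof (induction p arbitrary: X)
    case Nil
    then show ?case using dc(4)[OF hom] dc(5) is_word_objects[of C W Y Z q] by auto
  next
    case (Cons l p)
    note q = hom[OF Cons.prems(2)] and Z = is_word_objects[OF Cons.prems(2)]
    show ?case
    proof (cases l)
      case (Fwd A B f)
      then have p: "is_word C W B Y p" and [simp]: "X = A" and A: "A \<in> Obj C" "B \<in> Obj C"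
        and f: "f \<in> Hom C A B" using Cons.prems(1) by auto
      show ?thesis
        using Cons.IH[OF p Cons.prems(2)] category_assoc[OF D dc(6)[OF f A] hom[OF p] q] A Z
        by (simp add: Fwd dc(5))
    next
      case (Bwd A B s)
      then have p: "is_word C W A Y p" and [simp]: "X = B" and A: "A \<in> Obj C" "B \<in> Obj C"
        and s: "is_iso D (FObj G A) (FObj G B) (FMor G A B s)" using Cons.prems(1) inv by auto
      show ?thesis
        using Cons.IH[OF p Cons.prems(2)] A Z
          category_assoc[OF D inverse_morphism_Hom[OF s] hom[OF p] q]
        by (simp add: Bwd dc(5))
    qed
  qed
  have cong: "word_value D G Y (p @ a) = word_value D G Y (p @ b)"
    if "word_value D G Y a = word_value D G Y b" for Y p a b
  proof (induction p)
    case (Cons l p)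
    then show ?case by (cases l) simp_all
  qed (simp add: that)
  have relation: "word_value D G Y (l @ q) = word_value D G Y (r @ q)"
    if "word_step C W l r" "is_word C W X Y (l @ q)" for l r X Y q
    using that
  proof (induction rule: word_step.induct)
    case (ident V)
    then have q: "is_word C W V Y q" by simp
    show ?case using is_word_objects[OF q] dc(4)[OF hom[OF q]] functor_Id[OF G] dc(5) by simp
  next
    case (comp A B f E g)
    then have q: "is_word C W E Y q" and A: "A \<in> Obj C" "B \<in> Obj C" "E \<in> Obj C"
      and f: "f \<in> Hom C A B" and g: "g \<in> Hom C B E" by auto
    show ?case
      using category_assoc[OF D dc(6)[OF f] dc(6)[OF g] hom[OF q]] functor_Comp[OF G f g] A
        is_word_objects[OF q] by (simp add: dc(5))
  next
    case (inv_right A B s)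
    then have q: "is_word C W A Y q" and A: "A \<in> Obj C" "B \<in> Obj C" and s: "s \<in> Hom C A B"
      and i: "is_iso D (FObj G A) (FObj G B) (FMor G A B s)" using inv by auto
    show ?case
      using category_assoc[OF D dc(6)[OF s] inverse_morphism_Hom[OF i] hom[OF q]] A
        is_word_objects[OF q] inverse_morphism_left[OF i] dc(4)[OF hom[OF q]] by (simp add: dc(5))
  next
    case (inv_left A B s)
    then have q: "is_word C W B Y q" and A: "A \<in> Obj C" "B \<in> Obj C" and s: "s \<in> Hom C A B"
      and i: "is_iso D (FObj G A) (FObj G B) (FMor G A B s)" using inv by auto
    show ?case
      using category_assoc[OF D inverse_morphism_Hom[OF i] dc(6)[OF s] hom[OF q]] A
        is_word_objects[OF q] inverse_morphism_right[OF i] dc(4)[OF hom[OF q]] by (simp add: dc(5))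
  qed
  have value_eq: "word_value D G Y p = word_value D G Y q" if "word_eq C W X Y p q" for X Y p q
    using that
  proof (induction rule: word_eq.induct)
    case (step l r p q)
    then obtain V where "is_word C W V Y (l @ q)" unfolding is_word_append[of C W X Y p] by blast
    then show ?case using cong[OF relation[OF step(1)]] by blast
  qed simp_all
  define H where "H = \<lparr>FObj = FObj G, FMor = (\<lambda>X Y \<phi>. word_value D G Y (SOME p. p \<in> \<phi>))\<rparr>"
  have H: "FMor H X Y (word_class C W X Y p) = word_value D G Y p" if "is_word C W X Y p" for X Y p
  proof -
    have "p \<in> word_class C W X Y p" using that by (simp add: word_class_def word_eq.refl)
    then have "(SOME q. q \<in> word_class C W X Y p) \<in> word_class C W X Y p" by (rule someI)
    then have "word_eq C W X Y p (SOME q. q \<in> word_class C W X Y p)" unfolding word_class_def by blast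
    from value_eq[OF this] show ?thesis by (simp add: H_def)
  qed
  show thesis
  proof (rule that)
    show "FObj H X = FObj G X" for X by (simp add: H_def)
    show "FMor H X Y (FMor (localisation_functor C W) X Y f) = FMor G X Y f"
      if "X \<in> Obj C" "Y \<in> Obj C" "f \<in> Hom C X Y" for X Y f
      using that H[of X Y "[Fwd X Y f]"] by (simp add: dc)
    show "is_functor (localisation C W) D H"
      unfolding is_functor_def
    proof (intro conjI ballI)
      show "FMor H X X (Id (localisation C W) X) = Id D (FObj H X)"
        if "X \<in> Obj (localisation C W)" for X
        using that H[of X X "[]"] by (simp add: H_def)
      show "FMor H X Y f \<in> Hom D (FObj H X) (FObj H Y)"
        if "f \<in> Hom (localisation C W) X Y" for X Y f
        using that hom H by (auto simp: H_def)
      show "FMor H X Z (Comp (localisation C W) X Y Z g f) =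
          Comp D (FObj H X) (FObj H Y) (FObj H Z) (FMor H Y Z g) (FMor H X Y f)"
        if fg: "f \<in> Hom (localisation C W) X Y" "g \<in> Hom (localisation C W) Y Z" for X Y Z f g
      proof -
        obtain p q where pq: "is_word C W X Y p" "is_word C W Y Z q"
          and [simp]: "f = word_class C W X Y p" "g = word_class C W Y Z q" using fg by auto
        then have "is_word C W X Z (p @ q)" by (auto simp: is_word_append)
        then show ?thesis using pq append[OF pq] by (simp add: localisation_Comp H) (simp add: H_def)
      qed
    qed (simp_all add: is_category_localisation D dc H_def)
  qed
qed

text \<open>The two-dimensional half of the universal property. Every morphism of the localisation is a
  composite of images of morphisms of \<open>C\<close> and of inverses of such images, and a naturality square
  stays commutative when its horizontal arrows are composed or inverted.\<close>

lemma localisation_natural: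
  assumes C: "is_category C"
    and M: "is_functor (localisation C W) D M" and N: "is_functor (localisation C W) D N"
    and \<epsilon>: "\<And>X. X \<in> Obj C \<Longrightarrow> \<epsilon> X \<in> Hom D (FObj M X) (FObj N X)"
    and nat: "\<And>X Y f. \<lbrakk>X \<in> Obj C; Y \<in> Obj C; f \<in> Hom C X Y\<rbrakk> \<Longrightarrow>
      Comp D (FObj M X) (FObj M Y) (FObj N Y) (\<epsilon> Y) (FMor M X Y (FMor (localisation_functor C W) X Y f)) =
      Comp D (FObj M X) (FObj N X) (FObj N Y) (FMor N X Y (FMor (localisation_functor C W) X Y f)) (\<epsilon> X)"
    and \<phi>: "\<phi> \<in> Hom (localisation C W) X Y"
  shows "Comp D (FObj M X) (FObj M Y) (FObj N Y) (\<epsilon> Y) (FMor M X Y \<phi>) =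
      Comp D (FObj M X) (FObj N X) (FObj N Y) (FMor N X Y \<phi>) (\<epsilon> X)"
proof -
  let ?L = "localisation C W" and ?cl = "word_class C W"
  note D = functor_target[OF M]
  have MO: "FObj M X \<in> Obj D" and NO: "FObj N X \<in> Obj D" if "X \<in> Obj C" for X
    using functor_Obj[OF M] functor_Obj[OF N] that by simp_all
  have MH: "FMor M X Y f \<in> Hom D (FObj M X) (FObj M Y)" and NH: "FMor N X Y f \<in> Hom D (FObj N X) (FObj N Y)"
    if "f \<in> Hom ?L X Y" "X \<in> Obj C" "Y \<in> Obj C" for X Y f
    using functor_Hom[OF M] functor_Hom[OF N] that by simp_all
  define P where "P X Y f \<longleftrightarrow> Comp D (FObj M X) (FObj M Y) (FObj N Y) (\<epsilon> Y) (FMor M X Y f) =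
      Comp D (FObj M X) (FObj N X) (FObj N Y) (FMor N X Y f) (\<epsilon> X)" for X Y f
  have P_comp: "P X Z (Comp ?L X Y Z g f)"
    if "f \<in> Hom ?L X Y" "g \<in> Hom ?L Y Z" and o: "X \<in> Obj C" "Y \<in> Obj C" "Z \<in> Obj C" "P X Y f" "P Y Z g"
    for X Y Z f g
  proof -
    note fg = MH[OF that(1)] MH[OF that(2)] NH[OF that(1)] NH[OF that(2)]
    have "Comp D (FObj M X) (FObj M Z) (FObj N Z) (\<epsilon> Z)
        (Comp D (FObj M X) (FObj M Y) (FObj M Z) (FMor M Y Z g) (FMor M X Y f)) =
        Comp D (FObj M X) (FObj M Y) (FObj N Z)
          (Comp D (FObj M Y) (FObj M Z) (FObj N Z) (\<epsilon> Z) (FMor M Y Z g)) (FMor M X Y f)"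
      using category_assoc[OF D fg(1,2) \<epsilon>] o MO NO by simp
    also have "\<dots> = Comp D (FObj M X) (FObj M Y) (FObj N Z)
          (Comp D (FObj M Y) (FObj N Y) (FObj N Z) (FMor N Y Z g) (\<epsilon> Y)) (FMor M X Y f)"
      using o(5) by (simp add: P_def)
    also have "\<dots> = Comp D (FObj M X) (FObj N Y) (FObj N Z) (FMor N Y Z g)
          (Comp D (FObj M X) (FObj M Y) (FObj N Y) (\<epsilon> Y) (FMor M X Y f))"
      using category_assoc[OF D fg(1) \<epsilon> fg(4)] o MO NO by simp
    also have "\<dots> = Comp D (FObj M X) (FObj N Y) (FObj N Z) (FMor N Y Z g)
          (Comp D (FObj M X) (FObj N X) (FObj N Y) (FMor N X Y f) (\<epsilon> X))"
      using o(4) by (simp add: P_def)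
    also have "\<dots> = Comp D (FObj M X) (FObj N X) (FObj N Z)
        (Comp D (FObj N X) (FObj N Y) (FObj N Z) (FMor N Y Z g) (FMor N X Y f)) (\<epsilon> X)"
      using category_assoc[OF D \<epsilon> fg(3,4)] o MO NO by simp
    finally show ?thesis
      using functor_Comp[OF M that(1,2)] functor_Comp[OF N that(1,2)] o by (simp add: P_def)
  qed
  have P_id: "P X X (?cl X X [])" if "X \<in> Obj C" for X
    using that functor_Id[OF M, of X] functor_Id[OF N, of X] \<epsilon>[OF that] MO NO D
    by (simp add: P_def category_Id_left category_Id_right)
  have P_fwd: "P X Y (?cl X Y [Fwd X Y f])" if "X \<in> Obj C" "Y \<in> Obj C" "f \<in> Hom C X Y" for X Y f
    using nat[OF that] by (simp add: P_def)
  have P_bwd: "P Y X (?cl Y X [Bwd X Y s])"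
    if o: "X \<in> Obj C" "Y \<in> Obj C" and s: "s \<in> Hom C X Y" "(X, Y, s) \<in> W" for X Y s
  proof -
    let ?s = "?cl X Y [Fwd X Y s]" and ?t = "?cl Y X [Bwd X Y s]"
    have st: "?s \<in> Hom ?L X Y" "?t \<in> Hom ?L Y X" using o s by simp_all
    note inv = localisation_inverse_left[OF s(2) o s(1)] localisation_inverse_right[OF s(2) o s(1)]
    note m = MH[OF st(1) o] MH[OF st(2) o(2,1)] NH[OF st(1) o] NH[OF st(2) o(2,1)]
    have Mi: "Comp D (FObj M Y) (FObj M X) (FObj M Y) (FMor M X Y ?s) (FMor M Y X ?t) = Id D (FObj M Y)"
      using functor_Comp[OF M st(2,1)] functor_Id[OF M, of Y] o inv by simp
    have Ni: "Comp D (FObj N X) (FObj N Y) (FObj N X) (FMor N Y X ?t) (FMor N X Y ?s) = Id D (FObj N X)"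
      using functor_Comp[OF N st(1,2)] functor_Id[OF N, of X] o inv by simp
    have "Comp D (FObj M Y) (FObj M X) (FObj N X) (\<epsilon> X) (FMor M Y X ?t)
        = Comp D (FObj M Y) (FObj N X) (FObj N X)
          (Comp D (FObj N X) (FObj N Y) (FObj N X) (FMor N Y X ?t) (FMor N X Y ?s))
          (Comp D (FObj M Y) (FObj M X) (FObj N X) (\<epsilon> X) (FMor M Y X ?t))"
      using Ni category_Id_left[OF D category_Comp[OF D m(2) \<epsilon>]] o MO NO by simp
    also have "\<dots> = Comp D (FObj M Y) (FObj N Y) (FObj N X) (FMor N Y X ?t)
        (Comp D (FObj M Y) (FObj M X) (FObj N Y)
          (Comp D (FObj M X) (FObj N X) (FObj N Y) (FMor N X Y ?s) (\<epsilon> X)) (FMor M Y X ?t))"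
      using category_assoc[OF D category_Comp[OF D m(2) \<epsilon>] m(3,4)] category_assoc[OF D m(2) \<epsilon> m(3)]
        o MO NO by simp
    also have "\<dots> = Comp D (FObj M Y) (FObj N Y) (FObj N X) (FMor N Y X ?t)
        (Comp D (FObj M Y) (FObj M X) (FObj N Y)
          (Comp D (FObj M X) (FObj M Y) (FObj N Y) (\<epsilon> Y) (FMor M X Y ?s)) (FMor M Y X ?t))"
      using P_fwd[OF o s(1)] by (simp add: P_def)
    also have "\<dots> = Comp D (FObj M Y) (FObj N Y) (FObj N X) (FMor N Y X ?t) (\<epsilon> Y)"
      using category_assoc[OF D m(2,1) \<epsilon>] Mi category_Id_right[OF D \<epsilon>] o MO NO by simp
    finally show ?thesis by (simp add: P_def)
  qed
  have "P X Y (?cl X Y p)" if "is_word C W X Y p" for X p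
    using that
  proof (induction p arbitrary: X)
    case Nil
    then show ?case using P_id by auto
  next
    case (Cons l p)
    obtain V where l: "is_word C W X V [l]" and p: "is_word C W V Y p"
      using Cons.prems is_word_append[of C W X Y "[l]" p] by auto
    have "P X V (?cl X V [l])" using l P_fwd P_bwd by (cases l) auto
    then show ?case
      using P_comp[of "?cl X V [l]" X V "?cl V Y p" Y] localisation_Comp[OF l p] Cons.IH[OF p] l p
        is_word_objects[OF l] is_word_objects[OF p] by auto
  qed
  then show ?thesis using \<phi> by (auto simp: P_def)
qed

section \<open>Localisations equivalent to a coreflective subcategory\<close>

text \<open>The hypotheses say that \<open>F\<close> is fully faithful, that its objects see morphisms of \<open>S\<close> as bijections,
  and that each \<open>X\<close> admits some \<open>s\<^sub>X : F V \<rightarrow> X\<close> in \<open>S\<close>. Composition with \<open>s\<^sub>X\<close> then identifies \<open>Hom(W, V)\<close> with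
  \<open>Hom(F W, X)\<close>, so \<open>X \<mapsto> V\<close> extends to a right adjoint \<open>G\<close> of \<open>F\<close> with counit \<open>s\<close>. It inverts \<open>S\<close>,
  hence extends to the localisation. The unit is invertible since \<open>F\<close> is fully faithful, and the
  counit becomes invertible in the localisation because its components lie in \<open>S\<close>.\<close>

lemma localisation_equivalence:
  assumes F: "is_functor P Q F"
    and ff: "\<And>V W. \<lbrakk>V \<in> Obj P; W \<in> Obj P\<rbrakk>
      \<Longrightarrow> bij_betw (FMor F V W) (Hom P V W) (Hom Q (FObj F V) (FObj F W))"
    and S: "\<And>X Y f. (X, Y, f) \<in> S \<Longrightarrow> X \<in> Obj Q \<and> Y \<in> Obj Q \<and> f \<in> Hom Q X Y"
    and local: "\<And>X Y f W. \<lbrakk>(X, Y, f) \<in> S; W \<in> Obj P\<rbrakk>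
      \<Longrightarrow> bij_betw (Comp Q (FObj F W) X Y f) (Hom Q (FObj F W) X) (Hom Q (FObj F W) Y)"
    and enough: "\<And>X. X \<in> Obj Q \<Longrightarrow> \<exists>V\<in>Obj P. \<exists>s. (FObj F V, X, s) \<in> S"
  shows "is_equivalence P (localisation Q S) (comp_functor (localisation_functor Q S) F)"
proof -
  note P = functor_source[OF F] and Q = functor_target[OF F]
  note FO = functor_Obj[OF F] and FH = functor_Hom[OF F]
  let ?L = "localisation_functor Q S" and ?QS = "localisation Q S"
  note L = is_functor_localisation_functor[OF Q, of S]
  have "\<exists>V s. V \<in> Obj P \<and> (FObj F V, X, s) \<in> S" if "X \<in> Obj Q" for X
    using enough[OF that] by blast
  then obtain A s where A: "\<And>X. X \<in> Obj Q \<Longrightarrow> A X \<in> Obj P"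
    and sS: "\<And>X. X \<in> Obj Q \<Longrightarrow> (FObj F (A X), X, s X) \<in> S" by metis
  have s: "s X \<in> Hom Q (FObj F (A X)) X" if "X \<in> Obj Q" for X using S sS that by blast
  \<comment> \<open>The adjunction bijection.\<close>
  define \<phi> where "\<phi> W X g = Comp Q (FObj F W) (FObj F (A X)) X (s X) (FMor F W (A X) g)" for W X g
  have \<phi>_bij: "bij_betw (\<phi> W X) (Hom P W (A X)) (Hom Q (FObj F W) X)"
    if "W \<in> Obj P" "X \<in> Obj Q" for W X
    using bij_betw_trans[OF ff[OF that(1) A[OF that(2)]] local[OF sS[OF that(2)] that(1)]]
    by (simp add: \<phi>_def[abs_def] comp_def)
  define lift where "lift W X h = inv_into (Hom P W (A X)) (\<phi> W X) h" for W X h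
  have lift: "lift W X h \<in> Hom P W (A X)" "\<phi> W X (lift W X h) = h"
    if "h \<in> Hom Q (FObj F W) X" "W \<in> Obj P" "X \<in> Obj Q" for W X h
    using \<phi>_bij[OF that(2,3)] that(1) inv_into_into[of h "\<phi> W X"] f_inv_into_f[of h "\<phi> W X"]
    unfolding lift_def bij_betw_def by blast+
  have \<phi>_inj: "g = h" if "\<phi> W X g = \<phi> W X h" "g \<in> Hom P W (A X)" "h \<in> Hom P W (A X)"
    "W \<in> Obj P" "X \<in> Obj Q" for W X g h
    using \<phi>_bij[OF that(4,5)] that(1-3) unfolding bij_betw_def inj_on_def by blast
  have \<phi>_comp: "\<phi> V X (Comp P V W (A X) g k) = Comp Q (FObj F V) (FObj F W) X (\<phi> W X g) (FMor F V W k)"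
    if "k \<in> Hom P V W" "g \<in> Hom P W (A X)" "V \<in> Obj P" "W \<in> Obj P" "X \<in> Obj Q" for V W X g k
    using category_assoc[OF Q FH[OF that(1)] FH[OF that(2)] s[OF that(5)]]
      functor_Comp[OF F that(1,2)] that A FO by (simp add: \<phi>_def)
  have \<phi>_id: "\<phi> (A X) X (Id P (A X)) = s X" if "X \<in> Obj Q" for X
    using category_Id_right[OF Q s[OF that]] functor_Id[OF F A[OF that]] FO A that by (simp add: \<phi>_def)
  define G where "G = \<lparr>FObj = A, FMor = (\<lambda>X Y f. lift (A X) Y (Comp Q (FObj F (A X)) X Y f (s X)))\<rparr>"
  have G_Obj [simp]: "FObj G X = A X" for X by (simp add: G_def)
  have G_Hom: "FMor G X Y f \<in> Hom P (A X) (A Y)"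
    and G_nat: "\<phi> (A X) Y (FMor G X Y f) = Comp Q (FObj F (A X)) X Y f (s X)"
    if "f \<in> Hom Q X Y" "X \<in> Obj Q" "Y \<in> Obj Q" for X Y f
    using lift[OF category_Comp[OF Q s[OF that(2)] that(1)]] that A FO by (simp_all add: G_def)
  have G: "is_functor Q P G"
    unfolding is_functor_def
  proof (intro conjI ballI)
    show "FMor G X X (Id Q X) = Id P (FObj G X)" if "X \<in> Obj Q" for X
    proof -
      have "\<phi> (A X) X (FMor G X X (Id Q X)) = \<phi> (A X) X (Id P (A X))"
        using G_nat[OF category_Id[OF Q that] that that] category_Id_left[OF Q s[OF that]]
          \<phi>_id that A FO by simp
      then show ?thesis
        using \<phi>_inj G_Hom[OF category_Id[OF Q that]] category_Id[OF P] A that by auto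
    qed
    show "FMor G X Z (Comp Q X Y Z g f) =
        Comp P (FObj G X) (FObj G Y) (FObj G Z) (FMor G Y Z g) (FMor G X Y f)"
      if o: "X \<in> Obj Q" "Y \<in> Obj Q" "Z \<in> Obj Q" and f: "f \<in> Hom Q X Y" and g: "g \<in> Hom Q Y Z"
      for X Y Z f g
    proof -
      note Gf = G_Hom[OF f o(1,2)] and Gg = G_Hom[OF g o(2,3)]
      have "\<phi> (A X) Z (Comp P (A X) (A Y) (A Z) (FMor G Y Z g) (FMor G X Y f)) =
          Comp Q (FObj F (A X)) (FObj F (A Y)) Z (Comp Q (FObj F (A Y)) Y Z g (s Y))
            (FMor F (A X) (A Y) (FMor G X Y f))"
        using \<phi>_comp[OF Gf Gg] G_nat[OF g] o A by simp
      also have "\<dots> = Comp Q (FObj F (A X)) Y Z g (Comp Q (FObj F (A X)) X Y f (s X))"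
        using category_assoc[OF Q FH[OF Gf] s g] G_nat[OF f o(1,2)] o A FO by (simp add: \<phi>_def)
      also have "\<dots> = \<phi> (A X) Z (FMor G X Z (Comp Q X Y Z g f))"
        using category_assoc[OF Q s f g] G_nat[OF category_Comp[OF Q f g]] o A FO by simp
      finally show ?thesis
        using \<phi>_inj category_Comp[OF P Gf Gg] G_Hom[OF category_Comp[OF Q f g]] o A
        unfolding G_Obj by metis
    qed
  qed (simp_all add: P Q A G_Hom)
  have G_inverts: "is_iso P (FObj G X) (FObj G Y) (FMor G X Y f)" if "(X, Y, f) \<in> S" for X Y f
  proof -
    have o: "X \<in> Obj Q" "Y \<in> Obj Q" and f: "f \<in> Hom Q X Y" using S[OF that] by auto
    note Gf = G_Hom[OF f o]
    have "s Y \<in> Comp Q (FObj F (A Y)) X Y f ` Hom Q (FObj F (A Y)) X"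
      using local[OF that A[OF o(2)]] s[OF o(2)] unfolding bij_betw_def by simp
    then obtain k where k: "k \<in> Hom Q (FObj F (A Y)) X" "Comp Q (FObj F (A Y)) X Y f k = s Y"
      by auto
    define h where "h = lift (A Y) X k"
    have h: "h \<in> Hom P (A Y) (A X)" "\<phi> (A Y) X h = k" using lift[OF k(1)] A o by (simp_all add: h_def)
    have "\<phi> (A Y) Y (Comp P (A Y) (A X) (A Y) (FMor G X Y f) h) = s Y"
      using \<phi>_comp[OF h(1) Gf] G_nat[OF f o] category_assoc[OF Q FH[OF h(1)] s f] h(2) k(2) o A FO
      by (simp add: \<phi>_def)
    then have r: "Comp P (A Y) (A X) (A Y) (FMor G X Y f) h = Id P (A Y)"
      using \<phi>_inj \<phi>_id category_Comp[OF P h(1) Gf] category_Id[OF P] o A by metis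
    have "Comp Q (FObj F (A X)) X Y f (\<phi> (A X) X (Comp P (A X) (A Y) (A X) h (FMor G X Y f)))
      = Comp Q (FObj F (A X)) X Y f (Comp Q (FObj F (A X)) (FObj F (A Y)) X k (FMor F (A X) (A Y) (FMor G X Y f)))"
      using \<phi>_comp[OF Gf h(1)] h(2) o A by simp
    also have "\<dots> = \<phi> (A X) Y (FMor G X Y f)"
      using category_assoc[OF Q FH[OF Gf] k(1) f] k(2) o A FO by (simp add: \<phi>_def)
    finally have "Comp Q (FObj F (A X)) X Y f (\<phi> (A X) X (Comp P (A X) (A Y) (A X) h (FMor G X Y f)))
      = Comp Q (FObj F (A X)) X Y f (s X)" using G_nat[OF f o] by simp
    moreover have "\<phi> (A X) X (Comp P (A X) (A Y) (A X) h (FMor G X Y f)) \<in> Hom Q (FObj F (A X)) X"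
      using bij_betwE[OF \<phi>_bij[of "A X" X]] category_Comp[OF P Gf h(1)] o A by blast
    ultimately have "\<phi> (A X) X (Comp P (A X) (A Y) (A X) h (FMor G X Y f)) = s X"
      using local[OF that A[OF o(1)]] s[OF o(1)] unfolding bij_betw_def inj_on_def by blast
    then have "Comp P (A X) (A Y) (A X) h (FMor G X Y f) = Id P (A X)"
      using \<phi>_inj \<phi>_id category_Comp[OF P Gf h(1)] category_Id[OF P] o A by metis
    then show ?thesis using r h Gf unfolding is_iso_def G_Obj by blast
  qed
  obtain H where H: "is_functor ?QS P H" and H_Obj: "\<And>X. FObj H X = A X"
    and H_L: "\<And>X Y f. \<lbrakk>X \<in> Obj Q; Y \<in> Obj Q; f \<in> Hom Q X Y\<rbrakk> \<Longrightarrow> FMor H X Y (FMor ?L X Y f) = FMor G X Y f"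
    using localisation_extension[OF G, of S] G_inverts by auto
  have LF: "is_functor P ?QS (comp_functor ?L F)" using is_functor_comp[OF F L] .
  define \<eta> where "\<eta> W = lift W (FObj F W) (Id Q (FObj F W))" for W
  have \<eta>: "\<eta> W \<in> Hom P W (A (FObj F W))" "\<phi> W (FObj F W) (\<eta> W) = Id Q (FObj F W)" if "W \<in> Obj P" for W
    using lift[OF category_Id[OF Q FO[OF that]] that FO[OF that]] by (simp_all add: \<eta>_def)
  have \<eta>_iso: "is_iso P W (A (FObj F W)) (\<eta> W)" if W: "W \<in> Obj P" for W
  proof -
    let ?X = "FObj F W"
    have X: "?X \<in> Obj Q" "A ?X \<in> Obj P" using FO A W by simp_all
    \<comment> \<open>The counit at an object in the image of \<open>F\<close> comes from \<open>P\<close> by fullness; it is inverse to the unit.\<close>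
    have "s ?X \<in> FMor F (A ?X) W ` Hom P (A ?X) W"
      using ff[OF X(2) W] s[OF X(1)] unfolding bij_betw_def by simp
    then obtain \<theta> where \<theta>: "\<theta> \<in> Hom P (A ?X) W" "FMor F (A ?X) W \<theta> = s ?X" by auto
    have "\<phi> (A ?X) ?X (Comp P (A ?X) W (A ?X) (\<eta> W) \<theta>) = s ?X"
      using \<phi>_comp[OF \<theta>(1) \<eta>(1)[OF W]] \<eta>(2)[OF W] \<theta>(2) category_Id_left[OF Q s[OF X(1)]] X W FO by simp
    then have r: "Comp P (A ?X) W (A ?X) (\<eta> W) \<theta> = Id P (A ?X)"
      using \<phi>_inj \<phi>_id category_Comp[OF P \<theta>(1) \<eta>(1)[OF W]] category_Id[OF P] X W by metis
    have "FMor F W W (Comp P W (A ?X) W \<theta> (\<eta> W)) = FMor F W W (Id P W)"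
      using functor_Comp[OF F \<eta>(1)[OF W] \<theta>(1)] \<eta>(2)[OF W] \<theta>(2) functor_Id[OF F W] X W
      by (simp add: \<phi>_def)
    then have "Comp P W (A ?X) W \<theta> (\<eta> W) = Id P W"
      using ff[OF W W] category_Comp[OF P \<eta>(1)[OF W] \<theta>(1)] category_Id[OF P W] X W
      unfolding bij_betw_def inj_on_def by blast
    then show ?thesis using r \<theta>(1) \<eta>(1)[OF W] unfolding is_iso_def by blast
  qed
  have HLF: "is_functor P P (comp_functor H (comp_functor ?L F))" using is_functor_comp[OF LF H] .
  have unit: "natural_iso P P id_functor (comp_functor H (comp_functor ?L F)) \<eta>"
    unfolding natural_iso_def
  proof (intro conjI ballI is_functor_id P HLF)
    show "is_iso P (FObj id_functor W) (FObj (comp_functor H (comp_functor ?L F)) W) (\<eta> W)"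
      if "W \<in> Obj P" for W
      using \<eta>_iso[OF that] by (simp add: id_functor_def comp_functor_def H_Obj)
    fix V W f assume V: "V \<in> Obj P" and W: "W \<in> Obj P" and f: "f \<in> Hom P V W"
    let ?Ff = "FMor F V W f" and ?AV = "A (FObj F V)" and ?AW = "A (FObj F W)"
    have o: "FObj F V \<in> Obj Q" "FObj F W \<in> Obj Q" "?AV \<in> Obj P" "?AW \<in> Obj P"
      using FO A V W by simp_all
    note Ff = FH[OF f V W]
    note GF = G_Hom[OF Ff o(1,2)]
    have "\<phi> V (FObj F W) (Comp P V W ?AW (\<eta> W) f) = ?Ff"
      using \<phi>_comp[OF f \<eta>(1)[OF W]] \<eta>(2)[OF W] category_Id_left[OF Q Ff] o V W by simp
    moreover have "\<phi> V (FObj F W) (Comp P V ?AV ?AW (FMor G (FObj F V) (FObj F W) ?Ff) (\<eta> V)) = ?Ff"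
      using \<phi>_comp[OF \<eta>(1)[OF V] GF] G_nat[OF Ff o(1,2)] o V FO
        category_assoc[OF Q FH[OF \<eta>(1)[OF V]] s[OF o(1)] Ff] \<eta>(2)[OF V] category_Id_right[OF Q Ff]
      by (simp add: \<phi>_def)
    ultimately have "Comp P V W ?AW (\<eta> W) f
        = Comp P V ?AV ?AW (FMor G (FObj F V) (FObj F W) ?Ff) (\<eta> V)"
      using \<phi>_inj category_Comp[OF P f \<eta>(1)[OF W]] category_Comp[OF P \<eta>(1)[OF V] GF] o V W by metis
    then show "Comp P (FObj id_functor V) (FObj id_functor W) (FObj (comp_functor H (comp_functor ?L F)) W)
        (\<eta> W) (FMor id_functor V W f) =
      Comp P (FObj id_functor V) (FObj (comp_functor H (comp_functor ?L F)) V)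
        (FObj (comp_functor H (comp_functor ?L F)) W)
        (FMor (comp_functor H (comp_functor ?L F)) V W f) (\<eta> V)"
      using H_L[OF o(1,2) Ff] by (simp add: id_functor_def comp_functor_def H_Obj)
  qed
  define \<epsilon> where "\<epsilon> X = FMor ?L (FObj F (A X)) X (s X)" for X
  let ?M = "comp_functor (comp_functor ?L F) H"
  have M: "is_functor ?QS ?QS ?M" using is_functor_comp[OF H LF] .
  have M_Obj: "FObj ?M X = FObj F (A X)" for X by (simp add: comp_functor_def H_Obj)
  have \<epsilon>: "is_iso ?QS (FObj ?M X) (FObj id_functor X) (\<epsilon> X)" if "X \<in> Obj Q" for X
    using localisation_inverts[OF sS[OF that] FO[OF A[OF that]] that s[OF that]]
    unfolding \<epsilon>_def M_Obj by (simp add: id_functor_def)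
  have I: "is_functor ?QS ?QS id_functor" by (rule is_functor_id[OF is_category_localisation])
  have "natural_iso ?QS ?QS ?M id_functor \<epsilon>"
    unfolding natural_iso_def
  proof (intro conjI ballI M I)
    show "is_iso ?QS (FObj ?M X) (FObj id_functor X) (\<epsilon> X)" if "X \<in> Obj ?QS" for X
      using \<epsilon> that by simp
    have \<epsilon>_Hom: "\<epsilon> X \<in> Hom ?QS (FObj ?M X) X" if "X \<in> Obj Q" for X
      using \<epsilon>[OF that] unfolding is_iso_def id_functor_simps by blast
    have \<epsilon>_nat: "Comp ?QS (FObj ?M X) (FObj ?M Y) Y (\<epsilon> Y) (FMor ?M X Y (FMor ?L X Y f)) =
        Comp ?QS (FObj ?M X) X Y (FMor ?L X Y f) (\<epsilon> X)"
      if o: "X \<in> Obj Q" "Y \<in> Obj Q" and f: "f \<in> Hom Q X Y" for X Y f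
    proof -
      have o': "FObj F (A X) \<in> Obj Q" "FObj F (A Y) \<in> Obj Q" using o A FO by simp_all
      note Gf = G_Hom[OF f o] and FGf = FH[OF G_Hom[OF f o] A[OF o(1)] A[OF o(2)]]
      have "Comp Q (FObj F (A X)) (FObj F (A Y)) Y (s Y) (FMor F (A X) (A Y) (FMor G X Y f))
          = Comp Q (FObj F (A X)) X Y f (s X)"
        using G_nat[OF f o] by (simp add: \<phi>_def)
      then have "Comp ?QS (FObj F (A X)) (FObj F (A Y)) Y (\<epsilon> Y)
            (FMor ?L (FObj F (A X)) (FObj F (A Y)) (FMor F (A X) (A Y) (FMor G X Y f)))
          = Comp ?QS (FObj F (A X)) X Y (FMor ?L X Y f) (\<epsilon> X)"
        using functor_Comp[OF L FGf s[OF o(2)] o' o(2)] functor_Comp[OF L s[OF o(1)] f o'(1) o]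
        unfolding \<epsilon>_def localisation_functor_simps(1) by simp
      moreover have "FMor ?M X Y (FMor ?L X Y f) =
          FMor ?L (FObj F (A X)) (FObj F (A Y)) (FMor F (A X) (A Y) (FMor G X Y f))"
        using H_L[OF o f] by (simp add: comp_functor_def H_Obj)
      ultimately show ?thesis
        unfolding M_Obj by (simp only:)
    qed
    show "Comp ?QS (FObj ?M X) (FObj ?M Y) (FObj id_functor Y) (\<epsilon> Y) (FMor ?M X Y \<psi>) =
        Comp ?QS (FObj ?M X) (FObj id_functor X) (FObj id_functor Y) (FMor id_functor X Y \<psi>) (\<epsilon> X)"
      if "\<psi> \<in> Hom ?QS X Y" for X Y \<psi>
      unfolding id_functor_simps
      by (rule localisation_natural[OF Q M I, unfolded id_functor_simps, OF \<epsilon>_Hom \<epsilon>_nat that])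
  qed
  then show ?thesis unfolding is_equivalence_def using LF H unit by blast
qed

section \<open>Preadditive categories and ideal quotients\<close>

lemma hom_mod_simps [simp]:
  "carrier (hom_mod C X Y) = Hom C X Y"
  "zero (hom_mod C X Y) = HZero C X Y"
  "add (hom_mod C X Y) = HAdd C X Y"
  "smult (hom_mod C X Y) = HSmult C X Y"
  by (simp_all add: hom_mod_def)

locale preadditive =
  fixes C :: "('o, 'm, 'k, 'z) lincat_scheme"
  assumes preadditive: "preadditive_category C"
begin

abbreviation neg :: "'o \<Rightarrow> 'o \<Rightarrow> 'm \<Rightarrow> 'm" where
  "neg X Y f \<equiv> a_inv (hom_mod C X Y) f"

lemma category: "is_category C"
  using preadditive by (simp add: preadditive_category_def)

lemmas Id_Hom = category_Id[OF category] and Comp_Hom = category_Comp[OF category]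
  and Id_right = category_Id_right[OF category] and Id_left = category_Id_left[OF category]
  and assoc = category_assoc[OF category]

lemma hom_group: "\<lbrakk>X \<in> Obj C; Y \<in> Obj C\<rbrakk> \<Longrightarrow> abelian_group (hom_mod C X Y)"
  using preadditive by (simp add: preadditive_category_def)

lemma zero_Hom: "\<lbrakk>X \<in> Obj C; Y \<in> Obj C\<rbrakk> \<Longrightarrow> HZero C X Y \<in> Hom C X Y"
  using abelian_groupE(2)[OF hom_group] by simp

lemma add_Hom: "\<lbrakk>f \<in> Hom C X Y; g \<in> Hom C X Y; X \<in> Obj C; Y \<in> Obj C\<rbrakk> \<Longrightarrow> HAdd C X Y f g \<in> Hom C X Y"
  using abelian_groupE(1)[OF hom_group] by simp

lemma neg_Hom: "\<lbrakk>f \<in> Hom C X Y; X \<in> Obj C; Y \<in> Obj C\<rbrakk> \<Longrightarrow> neg X Y f \<in> Hom C X Y"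
  using abelian_group.a_inv_closed[OF hom_group] by simp

lemma add_zero: "\<lbrakk>f \<in> Hom C X Y; X \<in> Obj C; Y \<in> Obj C\<rbrakk> \<Longrightarrow> HAdd C X Y f (HZero C X Y) = f"
  using abelian_monoid.r_zero[OF abelian_group.axioms(1)[OF hom_group]] by simp

lemma neg_zero: "\<lbrakk>X \<in> Obj C; Y \<in> Obj C\<rbrakk> \<Longrightarrow> neg X Y (HZero C X Y) = HZero C X Y"
  using abelian_group.minus_equality[OF hom_group, of X Y "HZero C X Y" "HZero C X Y"]
  by (simp add: zero_Hom add_zero)

lemma neg_neg: "\<lbrakk>f \<in> Hom C X Y; X \<in> Obj C; Y \<in> Obj C\<rbrakk> \<Longrightarrow> neg X Y (neg X Y f) = f"
  using abelian_group.minus_minus[OF hom_group] by simp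

lemma neg_inj: "\<lbrakk>neg X Y f = neg X Y g; f \<in> Hom C X Y; g \<in> Hom C X Y; X \<in> Obj C; Y \<in> Obj C\<rbrakk> \<Longrightarrow> f = g"
  using neg_neg by metis

lemma diff_zero_iff: "\<lbrakk>f \<in> Hom C X Y; g \<in> Hom C X Y; X \<in> Obj C; Y \<in> Obj C\<rbrakk>
    \<Longrightarrow> HAdd C X Y f (neg X Y g) = HZero C X Y \<longleftrightarrow> f = g"
proof -
  assume h: "f \<in> Hom C X Y" "g \<in> Hom C X Y" "X \<in> Obj C" "Y \<in> Obj C"
  interpret abelian_group "hom_mod C X Y" by (rule hom_group) fact+
  show ?thesis using minus_equality[of f "neg X Y g"] minus_minus[of g] r_neg[of g] h neg_Hom by auto
qed

text \<open>Composition on either side is packaged as a homomorphism of Hom-groups, so that compatibility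
  with zeros, negatives and finite sums comes from the general theory of such homomorphisms.\<close>

lemma postcomp_hom:
  assumes "g \<in> Hom C Y Z" "X \<in> Obj C" "Y \<in> Obj C" "Z \<in> Obj C"
  shows "abelian_group_hom (hom_mod C X Y) (hom_mod C X Z) (Comp C X Y Z g)"
proof (rule abelian_group_homI[OF hom_group hom_group])
  have "Comp C X Y Z g (HAdd C X Y f f') = HAdd C X Z (Comp C X Y Z g f) (Comp C X Y Z g f')"
    if "f \<in> Hom C X Y" "f' \<in> Hom C X Y" for f f'
    using preadditive assms that by (simp add: preadditive_category_def)
  then show "group_hom (add_monoid (hom_mod C X Y)) (add_monoid (hom_mod C X Z)) (Comp C X Y Z g)"
    using assms abelian_group.a_group[OF hom_group]
    by (auto simp: group_hom_def group_hom_axioms_def hom_def Comp_Hom)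
qed (use assms in auto)

lemma precomp_hom:
  assumes "f \<in> Hom C X Y" "X \<in> Obj C" "Y \<in> Obj C" "Z \<in> Obj C"
  shows "abelian_group_hom (hom_mod C Y Z) (hom_mod C X Z) (\<lambda>g. Comp C X Y Z g f)"
proof (rule abelian_group_homI[OF hom_group hom_group])
  have "Comp C X Y Z (HAdd C Y Z g g') f = HAdd C X Z (Comp C X Y Z g f) (Comp C X Y Z g' f)"
    if "g \<in> Hom C Y Z" "g' \<in> Hom C Y Z" for g g'
    using preadditive assms that by (simp add: preadditive_category_def)
  then show "group_hom (add_monoid (hom_mod C Y Z)) (add_monoid (hom_mod C X Z)) (\<lambda>g. Comp C X Y Z g f)"
    using assms abelian_group.a_group[OF hom_group]
    by (auto simp: group_hom_def group_hom_axioms_def hom_def Comp_Hom)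
qed (use assms in auto)

lemma
  assumes "g \<in> Hom C Y Z" "X \<in> Obj C" "Y \<in> Obj C" "Z \<in> Obj C"
  shows Comp_zero_right: "Comp C X Y Z g (HZero C X Y) = HZero C X Z"
    and Comp_neg_right: "f \<in> Hom C X Y \<Longrightarrow> Comp C X Y Z g (neg X Y f) = neg X Z (Comp C X Y Z g f)"
    and Comp_add_right: "\<lbrakk>f \<in> Hom C X Y; f' \<in> Hom C X Y\<rbrakk> \<Longrightarrow>
      Comp C X Y Z g (HAdd C X Y f f') = HAdd C X Z (Comp C X Y Z g f) (Comp C X Y Z g f')"
  using abelian_group_hom.hom_zero[OF postcomp_hom[OF assms]]
    abelian_group_hom.hom_a_inv[OF postcomp_hom[OF assms]]
    abelian_group_hom.hom_add[OF postcomp_hom[OF assms]] by simp_all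

lemma
  assumes "f \<in> Hom C X Y" "X \<in> Obj C" "Y \<in> Obj C" "Z \<in> Obj C"
  shows Comp_zero_left: "Comp C X Y Z (HZero C Y Z) f = HZero C X Z"
    and Comp_neg_left: "g \<in> Hom C Y Z \<Longrightarrow> Comp C X Y Z (neg Y Z g) f = neg X Z (Comp C X Y Z g f)"
    and Comp_add_left: "\<lbrakk>g \<in> Hom C Y Z; g' \<in> Hom C Y Z\<rbrakk> \<Longrightarrow>
      Comp C X Y Z (HAdd C Y Z g g') f = HAdd C X Z (Comp C X Y Z g f) (Comp C X Y Z g' f)"
  using abelian_group_hom.hom_zero[OF precomp_hom[OF assms]]
    abelian_group_hom.hom_a_inv[OF precomp_hom[OF assms]]
    abelian_group_hom.hom_add[OF precomp_hom[OF assms]] by simp_all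

lemma factor_idealI:
  "\<lbrakk>Z \<in> A; Z \<in> Obj C; f \<in> Hom C X Z; g \<in> Hom C Z Y\<rbrakk> \<Longrightarrow> Comp C X Z Y g f \<in> factor_ideal C A X Y"
  unfolding factor_ideal_def by blast

lemma factor_idealE:
  assumes "h \<in> factor_ideal C A X Y"
  obtains Z f g where "Z \<in> Obj C" "Z \<in> A" "f \<in> Hom C X Z" "g \<in> Hom C Z Y" "h = Comp C X Z Y g f"
  using assms unfolding factor_ideal_def by blast

lemma factor_ideal_postcomp:
  assumes "h \<in> factor_ideal C A X Y" "k \<in> Hom C Y Z" "X \<in> Obj C" "Y \<in> Obj C" "Z \<in> Obj C"
  shows "Comp C X Y Z k h \<in> factor_ideal C A X Z"
proof -
  obtain V f g where V: "V \<in> Obj C" "V \<in> A" "f \<in> Hom C X V" "g \<in> Hom C V Y" "h = Comp C X V Y g f"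
    using factor_idealE[OF assms(1)] .
  have "Comp C X Y Z k h = Comp C X V Z (Comp C V Y Z k g) f"
    using assoc[OF V(3,4) assms(2)] V assms by simp
  then show ?thesis using factor_idealI[OF V(2,1,3) Comp_Hom[OF V(4) assms(2)]] V assms by simp
qed

lemma factor_ideal_precomp:
  assumes "h \<in> factor_ideal C A Y Z" "k \<in> Hom C X Y" "X \<in> Obj C" "Y \<in> Obj C" "Z \<in> Obj C"
  shows "Comp C X Y Z h k \<in> factor_ideal C A X Z"
proof -
  obtain V f g where V: "V \<in> Obj C" "V \<in> A" "f \<in> Hom C Y V" "g \<in> Hom C V Z" "h = Comp C Y V Z g f"
    using factor_idealE[OF assms(1)] .
  have "Comp C X Y Z h k = Comp C X V Z g (Comp C X Y V f k)"
    using assoc[OF assms(2) V(3,4)] V assms by simp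
  then show ?thesis using factor_idealI[OF V(2,1) Comp_Hom[OF assms(2) V(3)] V(4)] V assms by simp
qed

end

lemma preadditive_full_subcategory:
  assumes "preadditive_category C"
  shows "preadditive_category (full_subcategory C S)"
proof -
  have "hom_mod (full_subcategory C S) X Y = hom_mod C X Y" for X Y
    by (simp add: hom_mod_def full_subcategory_def lincat.truncate_def)
  then show ?thesis
    using assms unfolding preadditive_category_def is_category_def
    by (simp add: full_subcategory_def lincat.truncate_def)
qed

text \<open>Ideals of the form \<open>[A]\<close> absorb composition on both sides by associativity, so the subgroup property
  is all that a quotient requires.\<close>

locale ideal_quotient = preadditive C for C :: "('o, 'm, 'k, 'z) lincat_scheme" +
  fixes A :: "'o set"
  assumes ideal_subgroup: "\<And>X Y. \<lbrakk>X \<in> Obj C; Y \<in> Obj C\<rbrakk>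
    \<Longrightarrow> additive_subgroup (factor_ideal C A X Y) (hom_mod C X Y)"
begin

abbreviation quot :: "('o, 'm set, 'k) lincat" where
  "quot \<equiv> quotient_category C A"

definition cls :: "'o \<Rightarrow> 'o \<Rightarrow> 'm \<Rightarrow> 'm set" where
  "cls X Y f = factor_ideal C A X Y +>\<^bsub>hom_mod C X Y\<^esub> f"

lemma ideal_abelian_subgroup:
  "\<lbrakk>X \<in> Obj C; Y \<in> Obj C\<rbrakk> \<Longrightarrow> abelian_subgroup (factor_ideal C A X Y) (hom_mod C X Y)"
  using abelian_subgroupI3[OF ideal_subgroup hom_group] .

lemma quotient_Obj [simp]: "Obj quot = Obj C"
  by (simp add: quotient_category_def)

lemma quotient_Hom: "Hom quot X Y = cls X Y ` Hom C X Y"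
  by (auto simp: quotient_category_def A_RCOSETS_def' cls_def)

lemma cls_Hom: "f \<in> Hom C X Y \<Longrightarrow> cls X Y f \<in> Hom quot X Y"
  by (simp add: quotient_Hom)

lemma quotient_Id: "Id quot X = cls X X (Id C X)"
  by (simp add: quotient_category_def cls_def)

lemma mem_cls_iff:
  assumes "f \<in> Hom C X Y" "g \<in> Hom C X Y" "X \<in> Obj C" "Y \<in> Obj C"
  shows "g \<in> cls X Y f \<longleftrightarrow> HAdd C X Y g (neg X Y f) \<in> factor_ideal C A X Y"
  using abelian_subgroup.a_rcos_module[OF ideal_abelian_subgroup, of X Y] assms hom_group
  by (simp add: cls_def)

lemma cls_eq_iff_mem:
  assumes "f \<in> Hom C X Y" "g \<in> Hom C X Y" "X \<in> Obj C" "Y \<in> Obj C"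
  shows "cls X Y f = cls X Y g \<longleftrightarrow> g \<in> cls X Y f"
proof -
  interpret abelian_subgroup "factor_ideal C A X Y" "hom_mod C X Y"
    using ideal_abelian_subgroup assms by blast
  show ?thesis
    using a_repr_independence'[of g f] a_rcos_self[of g] assms(1,2) unfolding cls_def hom_mod_simps
    by blast
qed

lemma cls_eq_iff:
  assumes "f \<in> Hom C X Y" "g \<in> Hom C X Y" "X \<in> Obj C" "Y \<in> Obj C"
  shows "cls X Y f = cls X Y g \<longleftrightarrow> HAdd C X Y g (neg X Y f) \<in> factor_ideal C A X Y"
  using cls_eq_iff_mem mem_cls_iff assms by simp

lemma cls_subset: "\<lbrakk>f \<in> Hom C X Y; X \<in> Obj C; Y \<in> Obj C\<rbrakk> \<Longrightarrow> cls X Y f \<subseteq> Hom C X Y"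
  using abelian_monoid.a_r_coset_subset_G[of "hom_mod C X Y" "factor_ideal C A X Y" f]
    additive_subgroup.a_subset[OF ideal_subgroup] abelian_group.axioms(1)[OF hom_group]
  by (simp add: cls_def)

text \<open>Changing the representatives of \<open>g\<close> and \<open>f\<close> one after the other changes \<open>g f\<close> by elements of the
  ideal, so the union defining the composite is a single coset.\<close>

lemma quotient_Comp:
  assumes f: "f \<in> Hom C X Y" and g: "g \<in> Hom C Y Z" and o: "X \<in> Obj C" "Y \<in> Obj C" "Z \<in> Obj C"
  shows "Comp quot X Y Z (cls Y Z g) (cls X Y f) = cls X Z (Comp C X Y Z g f)"
proof -
  have "cls X Z (Comp C X Y Z g' f') = cls X Z (Comp C X Y Z g f)"
    if f'_in: "f' \<in> cls X Y f" and g'_in: "g' \<in> cls Y Z g" for f' g'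
  proof -
    have f': "f' \<in> Hom C X Y" and g': "g' \<in> Hom C Y Z" using cls_subset that f g o by blast+
    have "Comp C X Y Z g' (HAdd C X Y f' (neg X Y f)) \<in> factor_ideal C A X Z"
      using factor_ideal_postcomp[OF _ g' o] f'_in mem_cls_iff[OF f f' o(1,2)] by blast
    then have "HAdd C X Z (Comp C X Y Z g' f') (neg X Z (Comp C X Y Z g' f)) \<in> factor_ideal C A X Z"
      using Comp_add_right[OF g' o] Comp_neg_right[OF g' o f] f f' neg_Hom o by simp
    then have 1: "cls X Z (Comp C X Y Z g' f) = cls X Z (Comp C X Y Z g' f')"
      using cls_eq_iff f f' g' o Comp_Hom by simp
    have "Comp C X Y Z (HAdd C Y Z g' (neg Y Z g)) f \<in> factor_ideal C A X Z"
      using factor_ideal_precomp[OF _ f o] g'_in mem_cls_iff[OF g g' o(2,3)] by blast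
    then have "HAdd C X Z (Comp C X Y Z g' f) (neg X Z (Comp C X Y Z g f)) \<in> factor_ideal C A X Z"
      using Comp_add_left[OF f o] Comp_neg_left[OF f o g] g g' neg_Hom o by simp
    then have "cls X Z (Comp C X Y Z g f) = cls X Z (Comp C X Y Z g' f)"
      using cls_eq_iff f g g' o Comp_Hom by simp
    then show ?thesis using 1 by simp
  qed
  moreover have "f \<in> cls X Y f" "g \<in> cls Y Z g" using cls_eq_iff_mem f g o by auto
  ultimately have "(\<Union>g'\<in>cls Y Z g. \<Union>f'\<in>cls X Y f. cls X Z (Comp C X Y Z g' f')) =
      cls X Z (Comp C X Y Z g f)" by blast
  then show ?thesis by (simp add: quotient_category_def cls_def)
qed

lemma quotient_HAdd:
  assumes "f \<in> Hom C X Y" "g \<in> Hom C X Y" "X \<in> Obj C" "Y \<in> Obj C"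
  shows "HAdd quot X Y (cls X Y f) (cls X Y g) = cls X Y (HAdd C X Y f g)"
  using abelian_subgroup.a_rcos_sum[OF ideal_abelian_subgroup, of X Y f g] assms
  by (simp add: cls_def quotient_category_def)

lemma quotient_HZero:
  assumes "X \<in> Obj C" "Y \<in> Obj C"
  shows "HZero quot X Y = cls X Y (HZero C X Y)"
  using abelian_group.a_coset_add_zero[OF hom_group, of X Y "factor_ideal C A X Y"] assms
    additive_subgroup.a_subset[OF ideal_subgroup]
  by (simp add: cls_def quotient_category_def)

lemma is_category_quotient: "is_category quot"
  unfolding is_category_def
  by (auto simp: quotient_Hom quotient_Id quotient_Comp Comp_Hom Id_Hom Id_left Id_right assoc)

lemma preadditive_quotient: "preadditive_category quot"
proof -
  have "abelian_group (hom_mod quot X Y)" if "X \<in> Obj C" "Y \<in> Obj C" for X Y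
  proof -
    note G = abelian_groupE[OF hom_group[OF that]]
    show ?thesis
    proof (rule abelian_groupI)
      show "\<exists>g\<in>carrier (hom_mod quot X Y). g \<oplus>\<^bsub>hom_mod quot X Y\<^esub> F = \<zero>\<^bsub>hom_mod quot X Y\<^esub>"
        if F: "F \<in> carrier (hom_mod quot X Y)" for F
      proof -
        obtain f where f: "f \<in> Hom C X Y" "F = cls X Y f" using F by (auto simp: quotient_Hom)
        then obtain g where "g \<in> Hom C X Y" "HAdd C X Y g f = HZero C X Y" using G(6)[of f] by auto
        then show ?thesis
          using f \<open>X \<in> Obj C\<close> \<open>Y \<in> Obj C\<close>
          by (force simp: quotient_Hom quotient_HAdd quotient_HZero)
      qed
    qed (use that G zero_Hom in \<open>auto simp: quotient_Hom quotient_HAdd quotient_HZero add_Hom\<close>)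
  qed
  then show ?thesis
    unfolding preadditive_category_def
    by (auto simp: is_category_quotient quotient_Hom quotient_Comp quotient_HAdd add_Hom Comp_Hom
        Comp_add_left Comp_add_right)
qed

end

section \<open>Direct sums and additive closures\<close>

lemma additive_functor_hom:
  assumes "additive_functor A B F" "X \<in> Obj A" "Y \<in> Obj A"
  shows "abelian_group_hom (hom_mod A X Y) (hom_mod B (FObj F X) (FObj F Y)) (FMor F X Y)"
proof -
  have F: "is_functor A B F" using assms by (simp add: additive_functor_def)
  interpret A: preadditive A using assms by (simp add: preadditive_def additive_functor_def)
  interpret B: preadditive B using assms by (simp add: preadditive_def additive_functor_def)
  have o: "FObj F X \<in> Obj B" "FObj F Y \<in> Obj B" using functor_Obj[OF F] assms by simp_all
  show ?thesis
  proof (rule abelian_group_homI[OF A.hom_group B.hom_group])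
    show "group_hom (add_monoid (hom_mod A X Y)) (add_monoid (hom_mod B (FObj F X) (FObj F Y))) (FMor F X Y)"
      using assms o abelian_group.a_group[OF A.hom_group] abelian_group.a_group[OF B.hom_group]
        functor_Hom[OF F]
      by (auto simp: group_hom_def group_hom_axioms_def hom_def additive_functor_def)
  qed (use assms o in auto)
qed

lemma abelian_group_hom_finsum:
  assumes "abelian_group_hom G H h" "finite I" "f \<in> I \<rightarrow> carrier G"
  shows "h (finsum G f I) = finsum H (\<lambda>i. h (f i)) I"
proof -
  interpret abelian_group_hom G H h by fact
  show ?thesis using assms(2,3) by (induction I rule: finite_induct) (auto simp: Pi_iff)
qed

lemma finsum_eq_zero:
  assumes "abelian_group G" "\<And>i. i \<in> I \<Longrightarrow> f i = \<zero>\<^bsub>G\<^esub>"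
  shows "finsum G f I = \<zero>\<^bsub>G\<^esub>"
proof -
  interpret abelian_group G by fact
  have "finsum G f I = finsum G (\<lambda>_. \<zero>\<^bsub>G\<^esub>) I" using assms(2) by (intro finsum_cong') auto
  then show ?thesis by simp
qed

lemma is_direct_sumI:
  assumes "set Xs \<subseteq> Obj C" "S \<in> Obj C"
    and "\<And>i. i < length Xs \<Longrightarrow> \<iota> i \<in> Hom C (Xs ! i) S" "\<And>i. i < length Xs \<Longrightarrow> \<pi> i \<in> Hom C S (Xs ! i)"
    and "\<And>i j. \<lbrakk>i < length Xs; j < length Xs\<rbrakk> \<Longrightarrow> Comp C (Xs ! i) S (Xs ! j) (\<pi> j) (\<iota> i) =
           (if i = j then Id C (Xs ! i) else HZero C (Xs ! i) (Xs ! j))"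
    and "finsum (hom_mod C S S) (\<lambda>i. Comp C S (Xs ! i) S (\<iota> i) (\<pi> i)) {..<length Xs} = Id C S"
  shows "is_direct_sum C Xs S"
  unfolding is_direct_sum_def using assms by blast

lemma additive_functor_direct_sum:
  assumes F: "additive_functor A B F" and S: "is_direct_sum A Xs S"
  shows "is_direct_sum B (map (FObj F) Xs) (FObj F S)"
proof -
  have fF: "is_functor A B F" using F by (simp add: additive_functor_def)
  interpret A: preadditive A using F by (simp add: preadditive_def additive_functor_def)
  obtain \<iota> \<pi> where So: "S \<in> Obj A" "set Xs \<subseteq> Obj A"
    and i: "\<And>i. i < length Xs \<Longrightarrow> \<iota> i \<in> Hom A (Xs ! i) S"
    and p: "\<And>i. i < length Xs \<Longrightarrow> \<pi> i \<in> Hom A S (Xs ! i)"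
    and pi: "\<And>i j. i < length Xs \<Longrightarrow> j < length Xs \<Longrightarrow> Comp A (Xs ! i) S (Xs ! j) (\<pi> j) (\<iota> i) =
           (if i = j then Id A (Xs ! i) else HZero A (Xs ! i) (Xs ! j))"
    and sum: "finsum (hom_mod A S S) (\<lambda>i. Comp A S (Xs ! i) S (\<iota> i) (\<pi> i)) {..<length Xs} = Id A S"
    using S unfolding is_direct_sum_def by blast
  have Xo: "Xs ! i \<in> Obj A" if "i < length Xs" for i using So(2) that by auto
  let ?\<iota> = "\<lambda>i. FMor F (Xs ! i) S (\<iota> i)" and ?\<pi> = "\<lambda>i. FMor F S (Xs ! i) (\<pi> i)"
  have ip: "FMor F S S (Comp A S (Xs ! i) S (\<iota> i) (\<pi> i)) =
      Comp B (FObj F S) (FObj F (Xs ! i)) (FObj F S) (?\<iota> i) (?\<pi> i)" if "i < length Xs" for i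
    using functor_Comp[OF fF p[OF that] i[OF that]] So Xo[OF that] by simp
  have z: "FMor F X Y (HZero A X Y) = HZero B (FObj F X) (FObj F Y)" if "X \<in> Obj A" "Y \<in> Obj A" for X Y
    using abelian_group_hom.hom_zero[OF additive_functor_hom[OF F that]] by simp
  have "finsum (hom_mod B (FObj F S) (FObj F S))
      (\<lambda>i. FMor F S S (Comp A S (Xs ! i) S (\<iota> i) (\<pi> i))) {..<length Xs} = Id B (FObj F S)"
    using abelian_group_hom_finsum[OF additive_functor_hom[OF F So(1) So(1)], of "{..<length Xs}"
        "\<lambda>i. Comp A S (Xs ! i) S (\<iota> i) (\<pi> i)"] functor_Id[OF fF So(1)] i p A.Comp_Hom So Xo sum
    by (auto simp: Pi_iff)
  moreover have "finsum (hom_mod B (FObj F S) (FObj F S))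
      (\<lambda>i. FMor F S S (Comp A S (Xs ! i) S (\<iota> i) (\<pi> i))) {..<length Xs} =
    finsum (hom_mod B (FObj F S) (FObj F S))
      (\<lambda>i. Comp B (FObj F S) (map (FObj F) Xs ! i) (FObj F S) (?\<iota> i) (?\<pi> i)) {..<length Xs}"
  proof -
    interpret B: preadditive B using F by (simp add: preadditive_def additive_functor_def)
    interpret G: abelian_group "hom_mod B (FObj F S) (FObj F S)"
      using B.hom_group functor_Obj[OF fF] So by blast
    show ?thesis
      using ip i p functor_Hom[OF fF] functor_Obj[OF fF] So Xo B.Comp_Hom
      by (intro G.finsum_cong') auto
  qed
  moreover have "Comp B (FObj F (Xs ! i)) (FObj F S) (FObj F (Xs ! j)) (?\<pi> j) (?\<iota> i) =
      (if i = j then Id B (FObj F (Xs ! i)) else HZero B (FObj F (Xs ! i)) (FObj F (Xs ! j)))"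
    if "i < length Xs" "j < length Xs" for i j
    using functor_Comp[OF fF i[OF that(1)] p[OF that(2)]] pi[OF that] functor_Id[OF fF] z Xo that So
    by auto
  moreover have "?\<iota> i \<in> Hom B (FObj F (Xs ! i)) (FObj F S)" "?\<pi> i \<in> Hom B (FObj F S) (FObj F (Xs ! i))"
    if "i < length Xs" for i
    using functor_Hom[OF fF] i p Xo So that by simp_all
  ultimately show ?thesis
    using functor_Obj[OF fF] So by (intro is_direct_sumI[of _ _ _ ?\<iota> ?\<pi>]) auto
qed

context preadditive
begin

lemma zero_objectI:
  assumes "N \<in> Obj C" "Id C N = HZero C N N"
  shows "zero_object C N"
proof -
  have "f = HZero C X N" if "f \<in> Hom C X N" "X \<in> Obj C" for X f
    using Id_left[OF that(1)] Comp_zero_left[OF that(1)] assms that by simp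
  moreover have "f = HZero C N X" if "f \<in> Hom C N X" "X \<in> Obj C" for X f
    using Id_right[OF that(1)] Comp_zero_right[OF that(1)] assms that by simp
  ultimately show ?thesis using assms(1) zero_Hom unfolding zero_object_def by metis
qed

lemma zero_object_Hom_to:
  assumes "zero_object C N" "X \<in> Obj C"
  shows "f \<in> Hom C X N \<Longrightarrow> f = HZero C X N"
  using assms zero_Hom unfolding zero_object_def by blast

lemma zero_object_Obj: "zero_object C N \<Longrightarrow> N \<in> Obj C"
  by (simp add: zero_object_def)

lemma direct_sum_zero_object:
  assumes "S \<in> Obj C" "zero_object C N"
  shows "is_direct_sum C [S, N] S"
proof -
  have N: "N \<in> Obj C" using assms zero_object_Obj by blast
  define \<iota> \<pi> where "\<iota> i = (if i = (0::nat) then Id C S else HZero C N S)"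
    and "\<pi> i = (if i = (0::nat) then Id C S else HZero C S N)" for i
  interpret G: abelian_group "hom_mod C S S" by (rule hom_group) fact+
  have set: "{..<length [S, N]} = {0, 1}" by auto
  show ?thesis
  proof (rule is_direct_sumI[of _ _ _ \<iota> \<pi>])
    show "finsum (hom_mod C S S) (\<lambda>i. Comp C S ([S, N] ! i) S (\<iota> i) (\<pi> i)) {..<length [S, N]} = Id C S"
      unfolding set using assms N zero_Hom Id_Hom Id_left Comp_zero_right
      by (simp add: \<iota>_def \<pi>_def G.finsum_insert add_zero Comp_Hom)
    have "Id C N = HZero C N N" using zero_object_Hom_to assms(2) N Id_Hom by blast
    then show "Comp C ([S, N] ! i) S ([S, N] ! j) (\<pi> j) (\<iota> i) =
        (if i = j then Id C ([S, N] ! i) else HZero C ([S, N] ! i) ([S, N] ! j))"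
      if "i < length [S, N]" "j < length [S, N]" for i j
      using that assms N zero_Hom Id_Hom Id_left Comp_zero_right Comp_zero_left
      by (auto simp: less_Suc_eq \<iota>_def \<pi>_def)
  qed (use assms N zero_Hom Id_Hom in \<open>auto simp: less_Suc_eq \<iota>_def \<pi>_def\<close>)
qed

lemma direct_sum_in_add_closure:
  assumes "is_direct_sum C (replicate n X) S" "zero_object C N"
  shows "S \<in> add_closure C X"
proof -
  have "S \<in> Obj C" using assms(1) by (simp add: is_direct_sum_def)
  then show ?thesis using assms direct_sum_zero_object unfolding add_closure_def by blast
qed

text \<open>The part of membership in \<open>add X\<close> that the arguments below use: the identity of \<open>Y\<close> is a
  finite sum of endomorphisms that factor through \<open>X\<close>.\<close>

lemma add_closure_Id:
  assumes Y: "Y \<in> add_closure C X" and X: "X \<in> Obj C"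
  obtains n a b where "Y \<in> Obj C" "\<And>i. i < (n::nat) \<Longrightarrow> a i \<in> Hom C X Y"
    "\<And>i. i < n \<Longrightarrow> b i \<in> Hom C Y X"
    "finsum (hom_mod C Y Y) (\<lambda>i. Comp C Y X Y (a i) (b i)) {..<n} = Id C Y"
proof -
  obtain n S Y' where S: "is_direct_sum C (replicate n X) S" and Y': "is_direct_sum C [Y, Y'] S"
    using Y unfolding add_closure_def by blast
  obtain \<iota> \<pi> where ip0: "\<forall>i<length (replicate n X).
        \<iota> i \<in> Hom C (replicate n X ! i) S \<and> \<pi> i \<in> Hom C S (replicate n X ! i)"
    and sum0: "finsum (hom_mod C S S) (\<lambda>i. Comp C S (replicate n X ! i) S (\<iota> i) (\<pi> i))
      {..<length (replicate n X)} = Id C S"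
    using S unfolding is_direct_sum_def by blast
  have i: "\<iota> i \<in> Hom C X S" and p: "\<pi> i \<in> Hom C S X" if "i < n" for i
    using ip0 that by auto
  obtain j q where o: "Y \<in> Obj C" "S \<in> Obj C" and j: "j \<in> Hom C Y S" and q: "q \<in> Hom C S Y"
    and qj: "Comp C Y S Y q j = Id C Y"
    using Y' unfolding is_direct_sum_def by (auto simp: less_Suc_eq_0_disj)
  interpret G: abelian_group "hom_mod C S S" by (rule hom_group) fact+
  interpret H: abelian_group "hom_mod C Y Y" by (rule hom_group) fact+
  have ip: "Comp C S X S (\<iota> i) (\<pi> i) \<in> Hom C S S" if "i < n" for i
    using Comp_Hom[OF p[OF that] i[OF that]] X o by simp
  have sum: "finsum (hom_mod C S S) (\<lambda>i. Comp C S X S (\<iota> i) (\<pi> i)) {..<n} = Id C S"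
    unfolding sum0[symmetric] using ip by (intro G.finsum_cong') auto
  show thesis
  proof (rule that[of n "\<lambda>i. Comp C X S Y q (\<iota> i)" "\<lambda>i. Comp C Y S X (\<pi> i) j"])
    show "Comp C X S Y q (\<iota> i) \<in> Hom C X Y" "Comp C Y S X (\<pi> i) j \<in> Hom C Y X" if "i < n" for i
      using that i p j q o X Comp_Hom by simp_all
    have "Id C Y = Comp C Y S Y (Comp C S S Y q (Id C S)) j"
      using qj Id_right[OF q] o by simp
    also have "\<dots> = Comp C Y S Y (finsum (hom_mod C S Y) (\<lambda>i. Comp C S S Y q (Comp C S X S (\<iota> i) (\<pi> i))) {..<n}) j"
      using abelian_group_hom_finsum[OF postcomp_hom[OF q], of S "{..<n}" "\<lambda>i. Comp C S X S (\<iota> i) (\<pi> i)"] ip o sum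
      by (simp add: Pi_iff)
    also have "\<dots> = finsum (hom_mod C Y Y) (\<lambda>i. Comp C Y S Y (Comp C S S Y q (Comp C S X S (\<iota> i) (\<pi> i))) j) {..<n}"
      using abelian_group_hom_finsum[OF precomp_hom[OF j], of Y "{..<n}" "\<lambda>i. Comp C S S Y q (Comp C S X S (\<iota> i) (\<pi> i))"]
        Comp_Hom[OF ip q] o by (simp add: Pi_iff)
    also have "\<dots> = finsum (hom_mod C Y Y) (\<lambda>i. Comp C Y X Y (Comp C X S Y q (\<iota> i)) (Comp C Y S X (\<pi> i) j)) {..<n}"
    proof (intro H.finsum_cong')
      fix k assume "k \<in> {..<n}"
      then have k: "\<iota> k \<in> Hom C X S" "\<pi> k \<in> Hom C S X" using i p by auto
      show "Comp C Y S Y (Comp C S S Y q (Comp C S X S (\<iota> k) (\<pi> k))) j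
          = Comp C Y X Y (Comp C X S Y q (\<iota> k)) (Comp C Y S X (\<pi> k) j)"
        using assoc[OF k(2,1) q] assoc[OF j k(2) Comp_Hom[OF k(1) q]] o X by simp
    qed (use i p j q o X Comp_Hom in auto)
    finally show "finsum (hom_mod C Y Y) (\<lambda>i. Comp C Y X Y (Comp C X S Y q (\<iota> i)) (Comp C Y S X (\<pi> i) j)) {..<n} = Id C Y"
      by simp
  qed fact
qed

lemma postcomp_inj_on:
  assumes f: "f \<in> Hom C Y Z" and o: "X \<in> Obj C" "Y \<in> Obj C" "Z \<in> Obj C"
    and kernel: "\<And>t. \<lbrakk>t \<in> Hom C X Y; Comp C X Y Z f t = HZero C X Z\<rbrakk> \<Longrightarrow> t = HZero C X Y"
  shows "inj_on (Comp C X Y Z f) (Hom C X Y)"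
proof (rule inj_onI)
  fix s t assume s: "s \<in> Hom C X Y" and t: "t \<in> Hom C X Y"
    and eq: "Comp C X Y Z f s = Comp C X Y Z f t"
  have "Comp C X Y Z f (HAdd C X Y s (neg X Y t)) = HZero C X Z"
    using Comp_add_right[OF f o s neg_Hom[OF t o(1,2)]] Comp_neg_right[OF f o t] eq
      diff_zero_iff[of "Comp C X Y Z f t" X Z "Comp C X Y Z f t"] Comp_Hom[OF t f o] o by simp
  from kernel[OF add_Hom[OF s neg_Hom[OF t o(1,2)] o(1,2)] this] show "s = t"
    using diff_zero_iff[OF s t o(1,2)] by simp
qed

lemma add_closure_Obj: "Y \<in> add_closure C X \<Longrightarrow> Y \<in> Obj C"
  unfolding add_closure_def is_direct_sum_def by auto

text \<open>Objects of \<open>add X\<close> behave like \<open>X\<close> itself with respect to vanishing and lifting; each of the next three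
  lemmas expands the identity of \<open>Y\<close> as in \<open>add_closure_Id\<close>.\<close>

lemma add_closure_from_zero:
  assumes Y: "Y \<in> add_closure C X" and X: "X \<in> Obj C" and Z: "Z \<in> Obj C" and f: "f \<in> Hom C Y Z"
    and zero: "\<And>a. a \<in> Hom C X Y \<Longrightarrow> Comp C X Y Z f a = HZero C X Z"
  shows "f = HZero C Y Z"
proof -
  obtain n a b where o: "Y \<in> Obj C" and a: "\<And>i. i < (n::nat) \<Longrightarrow> a i \<in> Hom C X Y"
    and b: "\<And>i. i < n \<Longrightarrow> b i \<in> Hom C Y X"
    and sum: "finsum (hom_mod C Y Y) (\<lambda>i. Comp C Y X Y (a i) (b i)) {..<n} = Id C Y"
    using add_closure_Id[OF Y X] by metis
  have "f = finsum (hom_mod C Y Z) (\<lambda>i. Comp C Y Y Z f (Comp C Y X Y (a i) (b i))) {..<n}"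
    using abelian_group_hom_finsum[OF postcomp_hom[OF f, of Y], of "{..<n}" "\<lambda>i. Comp C Y X Y (a i) (b i)"]
      Comp_Hom[OF b a] o X Z sum Id_right[OF f] by (simp add: Pi_iff)
  also have "\<dots> = HZero C Y Z"
  proof -
    have "Comp C Y Y Z f (Comp C Y X Y (a i) (b i)) = HZero C Y Z" if "i < n" for i
      using assoc[OF b[OF that] a[OF that] f] zero[OF a[OF that]] Comp_zero_left[OF b[OF that]] o X Z by simp
    then show ?thesis using finsum_eq_zero[OF hom_group[OF o Z], of "{..<n}"] by simp
  qed
  finally show ?thesis .
qed

lemma add_closure_to_zero:
  assumes Y: "Y \<in> add_closure C X" and X: "X \<in> Obj C" and Z: "Z \<in> Obj C" and f: "f \<in> Hom C Z Y"
    and zero: "\<And>b. b \<in> Hom C Y X \<Longrightarrow> Comp C Z Y X b f = HZero C Z X"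
  shows "f = HZero C Z Y"
proof -
  obtain n a b where o: "Y \<in> Obj C" and a: "\<And>i. i < (n::nat) \<Longrightarrow> a i \<in> Hom C X Y"
    and b: "\<And>i. i < n \<Longrightarrow> b i \<in> Hom C Y X"
    and sum: "finsum (hom_mod C Y Y) (\<lambda>i. Comp C Y X Y (a i) (b i)) {..<n} = Id C Y"
    using add_closure_Id[OF Y X] by metis
  have "f = finsum (hom_mod C Z Y) (\<lambda>i. Comp C Z Y Y (Comp C Y X Y (a i) (b i)) f) {..<n}"
    using abelian_group_hom_finsum[OF precomp_hom[OF f, of Y], of "{..<n}" "\<lambda>i. Comp C Y X Y (a i) (b i)"]
      Comp_Hom[OF b a] o X Z sum Id_left[OF f] by (simp add: Pi_iff)
  also have "\<dots> = HZero C Z Y"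
  proof -
    have "Comp C Z Y Y (Comp C Y X Y (a i) (b i)) f = HZero C Z Y" if "i < n" for i
      using assoc[OF f b[OF that] a[OF that]] zero[OF b[OF that]] Comp_zero_right[OF a[OF that]] o X Z by simp
    then show ?thesis using finsum_eq_zero[OF hom_group[OF Z o], of "{..<n}"] by simp
  qed
  finally show ?thesis .
qed

lemma add_closure_lift:
  assumes Y: "Y \<in> add_closure C X" and X: "X \<in> Obj C" and U: "U \<in> Obj C" and V: "V \<in> Obj C"
    and f: "f \<in> Hom C U V" and m: "m \<in> Hom C Y V"
    and surj: "\<And>t. t \<in> Hom C X V \<Longrightarrow> \<exists>t'\<in>Hom C X U. Comp C X U V f t' = t"
  shows "\<exists>m'\<in>Hom C Y U. Comp C Y U V f m' = m"
proof -
  obtain n a b where o: "Y \<in> Obj C" and a: "\<And>i. i < (n::nat) \<Longrightarrow> a i \<in> Hom C X Y"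
    and b: "\<And>i. i < n \<Longrightarrow> b i \<in> Hom C Y X"
    and sum: "finsum (hom_mod C Y Y) (\<lambda>i. Comp C Y X Y (a i) (b i)) {..<n} = Id C Y"
    using add_closure_Id[OF Y X] by metis
  have "\<exists>k\<in>Hom C X U. Comp C X U V f k = Comp C X Y V m (a i)" if "i < n" for i
    using surj Comp_Hom[OF a[OF that] m] X V o by simp
  then obtain k where k: "\<And>i. i < n \<Longrightarrow> k i \<in> Hom C X U"
    and fk: "\<And>i. i < n \<Longrightarrow> Comp C X U V f (k i) = Comp C X Y V m (a i)" by metis
  interpret G: abelian_group "hom_mod C Y U" by (rule hom_group) fact+
  interpret H: abelian_group "hom_mod C Y V" by (rule hom_group) fact+
  let ?m = "finsum (hom_mod C Y U) (\<lambda>i. Comp C Y X U (k i) (b i)) {..<n}"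
  have "?m \<in> Hom C Y U" using G.finsum_closed[of "\<lambda>i. Comp C Y X U (k i) (b i)" "{..<n}"]
      Comp_Hom[OF b k] X o U by (simp add: Pi_iff)
  moreover have "Comp C Y U V f ?m = finsum (hom_mod C Y V) (\<lambda>i. Comp C Y U V f (Comp C Y X U (k i) (b i))) {..<n}"
    using abelian_group_hom_finsum[OF postcomp_hom[OF f, of Y], of "{..<n}" "\<lambda>i. Comp C Y X U (k i) (b i)"]
      Comp_Hom[OF b k] o X U V by (simp add: Pi_iff)
  moreover have "\<dots> = finsum (hom_mod C Y V) (\<lambda>i. Comp C Y Y V m (Comp C Y X Y (a i) (b i))) {..<n}"
  proof (intro H.finsum_cong')
    fix i assume "i \<in> {..<n}"
    then have i: "i < n" by simp
    show "Comp C Y U V f (Comp C Y X U (k i) (b i)) = Comp C Y Y V m (Comp C Y X Y (a i) (b i))"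
      using assoc[OF b[OF i] k[OF i] f] assoc[OF b[OF i] a[OF i] m] fk[OF i] o X U V by simp
  qed (use a b m o X V Comp_Hom in auto)
  moreover have "\<dots> = m"
    using abelian_group_hom_finsum[OF postcomp_hom[OF m, of Y], of "{..<n}" "\<lambda>i. Comp C Y X Y (a i) (b i)"]
      Comp_Hom[OF b a] o X V sum Id_right[OF m] by (simp add: Pi_iff)
  ultimately show ?thesis by metis
qed

end

section \<open>Exactness in triangulated categories\<close>

locale triangulated = preadditive C for C :: "('o, 'm, 'k) tricat" +
  fixes K :: "'k ring"
  assumes triangulated: "triangulated_category K C"
begin

lemma triangle_candidate:
  assumes "(X, Y, Z, u, v, w) \<in> Tri C"
  shows "X \<in> Obj C" "Y \<in> Obj C" "Z \<in> Obj C" "u \<in> Hom C X Y" "v \<in> Hom C Y Z" "w \<in> Hom C Z (SObj C X)"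
proof -
  have "candidate_triangle C (X, Y, Z, u, v, w)"
    using triangulated assms unfolding triangulated_category_def by blast
  then show "X \<in> Obj C" "Y \<in> Obj C" "Z \<in> Obj C" "u \<in> Hom C X Y" "v \<in> Hom C Y Z" "w \<in> Hom C Z (SObj C X)"
    by (simp_all add: candidate_triangle_def)
qed

lemma rotate_iff:
  assumes "X \<in> Obj C" "Y \<in> Obj C" "Z \<in> Obj C" "u \<in> Hom C X Y" "v \<in> Hom C Y Z" "w \<in> Hom C Z (SObj C X)"
  shows "(X, Y, Z, u, v, w) \<in> Tri C \<longleftrightarrow>
    (Y, Z, SObj C X, v, w, neg (SObj C X) (SObj C Y) (SMor C X Y u)) \<in> Tri C"
proof -
  have "triangles_TR2 C" using triangulated by (simp add: triangulated_category_def)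
  then show ?thesis using assms unfolding triangles_TR2_def candidate_triangle_def by blast
qed

lemma rotate:
  assumes "(X, Y, Z, u, v, w) \<in> Tri C"
  shows "(Y, Z, SObj C X, v, w, neg (SObj C X) (SObj C Y) (SMor C X Y u)) \<in> Tri C"
  using rotate_iff triangle_candidate[OF assms] assms by blast

lemma identity_triangle:
  assumes "X \<in> Obj C" "zero_object C N"
  shows "(X, X, N, Id C X, HZero C X N, HZero C N (SObj C X)) \<in> Tri C"
proof -
  have "triangles_TR1 C" using triangulated by (simp add: triangulated_category_def)
  then show ?thesis using assms unfolding triangles_TR1_def by blast
qed

lemma cone_exists:
  assumes "u \<in> Hom C X Y" "X \<in> Obj C" "Y \<in> Obj C"
  obtains Z v w where "(X, Y, Z, u, v, w) \<in> Tri C"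
proof -
  have "triangles_TR1 C" using triangulated by (simp add: triangulated_category_def)
  then show ?thesis using that assms unfolding triangles_TR1_def by blast
qed

lemma complete_triangle_morphism:
  assumes "(X, Y, Z, u, v, w) \<in> Tri C" "(X', Y', Z', u', v', w') \<in> Tri C"
    "a \<in> Hom C X X'" "b \<in> Hom C Y Y'" "Comp C X Y Y' b u = Comp C X X' Y' u' a"
  obtains c where "c \<in> Hom C Z Z'" "Comp C Y Z Z' c v = Comp C Y Y' Z' v' b"
    "Comp C Z (SObj C X) (SObj C X') (SMor C X X' a) w = Comp C Z Z' (SObj C X') w' c"
proof -
  have "triangles_TR3 C" using triangulated by (simp add: triangulated_category_def)
  then obtain c where "triangle_morphism C (X, Y, Z, u, v, w) (X', Y', Z', u', v', w') (a, b, c)"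
    using assms unfolding triangles_TR3_def by blast
  then have "c \<in> Hom C Z Z'" "Comp C Y Z Z' c v = Comp C Y Y' Z' v' b"
    "Comp C Z (SObj C X) (SObj C X') (SMor C X X' a) w = Comp C Z Z' (SObj C X') w' c"
    by (simp_all add: triangle_morphism_def)
  then show thesis by (rule that)
qed

lemma Susp_additive: "additive_functor C C (Susp C)"
  using triangulated by (simp add: triangulated_category_def linear_functor_def)

lemma Susp_functor: "is_functor C C (Susp C)"
  using Susp_additive by (simp add: additive_functor_def)

lemmas Susp_Obj = functor_Obj[OF Susp_functor] and Susp_Hom = functor_Hom[OF Susp_functor]
  and Susp_Comp = functor_Comp[OF Susp_functor] and Susp_Id = functor_Id[OF Susp_functor]

lemma Susp_zero: "\<lbrakk>X \<in> Obj C; Y \<in> Obj C\<rbrakk> \<Longrightarrow> SMor C X Y (HZero C X Y) = HZero C (SObj C X) (SObj C Y)"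
  using abelian_group_hom.hom_zero[OF additive_functor_hom[OF Susp_additive]] by simp

lemma Susp_bij: "\<lbrakk>X \<in> Obj C; Y \<in> Obj C\<rbrakk>
    \<Longrightarrow> bij_betw (SMor C X Y) (Hom C X Y) (Hom C (SObj C X) (SObj C Y))"
  using equivalence_fully_faithful[of C C "Susp C" X Y] triangulated
  unfolding triangulated_category_def by blast

lemma Susp_full:
  assumes "h \<in> Hom C (SObj C X) (SObj C Y)" "X \<in> Obj C" "Y \<in> Obj C"
  obtains f where "f \<in> Hom C X Y" "SMor C X Y f = h"
  using Susp_bij[OF assms(2,3)] assms(1) that unfolding bij_betw_def by (metis imageE)

lemma Susp_faithful:
  "\<lbrakk>SMor C X Y f = SMor C X Y g; f \<in> Hom C X Y; g \<in> Hom C X Y; X \<in> Obj C; Y \<in> Obj C\<rbrakk> \<Longrightarrow> f = g"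
  using Susp_bij unfolding bij_betw_def inj_on_def by blast

lemma direct_sum_exists:
  assumes "set Xs \<subseteq> Obj C"
  shows "\<exists>S. is_direct_sum C Xs S"
  using triangulated assms unfolding triangulated_category_def additive_category_def by blast

lemma zero_object_exists: obtains N where "zero_object C N"
proof -
  obtain N where N: "is_direct_sum C [] N" using direct_sum_exists[of "[]"] by auto
  then have "N \<in> Obj C" by (simp add: is_direct_sum_def)
  moreover have "Id C N = HZero C N N"
  proof -
    interpret abelian_group "hom_mod C N N" by (rule hom_group) fact+
    show ?thesis using N by (auto simp: is_direct_sum_def)
  qed
  ultimately show thesis using that zero_objectI by blast
qed

lemma Susp_zero_object: "zero_object C N \<Longrightarrow> zero_object C (SObj C N)"
proof (rule zero_objectI)
  assume N: "zero_object C N"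
  then have o: "N \<in> Obj C" using zero_object_Obj by blast
  show "SObj C N \<in> Obj C" using Susp_Obj o .
  have "Id C N = HZero C N N" using zero_object_Hom_to[OF N o] Id_Hom o by simp
  then show "Id C (SObj C N) = HZero C (SObj C N) (SObj C N)" using Susp_Id[OF o] Susp_zero o by simp
qed

text \<open>The triangle \<open>0 \<rightarrow> X \<rightarrow> X \<rightarrow> \<Sigma>0\<close> rotates to the identity triangle of \<open>X\<close>, so TR2 gives it.\<close>

lemma zero_identity_triangle:
  assumes "X \<in> Obj C" "zero_object C N"
  shows "(N, X, X, HZero C N X, Id C X, HZero C X (SObj C N)) \<in> Tri C"
proof -
  have N: "N \<in> Obj C" using assms zero_object_Obj by blast
  have "(X, X, SObj C N, Id C X, HZero C X (SObj C N), HZero C (SObj C N) (SObj C X)) \<in> Tri C"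
    using identity_triangle[OF assms(1) Susp_zero_object[OF assms(2)]] .
  moreover have "neg (SObj C N) (SObj C X) (SMor C N X (HZero C N X)) = HZero C (SObj C N) (SObj C X)"
    using Susp_zero neg_zero Susp_Obj N assms by simp
  ultimately show ?thesis
    using rotate_iff[OF N assms(1,1) zero_Hom Id_Hom zero_Hom] N assms Susp_Obj by simp
qed

lemma triangle_comp_zero:
  assumes T: "(X, Y, Z, u, v, w) \<in> Tri C"
  shows "Comp C X Y Z v u = HZero C X Z"
proof -
  note c = triangle_candidate[OF T]
  obtain N where N: "zero_object C N" using zero_object_exists .
  have NO: "N \<in> Obj C" using N zero_object_Obj by blast
  obtain k where "k \<in> Hom C N Z" "Comp C X N Z k (HZero C X N) = Comp C X Y Z v u"
    using complete_triangle_morphism[OF identity_triangle[OF c(1) N] T Id_Hom[OF c(1)] c(4)] by blast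
  then show ?thesis using Comp_zero_right[of k N Z X] c NO by simp
qed

text \<open>Exactness of \<open>Hom(-, W)\<close> and \<open>Hom(W, -)\<close> at the middle term comes from comparing the triangle with
  \<open>0 \<rightarrow> W \<rightarrow> W \<rightarrow> \<Sigma>0\<close> and \<open>W \<rightarrow> W \<rightarrow> 0 \<rightarrow> \<Sigma>W\<close> respectively. In the second case both triangles are
  rotated first, and the resulting map \<open>\<Sigma>W \<rightarrow> \<Sigma>X\<close> is desuspended.\<close>

lemma triangle_extend:
  assumes T: "(X, Y, Z, u, v, w) \<in> Tri C" and W: "W \<in> Obj C" and g: "g \<in> Hom C Y W"
    and zero: "Comp C X Y W g u = HZero C X W"
  obtains h where "h \<in> Hom C Z W" "Comp C Y Z W h v = g"
proof -
  note c = triangle_candidate[OF T]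
  obtain N where N: "zero_object C N" using zero_object_exists .
  have NO: "N \<in> Obj C" using N zero_object_Obj by blast
  have "Comp C X Y W g u = Comp C X N W (HZero C N W) (HZero C X N)"
    using zero Comp_zero_right zero_Hom c W NO by simp
  then obtain h where "h \<in> Hom C Z W" "Comp C Y Z W h v = Comp C Y W W (Id C W) g"
    using complete_triangle_morphism[OF T zero_identity_triangle[OF W N] zero_Hom g] c NO by blast
  then show thesis using that Id_left[OF g] c W by simp
qed

lemma triangle_lift:
  assumes T: "(X, Y, Z, u, v, w) \<in> Tri C" and W: "W \<in> Obj C" and t: "t \<in> Hom C W Y"
    and zero: "Comp C W Y Z v t = HZero C W Z"
  obtains s where "s \<in> Hom C W X" "Comp C W X Y u s = t"
proof -
  note c = triangle_candidate[OF T]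
  obtain N where N: "zero_object C N" using zero_object_exists .
  have NO: "N \<in> Obj C" using N zero_object_Obj by blast
  have So: "SObj C W \<in> Obj C" "SObj C X \<in> Obj C" "SObj C Y \<in> Obj C" using Susp_Obj W c by simp_all
  have "Comp C W N Z (HZero C N Z) (HZero C W N) = Comp C W Y Z v t"
    using zero Comp_zero_right zero_Hom c W NO by simp
  then obtain k where k: "k \<in> Hom C (SObj C W) (SObj C X)"
    and e: "Comp C (SObj C W) (SObj C W) (SObj C Y) (SMor C W Y t) (neg (SObj C W) (SObj C W) (SMor C W W (Id C W)))
      = Comp C (SObj C W) (SObj C X) (SObj C Y) (neg (SObj C X) (SObj C Y) (SMor C X Y u)) k"
    using complete_triangle_morphism[OF rotate[OF identity_triangle[OF W N]] rotate[OF T] t zero_Hom] c NO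
    by blast
  obtain s where s: "s \<in> Hom C W X" "SMor C W X s = k" using Susp_full[OF k W c(1)] .
  have St: "SMor C W Y t \<in> Hom C (SObj C W) (SObj C Y)" using Susp_Hom t W c by simp
  have Su: "SMor C X Y u \<in> Hom C (SObj C X) (SObj C Y)" using Susp_Hom c by simp
  have us: "Comp C W X Y u s \<in> Hom C W Y" using Comp_Hom[OF s(1) c(4)] c W by simp
  have "neg (SObj C W) (SObj C Y) (SMor C W Y t)
      = neg (SObj C W) (SObj C Y) (Comp C (SObj C W) (SObj C X) (SObj C Y) (SMor C X Y u) k)"
    using e Comp_neg_right[OF St So(1,1,3) Id_Hom[OF So(1)]] Id_right[OF St] Comp_neg_left[OF k So Su]
      Susp_Id[OF W] So by simp
  then have "SMor C W Y t = Comp C (SObj C W) (SObj C X) (SObj C Y) (SMor C X Y u) k"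
    using neg_inj[OF _ St Comp_Hom[OF k Su]] So by simp
  also have "\<dots> = SMor C W Y (Comp C W X Y u s)" using Susp_Comp[OF s(1) c(4)] s(2) W c by simp
  finally have "Comp C W X Y u s = t" using Susp_faithful[OF _ us t] W c by simp
  then show thesis using that s by blast
qed

text \<open>After two rotations the same statements hold at the term \<open>\<Sigma>X\<close>; the sign that rotation introduces
  does not affect vanishing.\<close>

lemma triangle_zero_fourth:
  assumes T: "(X, Y, Z, u, v, w) \<in> Tri C"
  shows "Comp C Z (SObj C X) (SObj C Y) (SMor C X Y u) w = HZero C Z (SObj C Y)"
proof -
  note c = triangle_candidate[OF T]
  have So: "SObj C X \<in> Obj C" "SObj C Y \<in> Obj C" using Susp_Obj c by simp_all
  have Su: "SMor C X Y u \<in> Hom C (SObj C X) (SObj C Y)" using Susp_Hom c by simp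
  have "neg Z (SObj C Y) (Comp C Z (SObj C X) (SObj C Y) (SMor C X Y u) w) = HZero C Z (SObj C Y)"
    using triangle_comp_zero[OF rotate[OF rotate[OF T]]] Comp_neg_left[OF c(6) c(3) So Su] by simp
  then show ?thesis
    using neg_inj[OF _ Comp_Hom[OF c(6) Su] zero_Hom] neg_zero c So by simp
qed

lemma triangle_lift_third:
  assumes T: "(X, Y, Z, u, v, w) \<in> Tri C" and W: "W \<in> Obj C" and t: "t \<in> Hom C W (SObj C X)"
    and zero: "Comp C W (SObj C X) (SObj C Y) (SMor C X Y u) t = HZero C W (SObj C Y)"
  obtains s where "s \<in> Hom C W Z" "Comp C W Z (SObj C X) w s = t"
proof -
  note c = triangle_candidate[OF T]
  have So: "SObj C X \<in> Obj C" "SObj C Y \<in> Obj C" using Susp_Obj c by simp_all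
  have Su: "SMor C X Y u \<in> Hom C (SObj C X) (SObj C Y)" using Susp_Hom c by simp
  have "Comp C W (SObj C X) (SObj C Y) (neg (SObj C X) (SObj C Y) (SMor C X Y u)) t = HZero C W (SObj C Y)"
    using zero Comp_neg_left[OF t W So Su] neg_zero W So by simp
  then show thesis using triangle_lift[OF rotate[OF rotate[OF T]] W t] that by blast
qed

text \<open>Since \<open>\<Sigma>\<close> is full, the last map of a triangle ending in \<open>\<Sigma>X \<rightarrow> \<Sigma>Y\<close> is, up to sign, the suspension of a
  map \<open>X \<rightarrow> Y\<close>, so TR2 can be read backwards.\<close>

lemma rotate_back:
  assumes T: "(Y, Z, SObj C X, v, w, h) \<in> Tri C" and X: "X \<in> Obj C"
  obtains u where "u \<in> Hom C X Y" "(X, Y, Z, u, v, w) \<in> Tri C"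
proof -
  note c = triangle_candidate[OF T]
  have So: "SObj C X \<in> Obj C" "SObj C Y \<in> Obj C" using Susp_Obj c X by simp_all
  obtain u where u: "u \<in> Hom C X Y" "SMor C X Y u = neg (SObj C X) (SObj C Y) h"
    using Susp_full[OF neg_Hom[OF c(6) So] X c(1)] .
  then have "neg (SObj C X) (SObj C Y) (SMor C X Y u) = h" using neg_neg[OF c(6) So] by simp
  then have "(X, Y, Z, u, v, w) \<in> Tri C"
    using rotate_iff[OF X c(1,2) u(1) c(4,5)] T by simp
  then show thesis using that u by blast
qed

end

section \<open>Rigid objects and ghosts\<close>

lemma full_subcategory_simps [simp]:
  "Obj (full_subcategory C S) = Obj C \<inter> S" "Hom (full_subcategory C S) = Hom C"
  "Comp (full_subcategory C S) = Comp C" "Id (full_subcategory C S) = Id C"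
  "HAdd (full_subcategory C S) = HAdd C" "HZero (full_subcategory C S) = HZero C"
  "hom_mod (full_subcategory C S) X Y = hom_mod C X Y"
  by (simp_all add: full_subcategory_def lincat.truncate_def hom_mod_def)

locale rigid_object = triangulated C K for C :: "('o, 'm, 'k) tricat" and K :: "'k ring" +
  fixes R :: 'o
  assumes hom_finite: "hom_finite K C" and rigid: "rigid C R"
begin

lemma R_Obj: "R \<in> Obj C"
  using rigid by (simp add: rigid_def)

lemma R_SuspR: "t \<in> Hom C R (SObj C R) \<Longrightarrow> t = HZero C R (SObj C R)"
  using rigid by (auto simp: rigid_def Ext1_def)

lemma hom_vectorspace: "\<lbrakk>X \<in> Obj C; Y \<in> Obj C\<rbrakk> \<Longrightarrow> vectorspace K (hom_mod C X Y)"
  using triangulated by (simp add: triangulated_category_def linear_category_def)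

text \<open>Take \<open>n\<close> generators \<open>t\<^sub>i\<close> of the vector space \<open>Hom(X, Z)\<close> and let \<open>p\<close> restrict to \<open>t\<^sub>i\<close> on the \<open>i\<close>-th copy of
  \<open>X\<close>. The maps that factor through \<open>p\<close> form a subspace containing all \<open>t\<^sub>i\<close>. The object \<open>S\<close> is quantified
  after \<open>n\<close> so that it may be chosen as the suspension of a direct sum of copies of \<open>R\<close>.\<close>

lemma precover:
  assumes X: "X \<in> Obj C" and Z: "Z \<in> Obj C"
  shows "\<exists>n. \<forall>S. is_direct_sum C (replicate n X) S \<longrightarrow>
    (\<exists>p\<in>Hom C S Z. \<forall>t\<in>Hom C X Z. \<exists>t'\<in>Hom C X S. Comp C X S Z p t' = t)"
proof -
  interpret V: vectorspace K "hom_mod C X Z" using hom_vectorspace[OF X Z] .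
  have "V.fin_dim" using hom_finite X Z by (simp add: hom_finite_def)
  then obtain B where B: "finite B" "B \<subseteq> Hom C X Z" "V.span B = Hom C X Z"
    unfolding V.fin_dim_def by auto
  obtain ts where ts: "set ts = B" using finite_list[OF B(1)] by auto
  define n where "n = length ts"
  have tH: "ts ! i \<in> Hom C X Z" if "i < n" for i using that ts B(2) n_def by auto
  show ?thesis
  proof (intro exI allI impI)
    fix S assume S: "is_direct_sum C (replicate n X) S"
    obtain \<iota> \<pi> where ip0: "\<forall>i<length (replicate n X).
        \<iota> i \<in> Hom C (replicate n X ! i) S \<and> \<pi> i \<in> Hom C S (replicate n X ! i)"
      and orth0: "\<forall>i<length (replicate n X). \<forall>j<length (replicate n X).
           Comp C (replicate n X ! i) S (replicate n X ! j) (\<pi> j) (\<iota> i) =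
           (if i = j then Id C (replicate n X ! i) else HZero C (replicate n X ! i) (replicate n X ! j))"
      using S unfolding is_direct_sum_def by blast
    have So: "S \<in> Obj C" using S by (simp add: is_direct_sum_def)
    have i: "\<iota> i \<in> Hom C X S" and p: "\<pi> i \<in> Hom C S X" if "i < n" for i using ip0 that by auto
    have orth: "Comp C X S X (\<pi> j) (\<iota> i) = (if i = j then Id C X else HZero C X X)"
      if "i < n" "j < n" for i j using orth0 that by auto
    interpret G: abelian_group "hom_mod C S Z" using hom_group So Z .
    define q where "q = finsum (hom_mod C S Z) (\<lambda>i. Comp C S X Z (ts ! i) (\<pi> i)) {..<n}"
    have tp: "Comp C S X Z (ts ! i) (\<pi> i) \<in> Hom C S Z" if "i < n" for i
      using Comp_Hom[OF p[OF that] tH[OF that]] So X Z by simp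
    have q: "q \<in> Hom C S Z"
      using G.finsum_closed[of "\<lambda>i. Comp C S X Z (ts ! i) (\<pi> i)" "{..<n}"] tp by (simp add: q_def Pi_iff)
    have qi: "Comp C X S Z q (\<iota> j) = ts ! j" if j: "j < n" for j
    proof -
      have "Comp C X S Z q (\<iota> j) = finsum (hom_mod C X Z) (\<lambda>i. Comp C X S Z (Comp C S X Z (ts ! i) (\<pi> i)) (\<iota> j)) {..<n}"
        using abelian_group_hom_finsum[OF precomp_hom[OF i[OF j] X So Z], of "{..<n}" "\<lambda>i. Comp C S X Z (ts ! i) (\<pi> i)"] tp
        by (simp add: q_def Pi_iff)
      also have "\<dots> = finsum (hom_mod C X Z) (\<lambda>i. if j = i then ts ! i else \<zero>\<^bsub>hom_mod C X Z\<^esub>) {..<n}"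
      proof (intro V.finsum_cong')
        fix k assume "k \<in> {..<n}"
        then have k: "k < n" by simp
        show "Comp C X S Z (Comp C S X Z (ts ! k) (\<pi> k)) (\<iota> j) = (if j = k then ts ! k else \<zero>\<^bsub>hom_mod C X Z\<^esub>)"
          using assoc[OF i[OF j] p[OF k] tH[OF k] X So X Z] orth[OF j k] Id_right[OF tH[OF k] X Z]
            Comp_zero_right[OF tH[OF k] X X Z] by simp
      qed (use tH zero_Hom X Z in auto)
      also have "\<dots> = ts ! j"
        using V.finsum_singleton[of j "{..<n}" "\<lambda>i. ts ! i"] j tH by (simp add: Pi_iff)
      finally show ?thesis .
    qed
    let ?U = "{t \<in> Hom C X Z. \<exists>t'\<in>Hom C X S. Comp C X S Z q t' = t}"
    have lin: "Comp C X S Z q (HSmult C X S c t') = HSmult C X Z c (Comp C X S Z q t')"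
      if "c \<in> carrier K" "t' \<in> Hom C X S" for c t'
      using triangulated that q X So Z unfolding triangulated_category_def linear_category_def by blast
    have smult: "HSmult C X Y c t \<in> Hom C X Y" if "c \<in> carrier K" "t \<in> Hom C X Y" "Y \<in> Obj C" for Y c t
    proof -
      interpret W: vectorspace K "hom_mod C X Y" using hom_vectorspace X that(3) .
      show ?thesis using W.smult_closed[of c t] that by simp
    qed
    have "submodule K ?U (hom_mod C X Z)"
    proof
      show "?U \<subseteq> carrier (hom_mod C X Z)" by auto
      show "s \<oplus>\<^bsub>hom_mod C X Z\<^esub> t \<in> ?U" if "s \<in> ?U" "t \<in> ?U" for s t
        using that Comp_add_right[OF q X So Z] add_Hom X So Z by auto metis
      show "\<zero>\<^bsub>hom_mod C X Z\<^esub> \<in> ?U"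
        using Comp_zero_right[OF q X So Z] zero_Hom X So Z by auto
      show "c \<odot>\<^bsub>hom_mod C X Z\<^esub> t \<in> ?U" if "c \<in> carrier K" "t \<in> ?U" for c t
        using that lin smult So Z by auto metis
    qed
    moreover have "B \<subseteq> ?U"
    proof
      fix t assume "t \<in> B"
      then obtain j where "j < n" "t = ts ! j" using ts n_def by (metis in_set_conv_nth)
      then show "t \<in> ?U" using qi i tH by blast
    qed
    ultimately have "V.span B \<subseteq> ?U" by (intro V.span_is_subset)
    then have "Hom C X Z \<subseteq> ?U" unfolding B(3) .
    then show "\<exists>p\<in>Hom C S Z. \<forall>t\<in>Hom C X Z. \<exists>t'\<in>Hom C X S. Comp C X S Z p t' = t"
      using q by blast
  qed
qed

lemma direct_sum_copies_exists: "\<exists>S. is_direct_sum C (replicate n R) S"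
proof -
  have "set (replicate n R) \<subseteq> Obj C" using R_Obj by auto
  then show ?thesis by (rule direct_sum_exists)
qed

lemma add_precover:
  assumes Z: "Z \<in> Obj C"
  obtains R0 p where "R0 \<in> add_closure C R" "p \<in> Hom C R0 Z"
    "\<And>t. t \<in> Hom C R Z \<Longrightarrow> \<exists>t'\<in>Hom C R R0. Comp C R R0 Z p t' = t"
proof -
  obtain n where n: "\<And>S. is_direct_sum C (replicate n R) S \<Longrightarrow>
    \<exists>p\<in>Hom C S Z. \<forall>t\<in>Hom C R Z. \<exists>t'\<in>Hom C R S. Comp C R S Z p t' = t"
    using precover[OF R_Obj Z] by blast
  obtain S where S: "is_direct_sum C (replicate n R) S"
    using direct_sum_copies_exists by blast
  obtain N where "zero_object C N" using zero_object_exists .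
  then have "S \<in> add_closure C R" using direct_sum_in_add_closure S by blast
  then show thesis using that n[OF S] by blast
qed

lemma Susp_add_precover:
  assumes Z: "Z \<in> Obj C"
  obtains R1 a where "R1 \<in> add_closure C R" "a \<in> Hom C (SObj C R1) Z"
    "\<And>t. t \<in> Hom C (SObj C R) Z \<Longrightarrow>
      \<exists>t'\<in>Hom C (SObj C R) (SObj C R1). Comp C (SObj C R) (SObj C R1) Z a t' = t"
proof -
  obtain n where n: "\<And>S. is_direct_sum C (replicate n (SObj C R)) S \<Longrightarrow>
    \<exists>p\<in>Hom C S Z. \<forall>t\<in>Hom C (SObj C R) Z. \<exists>t'\<in>Hom C (SObj C R) S. Comp C (SObj C R) S Z p t' = t"
    using precover[OF Susp_Obj[OF R_Obj] Z] by blast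
  obtain S where S: "is_direct_sum C (replicate n R) S"
    using direct_sum_copies_exists by blast
  obtain N where "zero_object C N" using zero_object_exists .
  then have "S \<in> add_closure C R" using direct_sum_in_add_closure S by blast
  moreover have "is_direct_sum C (replicate n (SObj C R)) (SObj C S)"
    using additive_functor_direct_sum[OF Susp_additive S] by (simp add: map_replicate)
  ultimately show thesis using that n by blast
qed

lemma Susp_add_closure: "X \<in> add_closure C R \<Longrightarrow> SObj C X \<in> add_closure C (SObj C R)"
  unfolding add_closure_def
  using additive_functor_direct_sum[OF Susp_additive] by (force simp: map_replicate)

lemma hom_perp_iff: "Y \<in> hom_perp C R \<longleftrightarrow> Y \<in> Obj C \<and> (\<forall>t\<in>Hom C R Y. t = HZero C R Y)"
  unfolding hom_perp_def using zero_Hom[OF R_Obj] by blast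

lemma add_SuspR_perp: "Y \<in> add_closure C (SObj C R) \<Longrightarrow> Y \<in> hom_perp C R"
proof -
  assume Y: "Y \<in> add_closure C (SObj C R)"
  have Yo: "Y \<in> Obj C" using add_closure_Obj[OF Y] .
  have "t = HZero C R Y" if t: "t \<in> Hom C R Y" for t
  proof (rule add_closure_to_zero[OF Y Susp_Obj[OF R_Obj] R_Obj t])
    show "Comp C R Y (SObj C R) b t = HZero C R (SObj C R)" if "b \<in> Hom C Y (SObj C R)" for b
      using R_SuspR[OF Comp_Hom[OF t that R_Obj Yo Susp_Obj[OF R_Obj]]] .
  qed
  then show ?thesis using Yo by (simp add: hom_perp_iff)
qed

lemma Hom_R_Susp_add:
  assumes "R1 \<in> add_closure C R" "t \<in> Hom C R (SObj C R1)"
  shows "t = HZero C R (SObj C R1)"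
  using add_SuspR_perp[OF Susp_add_closure[OF assms(1)]] assms(2) by (simp add: hom_perp_iff)

text \<open>The kernel of \<open>Hom(R, -)\<close>.\<close>

definition ghosts :: "'o \<Rightarrow> 'o \<Rightarrow> 'm set" where
  "ghosts X Y = {f \<in> Hom C X Y. \<forall>t\<in>Hom C R X. Comp C R X Y f t = HZero C R Y}"

text \<open>A ghost kills all maps from \<open>R\<close>, hence the map from \<open>R\<^sub>0\<close>, hence it factors over the cone.\<close>

lemma ghost_through_cone:
  assumes f: "f \<in> ghosts X Y" and Y: "Y \<in> Obj C"
    and T: "(R0, X, Z, u, v, w) \<in> Tri C" and R0: "R0 \<in> add_closure C R"
  obtains g where "g \<in> Hom C Z Y" "Comp C X Z Y g v = f"
proof -
  note c = triangle_candidate[OF T]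
  have fH: "f \<in> Hom C X Y" and fz: "\<And>t. t \<in> Hom C R X \<Longrightarrow> Comp C R X Y f t = HZero C R Y"
    using f by (simp_all add: ghosts_def)
  have "Comp C R0 X Y f u = HZero C R0 Y"
  proof (rule add_closure_from_zero[OF R0 R_Obj Y Comp_Hom[OF c(4) fH c(1,2) Y]])
    fix a assume a: "a \<in> Hom C R R0"
    show "Comp C R R0 Y (Comp C R0 X Y f u) a = HZero C R Y"
      using assoc[OF a c(4) fH R_Obj c(1,2) Y] fz[OF Comp_Hom[OF a c(4) R_Obj c(1,2)]] by simp
  qed
  from triangle_extend[OF T Y fH this] show thesis using that by blast
qed

text \<open>For the inclusion of ghosts, let \<open>Z\<close> be the cone of a map \<open>R\<^sub>0 \<rightarrow> X\<close> through which all maps \<open>R \<rightarrow> X\<close> factor.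
  A map \<open>R \<rightarrow> Z\<close> dies in \<open>\<Sigma>R\<^sub>0\<close> by rigidity, so it comes from \<open>X\<close>, so it comes from \<open>R\<^sub>0\<close>, so it is zero. Thus
  \<open>Z\<close> lies in \<open>\<X>\<^sub>R\<close>, and ghosts factor through \<open>Z\<close>.\<close>

lemma factor_ideal_hom_perp:
  assumes X: "X \<in> Obj C" and Y: "Y \<in> Obj C"
  shows "factor_ideal C (hom_perp C R) X Y = ghosts X Y"
proof
  show "factor_ideal C (hom_perp C R) X Y \<subseteq> ghosts X Y"
  proof
    fix h assume h_in: "h \<in> factor_ideal C (hom_perp C R) X Y"
    obtain Z f g where Z: "Z \<in> Obj C" "Z \<in> hom_perp C R" and fg: "f \<in> Hom C X Z" "g \<in> Hom C Z Y"
      and h: "h = Comp C X Z Y g f" using factor_idealE[OF h_in] .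
    have "Comp C R X Y h t = HZero C R Y" if t: "t \<in> Hom C R X" for t
    proof -
      have "Comp C R X Z f t = HZero C R Z"
        using Z Comp_Hom[OF t fg(1) R_Obj X Z(1)] by (simp add: hom_perp_iff)
      then show ?thesis
        using assoc[OF t fg R_Obj X Z(1) Y] Comp_zero_right[OF fg(2) R_Obj Z(1) Y] by (simp add: h)
    qed
    then show "h \<in> ghosts X Y" using Comp_Hom[OF fg X Z(1) Y] by (simp add: ghosts_def h)
  qed
  show "ghosts X Y \<subseteq> factor_ideal C (hom_perp C R) X Y"
  proof
    fix f assume f: "f \<in> ghosts X Y"
    obtain R0 p where R0: "R0 \<in> add_closure C R" and p: "p \<in> Hom C R0 X"
      and surj: "\<And>t. t \<in> Hom C R X \<Longrightarrow> \<exists>t'\<in>Hom C R R0. Comp C R R0 X p t' = t"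
      using add_precover[OF X] by metis
    obtain Z v w where T: "(R0, X, Z, p, v, w) \<in> Tri C"
      using cone_exists[OF p add_closure_Obj[OF R0] X] .
    note c = triangle_candidate[OF T]
    obtain g where g: "g \<in> Hom C Z Y" "Comp C X Z Y g v = f" using ghost_through_cone[OF f Y T R0] .
    have "t = HZero C R Z" if t: "t \<in> Hom C R Z" for t
    proof -
      have "Comp C R Z (SObj C R0) w t = HZero C R (SObj C R0)"
        using Hom_R_Susp_add[OF R0 Comp_Hom[OF t c(6) R_Obj c(3) Susp_Obj[OF c(1)]]] .
      then obtain s where s: "s \<in> Hom C R X" "Comp C R X Z v s = t"
        using triangle_lift[OF rotate[OF T] R_Obj t] by blast
      obtain s' where s': "s' \<in> Hom C R R0" "Comp C R R0 X p s' = s" using surj[OF s(1)] by blast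
      show ?thesis
        using assoc[OF s'(1) c(4,5) R_Obj c(1-3)] triangle_comp_zero[OF T] s s'(2)
          Comp_zero_left[OF s'(1) R_Obj c(1,3)] by simp
    qed
    then have "Z \<in> hom_perp C R" using c by (simp add: hom_perp_iff)
    then show "f \<in> factor_ideal C (hom_perp C R) X Y" using factor_idealI[OF _ c(3,5) g(1)] g(2) by auto
  qed
qed

lemma two_term_Obj: "X \<in> two_term C R \<Longrightarrow> X \<in> Obj C"
  by (simp add: two_term_def)

text \<open>Rotating the defining triangle back recovers the map \<open>R\<^sub>1 \<rightarrow> R\<^sub>0\<close> of which \<open>X\<close> is the cone: maps out of \<open>X\<close>
  are built with the rotated triangle, maps into \<open>X\<close> are lifted with the original one.\<close>

lemma two_term_presentation:
  assumes "X \<in> two_term C R"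
  obtains R1 R0 d u v where "R0 \<in> add_closure C R" "R1 \<in> add_closure C R"
    "(R1, R0, X, d, u, v) \<in> Tri C" "\<exists>w. (R0, X, SObj C R1, u, v, w) \<in> Tri C"
proof -
  obtain R0 R1 u v w where R01: "R0 \<in> add_closure C R" "R1 \<in> add_closure C R"
    and T: "(R0, X, SObj C R1, u, v, w) \<in> Tri C"
    using assms unfolding two_term_def by blast
  from rotate_back[OF T add_closure_Obj[OF R01(2)]] obtain d where "(R1, R0, X, d, u, v) \<in> Tri C"
    by blast
  then show thesis using that R01 T by blast
qed

text \<open>The triangle \<open>0 \<rightarrow> \<Sigma>R\<^sub>1 \<rightarrow> \<Sigma>R\<^sub>1\<close> is a presentation because \<open>add R\<close> contains the empty direct sum. This is
  needed since the ideal of the subcategory only admits factorisations inside \<open>\<C>(R)\<close>.\<close>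

lemma Susp_add_two_term:
  assumes R1: "R1 \<in> add_closure C R"
  shows "SObj C R1 \<in> two_term C R"
proof -
  obtain N where N: "zero_object C N" using zero_object_exists .
  have No: "N \<in> Obj C" using zero_object_Obj[OF N] .
  have "is_direct_sum C (replicate 0 R) N"
  proof -
    interpret abelian_group "hom_mod C N N" using hom_group No No .
    have "Id C N = HZero C N N" using zero_object_Hom_to[OF N No Id_Hom[OF No]] .
    then show ?thesis using No by (intro is_direct_sumI) auto
  qed
  then have "N \<in> add_closure C R" using direct_sum_in_add_closure N by blast
  moreover have So: "SObj C R1 \<in> Obj C" using Susp_Obj add_closure_Obj R1 by blast
  ultimately show ?thesis
    unfolding two_term_def using R1 zero_identity_triangle[OF So N] by blast
qed

lemma factor_ideal_two_term:
  assumes X: "X \<in> two_term C R" and Y: "Y \<in> Obj C"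
  shows "factor_ideal (full_subcategory C (two_term C R)) (add_closure C (SObj C R)) X Y = ghosts X Y"
proof
  have Xo: "X \<in> Obj C" using X by (simp add: two_term_def)
  show "factor_ideal (full_subcategory C (two_term C R)) (add_closure C (SObj C R)) X Y \<subseteq> ghosts X Y"
    unfolding factor_ideal_hom_perp[OF Xo Y, symmetric] factor_ideal_def
    using add_SuspR_perp by auto
  show "ghosts X Y \<subseteq> factor_ideal (full_subcategory C (two_term C R)) (add_closure C (SObj C R)) X Y"
  proof
    fix f assume f: "f \<in> ghosts X Y"
    obtain R1 R0 u v w where R0: "R0 \<in> add_closure C R" and R1: "R1 \<in> add_closure C R"
      and T: "(R0, X, SObj C R1, u, v, w) \<in> Tri C"
      using two_term_presentation[OF X] by metis
    obtain g where g: "g \<in> Hom C (SObj C R1) Y" "Comp C X (SObj C R1) Y g v = f"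
      using ghost_through_cone[OF f Y T R0] .
    show "f \<in> factor_ideal (full_subcategory C (two_term C R)) (add_closure C (SObj C R)) X Y"
      unfolding factor_ideal_def
      using g triangle_candidate[OF T] Susp_add_two_term[OF R1] Susp_add_closure[OF R1] by auto
  qed
qed

lemma ghosts_subgroup:
  assumes X: "X \<in> Obj C" and Y: "Y \<in> Obj C"
  shows "additive_subgroup (ghosts X Y) (hom_mod C X Y)"
proof (rule additive_subgroupI, rule group.subgroupI)
  interpret G: abelian_group "hom_mod C X Y" using hom_group X Y .
  show "Group.group (add_monoid (hom_mod C X Y))" by (rule G.a_group)
  show "ghosts X Y \<subseteq> carrier (add_monoid (hom_mod C X Y))" by (auto simp: ghosts_def)
  show "ghosts X Y \<noteq> {}"
    using zero_Hom[OF X Y] Comp_zero_left[OF _ R_Obj X Y] by (auto simp: ghosts_def)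
  show "inv\<^bsub>add_monoid (hom_mod C X Y)\<^esub> f \<in> ghosts X Y" if "f \<in> ghosts X Y" for f
    using that neg_Hom[OF _ X Y] Comp_neg_left[OF _ R_Obj X Y] neg_zero[OF R_Obj Y]
    unfolding a_inv_def[symmetric] by (simp add: ghosts_def)
  show "f \<otimes>\<^bsub>add_monoid (hom_mod C X Y)\<^esub> g \<in> ghosts X Y" if "f \<in> ghosts X Y" "g \<in> ghosts X Y" for f g
    using that add_Hom[OF _ _ X Y] Comp_add_left[OF _ R_Obj X Y] add_zero[OF zero_Hom[OF R_Obj Y] R_Obj Y]
    by (simp add: ghosts_def)
qed

text \<open>Complete an \<open>add R\<close>-precover \<open>p : R\<^sub>0 \<rightarrow> X\<close> to a triangle with third object \<open>Z\<close>, choose an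
  \<open>add \<Sigma>R\<close>-precover \<open>a : \<Sigma>R\<^sub>1 \<rightarrow> Z\<close>, and let \<open>X'\<close> be the cone of the map \<open>d : R\<^sub>1 \<rightarrow> R\<^sub>0\<close> with \<open>\<Sigma>d\<close> the composite
  \<open>\<Sigma>R\<^sub>1 \<rightarrow> Z \<rightarrow> \<Sigma>R\<^sub>0\<close>. Since \<open>p d = 0\<close>, the map \<open>p\<close> extends to \<open>s : X' \<rightarrow> X\<close>. Precovering \<open>Z\<close> by \<open>\<Sigma>R\<^sub>1\<close>
  replaces precovering the cocone of \<open>p\<close> by \<open>R\<^sub>1\<close>.\<close>

lemma two_term_coreflection:
  assumes X: "X \<in> Obj C"
  obtains X' s where "X' \<in> two_term C R" "s \<in> Hom C X' X"
    "bij_betw (Comp C R X' X s) (Hom C R X') (Hom C R X)"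
proof -
  obtain R0 p where R0: "R0 \<in> add_closure C R" and p: "p \<in> Hom C R0 X"
    and p_surj: "\<And>t. t \<in> Hom C R X \<Longrightarrow> \<exists>t'\<in>Hom C R R0. Comp C R R0 X p t' = t"
    using add_precover[OF X] by metis
  have R0o: "R0 \<in> Obj C" using add_closure_Obj[OF R0] .
  obtain Z v w where T: "(R0, X, Z, p, v, w) \<in> Tri C" using cone_exists[OF p R0o X] .
  note c = triangle_candidate[OF T]
  obtain R1 a where R1: "R1 \<in> add_closure C R" and a: "a \<in> Hom C (SObj C R1) Z"
    and a_surj: "\<And>t. t \<in> Hom C (SObj C R) Z \<Longrightarrow>
      \<exists>t'\<in>Hom C (SObj C R) (SObj C R1). Comp C (SObj C R) (SObj C R1) Z a t' = t"
    using Susp_add_precover[OF c(3)] by metis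
  have R1o: "R1 \<in> Obj C" using add_closure_Obj[OF R1] .
  have So: "SObj C R1 \<in> Obj C" "SObj C R0 \<in> Obj C" "SObj C R \<in> Obj C" "SObj C X \<in> Obj C"
    using Susp_Obj R1o R0o R_Obj X by simp_all
  obtain d where d: "d \<in> Hom C R1 R0" "SMor C R1 R0 d = Comp C (SObj C R1) Z (SObj C R0) w a"
    using Susp_full[OF Comp_Hom[OF a c(6) So(1) c(3) So(2)] R1o R0o] .
  obtain X' u v' where T': "(R1, R0, X', d, u, v') \<in> Tri C" using cone_exists[OF d(1) R1o R0o] .
  note c' = triangle_candidate[OF T']
  have Sp: "SMor C R0 X p \<in> Hom C (SObj C R0) (SObj C X)" using Susp_Hom[OF p R0o X] .
  have "SMor C R1 X (Comp C R1 R0 X p d) = SMor C R1 X (HZero C R1 X)"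
    using Susp_Comp[OF d(1) p R1o R0o X] d(2) assoc[OF a c(6) Sp So(1) c(3) So(2,4)]
      triangle_zero_fourth[OF T] Comp_zero_left[OF a So(1) c(3) So(4)] Susp_zero[OF R1o X] by simp
  then have "Comp C R1 R0 X p d = HZero C R1 X"
    using Susp_faithful[OF _ Comp_Hom[OF d(1) p R1o R0o X] zero_Hom[OF R1o X] R1o X] by blast
  then obtain s where s: "s \<in> Hom C X' X" "Comp C R0 X' X s u = p" using triangle_extend[OF T' X p] by blast
  have "X' \<in> two_term C R" using rotate[OF T'] R0 R1 c'(3) unfolding two_term_def by blast
  moreover have "t \<in> Comp C R X' X s ` Hom C R X'" if t: "t \<in> Hom C R X" for t
  proof -
    obtain t' where t': "t' \<in> Hom C R R0" "Comp C R R0 X p t' = t" using p_surj[OF t] by blast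
    then have "t = Comp C R X' X s (Comp C R R0 X' u t')"
      using assoc[OF t'(1) c'(5) s(1) R_Obj R0o c'(3) X] s(2) by simp
    then show ?thesis using Comp_Hom[OF t'(1) c'(5) R_Obj R0o c'(3)] by blast
  qed
  \<comment> \<open>A map \<open>t : R \<rightarrow> X'\<close> lifts to \<open>R\<^sub>0\<close> by rigidity. If \<open>s t = 0\<close>, the suspended lift comes from \<open>Z\<close>, hence from \<open>\<Sigma>R\<^sub>1\<close>, so the lift factors through \<open>d\<close>.\<close>
  moreover have inj0: "t = HZero C R X'" if t: "t \<in> Hom C R X'" and st: "Comp C R X' X s t = HZero C R X" for t
  proof -
    have "Comp C R X' (SObj C R1) v' t = HZero C R (SObj C R1)"
      using Hom_R_Susp_add[OF R1 Comp_Hom[OF t c'(6) R_Obj c'(3) So(1)]] .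
    then obtain t' where t': "t' \<in> Hom C R R0" "Comp C R R0 X' u t' = t"
      using triangle_lift[OF rotate[OF T'] R_Obj t] by blast
    have "Comp C R R0 X p t' = HZero C R X"
      using assoc[OF t'(1) c'(5) s(1) R_Obj R0o c'(3) X] s(2) st t'(2) by simp
    then have "Comp C (SObj C R) (SObj C R0) (SObj C X) (SMor C R0 X p) (SMor C R R0 t') = HZero C (SObj C R) (SObj C X)"
      using Susp_Comp[OF t'(1) p R_Obj R0o X] Susp_zero[OF R_Obj X] by simp
    then obtain b where b: "b \<in> Hom C (SObj C R) Z" "Comp C (SObj C R) Z (SObj C R0) w b = SMor C R R0 t'"
      using triangle_lift_third[OF T So(3) Susp_Hom[OF t'(1) R_Obj R0o]] by blast
    obtain b' where b': "b' \<in> Hom C (SObj C R) (SObj C R1)" "Comp C (SObj C R) (SObj C R1) Z a b' = b"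
      using a_surj[OF b(1)] by blast
    obtain b'' where b'': "b'' \<in> Hom C R R1" "SMor C R R1 b'' = b'" using Susp_full[OF b'(1) R_Obj R1o] .
    have "SMor C R R0 (Comp C R R1 R0 d b'') = SMor C R R0 t'"
      using Susp_Comp[OF b''(1) d(1) R_Obj R1o R0o] d(2) b''(2)
        assoc[OF b'(1) a c(6) So(3,1) c(3) So(2)] b'(2) b(2) by simp
    then have "t' = Comp C R R1 R0 d b''"
      using Susp_faithful[OF _ Comp_Hom[OF b''(1) d(1) R_Obj R1o R0o] t'(1) R_Obj R0o] by simp
    then show ?thesis
      using assoc[OF b''(1) d(1) c'(5) R_Obj R1o R0o c'(3)] triangle_comp_zero[OF T'] t'(2)
        Comp_zero_left[OF b''(1) R_Obj R1o c'(3)] by simp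
  qed
  moreover have "inj_on (Comp C R X' X s) (Hom C R X')"
    using postcomp_inj_on[OF s(1) R_Obj c'(3) X inj0] .
  ultimately show thesis using that s(1) Comp_Hom[OF _ s(1) R_Obj c'(3) X] unfolding bij_betw_def by blast
qed

abbreviation R_iso :: "'o \<Rightarrow> 'o \<Rightarrow> 'm \<Rightarrow> bool" where
  "R_iso X Y f \<equiv> bij_betw (Comp C R X Y f) (Hom C R X) (Hom C R Y)"

text \<open>Lift \<open>R\<^sub>0 \<rightarrow> W \<rightarrow> Y\<close> through \<open>f\<close>, using surjectivity of \<open>Hom(R, f)\<close>. The lift vanishes on \<open>R\<^sub>1\<close>, using injectivity,
  and so descends to \<open>h : W \<rightarrow> X\<close>. Then \<open>f h\<close> and \<open>g\<close> agree on \<open>R\<^sub>0\<close>, hence on all maps from \<open>R\<close>, since these lift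
  to \<open>R\<^sub>0\<close> by rigidity.\<close>

lemma two_term_lift:
  assumes W: "W \<in> two_term C R" and f: "f \<in> Hom C X Y" and X: "X \<in> Obj C" and Y: "Y \<in> Obj C"
    and iso: "R_iso X Y f" and g: "g \<in> Hom C W Y"
  obtains h where "h \<in> Hom C W X"
    "\<And>t. t \<in> Hom C R W \<Longrightarrow> Comp C R W Y (Comp C W X Y f h) t = Comp C R W Y g t"
proof -
  obtain R1 R0 d u v w where R0: "R0 \<in> add_closure C R" and R1: "R1 \<in> add_closure C R"
    and T: "(R1, R0, W, d, u, v) \<in> Tri C" and T': "(R0, W, SObj C R1, u, v, w) \<in> Tri C"
    using two_term_presentation[OF W] by metis
  note c = triangle_candidate[OF T]
  have gu: "Comp C R0 W Y g u \<in> Hom C R0 Y" using Comp_Hom[OF c(5) g c(2,3) Y] .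
  have "\<exists>t'\<in>Hom C R X. Comp C R X Y f t' = t" if "t \<in> Hom C R Y" for t
    using iso that unfolding bij_betw_def by (metis imageE)
  from add_closure_lift[OF R0 R_Obj X Y f gu this]
  obtain m where m: "m \<in> Hom C R0 X" "Comp C R0 X Y f m = Comp C R0 W Y g u" by blast
  have md: "Comp C R1 R0 X m d \<in> Hom C R1 X" using Comp_Hom[OF c(4) m(1) c(1,2) X] .
  have fmd: "Comp C R1 X Y f (Comp C R1 R0 X m d) = HZero C R1 Y"
    using assoc[OF c(4) m(1) f c(1,2) X Y] m(2) assoc[OF c(4,5) g c(1-3) Y] triangle_comp_zero[OF T]
      Comp_zero_right[OF g c(1,3) Y] by simp
  have "Comp C R1 R0 X m d = HZero C R1 X"
  proof (rule add_closure_from_zero[OF R1 R_Obj X md])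
    fix a assume a: "a \<in> Hom C R R1"
    have mda: "Comp C R R1 X (Comp C R1 R0 X m d) a \<in> Hom C R X" using Comp_Hom[OF a md R_Obj c(1) X] .
    have "Comp C R X Y f (Comp C R R1 X (Comp C R1 R0 X m d) a) = Comp C R X Y f (HZero C R X)"
      using assoc[OF a md f R_Obj c(1) X Y] fmd Comp_zero_left[OF a R_Obj c(1) Y]
        Comp_zero_right[OF f R_Obj X Y] by simp
    then show "Comp C R R1 X (Comp C R1 R0 X m d) a = HZero C R X"
      using iso mda zero_Hom[OF R_Obj X] unfolding bij_betw_def inj_on_def by blast
  qed
  then obtain h where h: "h \<in> Hom C W X" "Comp C R0 W X h u = m" using triangle_extend[OF T X m(1)] by blast
  show thesis
  proof (rule that[OF h(1)])
    fix t assume t: "t \<in> Hom C R W"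
    have "Comp C R W (SObj C R1) v t = HZero C R (SObj C R1)"
      using Hom_R_Susp_add[OF R1 Comp_Hom[OF t c(6) R_Obj c(3) Susp_Obj[OF c(1)]]] .
    then obtain t' where t': "t' \<in> Hom C R R0" "Comp C R R0 W u t' = t"
      using triangle_lift[OF T' R_Obj t] by blast
    have fh: "Comp C W X Y f h \<in> Hom C W Y" using Comp_Hom[OF h(1) f c(3) X Y] .
    have "Comp C R0 W Y (Comp C W X Y f h) u = Comp C R0 W Y g u"
      using assoc[OF c(5) h(1) f c(2,3) X Y] h(2) m(2) by simp
    then show "Comp C R W Y (Comp C W X Y f h) t = Comp C R W Y g t"
      using assoc[OF t'(1) c(5) fh R_Obj c(2,3) Y] assoc[OF t'(1) c(5) g R_Obj c(2,3) Y] t'(2) by simp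
  qed
qed

sublocale Q: ideal_quotient C "hom_perp C R"
  by (intro ideal_quotient.intro preadditive_axioms ideal_quotient_axioms.intro)
    (simp add: factor_ideal_hom_perp ghosts_subgroup)

sublocale P: ideal_quotient "full_subcategory C (two_term C R)" "add_closure C (SObj C R)"
proof (intro ideal_quotient.intro preadditive.intro ideal_quotient_axioms.intro)
  show "preadditive_category (full_subcategory C (two_term C R))"
    using preadditive_full_subcategory preadditive .
  show "additive_subgroup (factor_ideal (full_subcategory C (two_term C R)) (add_closure C (SObj C R)) X Y)
      (hom_mod (full_subcategory C (two_term C R)) X Y)"
    if "X \<in> Obj (full_subcategory C (two_term C R))" "Y \<in> Obj (full_subcategory C (two_term C R))" for X Y
    using that by (simp add: factor_ideal_two_term ghosts_subgroup)
qed

text \<open>As \<open>[\<X>\<^sub>R]\<close> is the ideal of ghosts, \<open>Hom(R, -)\<close> is faithful on the quotient.\<close>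

lemma Q_cls_eq_iff:
  assumes f: "f \<in> Hom C X Y" and g: "g \<in> Hom C X Y" and X: "X \<in> Obj C" and Y: "Y \<in> Obj C"
  shows "Q.cls X Y f = Q.cls X Y g \<longleftrightarrow> (\<forall>t\<in>Hom C R X. Comp C R X Y f t = Comp C R X Y g t)"
proof -
  have "Comp C R X Y (HAdd C X Y g (neg X Y f)) t = HZero C R Y \<longleftrightarrow> Comp C R X Y f t = Comp C R X Y g t"
    if t: "t \<in> Hom C R X" for t
    using Comp_add_left[OF t R_Obj X Y g neg_Hom[OF f X Y]] Comp_neg_left[OF t R_Obj X Y f]
      diff_zero_iff[OF Comp_Hom[OF t g R_Obj X Y] Comp_Hom[OF t f R_Obj X Y] R_Obj Y] by auto
  then show ?thesis
    unfolding Q.cls_eq_iff[OF f g X Y] factor_ideal_hom_perp[OF X Y] ghosts_def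
    using add_Hom[OF g neg_Hom[OF f X Y] X Y] by auto
qed

lemma P_cls: "\<lbrakk>X \<in> two_term C R; Y \<in> Obj C\<rbrakk> \<Longrightarrow> P.cls X Y f = Q.cls X Y f"
  by (simp add: P.cls_def Q.cls_def factor_ideal_two_term factor_ideal_hom_perp two_term_Obj)

text \<open>A faithful functor reflects monomorphisms and epimorphisms, which gives one direction. Conversely,
  testing a monomorphism against maps from \<open>R\<close> gives injectivity, since a ghost out of \<open>R\<close> is
  zero; an epimorphism makes the map to its cone a ghost, and exactness gives surjectivity.\<close>

lemma regular_iff:
  assumes f: "f \<in> Hom C X Y" and X: "X \<in> Obj C" and Y: "Y \<in> Obj C"
  shows "(X, Y, Q.cls X Y f) \<in> regular_morphisms Q.quot \<longleftrightarrow> R_iso X Y f"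
proof
  assume "(X, Y, Q.cls X Y f) \<in> regular_morphisms Q.quot"
  then have mono: "is_mono Q.quot X Y (Q.cls X Y f)" and epi: "is_epi Q.quot X Y (Q.cls X Y f)"
    by (simp_all add: regular_morphisms_def)
  have "t = t'" if t: "t \<in> Hom C R X" "t' \<in> Hom C R X" "Comp C R X Y f t = Comp C R X Y f t'" for t t'
  proof -
    have "Comp Q.quot R X Y (Q.cls X Y f) (Q.cls R X t) = Comp Q.quot R X Y (Q.cls X Y f) (Q.cls R X t')"
      using Q.quotient_Comp[OF _ f R_Obj X Y] t by simp
    then have "Q.cls R X t = Q.cls R X t'"
      using mono Q.cls_Hom t R_Obj unfolding is_mono_def by simp
    then show ?thesis
      using Q_cls_eq_iff[OF t(1,2) R_Obj X] Id_Hom[OF R_Obj] Id_right R_Obj X t by metis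
  qed
  moreover have "t \<in> Comp C R X Y f ` Hom C R X" if t: "t \<in> Hom C R Y" for t
  proof -
    obtain Z c w where T: "(X, Y, Z, f, c, w) \<in> Tri C" using cone_exists[OF f X Y] .
    note cd = triangle_candidate[OF T]
    have "Comp Q.quot X Y Z (Q.cls Y Z c) (Q.cls X Y f)
        = Comp Q.quot X Y Z (Q.cls Y Z (HZero C Y Z)) (Q.cls X Y f)"
      using Q.quotient_Comp[OF f _ X Y cd(3)] cd(5) zero_Hom[OF Y cd(3)] triangle_comp_zero[OF T]
        Comp_zero_left[OF f X Y cd(3)] by simp
    \<comment> \<open>The map \<open>c\<close> to the cone is zero in the quotient, hence a ghost.\<close>
    then have "Q.cls Y Z c = Q.cls Y Z (HZero C Y Z)"
      using epi Q.cls_Hom cd zero_Hom unfolding is_epi_def by simp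
    then have "Comp C R Y Z c t = HZero C R Z"
      using Q_cls_eq_iff[OF cd(5) zero_Hom[OF Y cd(3)] Y cd(3)] t Comp_zero_left[OF t R_Obj Y cd(3)] by simp
    from triangle_lift[OF T R_Obj t this] show ?thesis by blast
  qed
  ultimately show "R_iso X Y f"
    using Comp_Hom[OF _ f R_Obj X Y] unfolding bij_betw_def inj_on_def by blast
next
  assume iso: "R_iso X Y f"
  have "is_mono Q.quot X Y (Q.cls X Y f)"
    unfolding is_mono_def
  proof (intro conjI ballI impI Q.cls_Hom f)
    fix W \<phi> \<psi> assume W: "W \<in> Obj Q.quot" and "\<phi> \<in> Hom Q.quot W X" "\<psi> \<in> Hom Q.quot W X"
      and eq: "Comp Q.quot W X Y (Q.cls X Y f) \<phi> = Comp Q.quot W X Y (Q.cls X Y f) \<psi>"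
    then obtain g h where g: "g \<in> Hom C W X" "\<phi> = Q.cls W X g" and h: "h \<in> Hom C W X" "\<psi> = Q.cls W X h"
      by (auto simp: Q.quotient_Hom)
    have Wo: "W \<in> Obj C" using W by simp
    have fgh: "Q.cls W Y (Comp C W X Y f g) = Q.cls W Y (Comp C W X Y f h)"
      using eq Q.quotient_Comp[OF _ f Wo X Y] g h by simp
    have "Comp C R W X g t = Comp C R W X h t" if t: "t \<in> Hom C R W" for t
    proof -
      have "Comp C R X Y f (Comp C R W X g t) = Comp C R X Y f (Comp C R W X h t)"
        using fgh[unfolded Q_cls_eq_iff[OF Comp_Hom[OF g(1) f Wo X Y] Comp_Hom[OF h(1) f Wo X Y] Wo Y]] t
          assoc[OF t g(1) f R_Obj Wo X Y] assoc[OF t h(1) f R_Obj Wo X Y] by metis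
      then show ?thesis
        using iso Comp_Hom[OF t g(1) R_Obj Wo X] Comp_Hom[OF t h(1) R_Obj Wo X]
        unfolding bij_betw_def inj_on_def by blast
    qed
    then show "\<phi> = \<psi>" using Q_cls_eq_iff[OF g(1) h(1) Wo X] g h by simp
  qed
  moreover have "is_epi Q.quot X Y (Q.cls X Y f)"
    unfolding is_epi_def
  proof (intro conjI ballI impI Q.cls_Hom f)
    fix Z \<phi> \<psi> assume Z: "Z \<in> Obj Q.quot" and "\<phi> \<in> Hom Q.quot Y Z" "\<psi> \<in> Hom Q.quot Y Z"
      and eq: "Comp Q.quot X Y Z \<phi> (Q.cls X Y f) = Comp Q.quot X Y Z \<psi> (Q.cls X Y f)"
    then obtain g h where g: "g \<in> Hom C Y Z" "\<phi> = Q.cls Y Z g" and h: "h \<in> Hom C Y Z" "\<psi> = Q.cls Y Z h"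
      by (auto simp: Q.quotient_Hom)
    have Zo: "Z \<in> Obj C" using Z by simp
    have gfh: "Q.cls X Z (Comp C X Y Z g f) = Q.cls X Z (Comp C X Y Z h f)"
      using eq Q.quotient_Comp[OF f _ X Y Zo] g h by simp
    have "Comp C R Y Z g t = Comp C R Y Z h t" if "t \<in> Hom C R Y" for t
    proof -
      have "t \<in> Comp C R X Y f ` Hom C R X" using iso that by (simp add: bij_betw_def)
      then obtain s where s: "s \<in> Hom C R X" "Comp C R X Y f s = t" by auto
      then show ?thesis
        using gfh[unfolded Q_cls_eq_iff[OF Comp_Hom[OF f g(1) X Y Zo] Comp_Hom[OF f h(1) X Y Zo] X Zo]]
          assoc[OF s(1) f g(1) R_Obj X Y Zo] assoc[OF s(1) f h(1) R_Obj X Y Zo] s by metis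
    qed
    then show "\<phi> = \<psi>" using Q_cls_eq_iff[OF g(1) h(1) Y Zo] g h by simp
  qed
  ultimately show "(X, Y, Q.cls X Y f) \<in> regular_morphisms Q.quot"
    using X Y by (simp add: regular_morphisms_def)
qed

lemma P_Obj: "Obj P.quot = two_term C R"
  by (auto dest: two_term_Obj)

lemma P_Hom: "\<lbrakk>X \<in> two_term C R; Y \<in> two_term C R\<rbrakk> \<Longrightarrow> Hom P.quot X Y = Hom Q.quot X Y"
  by (simp add: P.quotient_Hom Q.quotient_Hom P_cls two_term_Obj)

lemma inclusion_additive: "additive_functor P.quot Q.quot id_functor"
  unfolding additive_functor_def is_functor_def id_functor_simps P_Obj
proof (intro conjI ballI)
  fix X assume X: "X \<in> two_term C R"
  then show "X \<in> Obj Q.quot" by (simp add: two_term_Obj)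
  show "Id P.quot X = Id Q.quot X"
    using X by (simp add: P.quotient_Id Q.quotient_Id P_cls two_term_Obj)
  fix Y assume Y: "Y \<in> two_term C R"
  show "\<phi> \<in> Hom Q.quot X Y" if "\<phi> \<in> Hom P.quot X Y" for \<phi>
    using that X Y by (simp add: P_Hom)
  show "HAdd P.quot X Y \<phi> \<psi> = HAdd Q.quot X Y \<phi> \<psi>"
    if \<phi>: "\<phi> \<in> Hom P.quot X Y" and \<psi>: "\<psi> \<in> Hom P.quot X Y" for \<phi> \<psi>
  proof -
    obtain f g where "f \<in> Hom C X Y" "\<phi> = Q.cls X Y f" "g \<in> Hom C X Y" "\<psi> = Q.cls X Y g"
      using \<phi> \<psi> X Y by (auto simp: P_Hom Q.quotient_Hom)
    then show ?thesis
      using P.quotient_HAdd[of f X Y g] Q.quotient_HAdd[of f X Y g] X Y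
      by (simp add: P_cls two_term_Obj)
  qed
  fix Z assume Z: "Z \<in> two_term C R"
  show "Comp P.quot X Y Z \<psi> \<phi> = Comp Q.quot X Y Z \<psi> \<phi>"
    if \<phi>: "\<phi> \<in> Hom P.quot X Y" and \<psi>: "\<psi> \<in> Hom P.quot Y Z" for \<phi> \<psi>
  proof -
    obtain f g where "f \<in> Hom C X Y" "\<phi> = Q.cls X Y f" "g \<in> Hom C Y Z" "\<psi> = Q.cls Y Z g"
      using \<phi> \<psi> X Y Z by (auto simp: P_Hom Q.quotient_Hom)
    then show ?thesis
      using P.quotient_Comp[of f X Y g Z] Q.quotient_Comp[of f X Y g Z] X Y Z
      by (simp add: P_cls two_term_Obj)
  qed
qed (simp_all add: P.preadditive_quotient Q.preadditive_quotient P.is_category_quotient Q.is_category_quotient)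

lemma localised_inclusion_equivalence:
  "is_equivalence P.quot (localisation Q.quot (regular_morphisms Q.quot))
    (comp_functor (localisation_functor Q.quot (regular_morphisms Q.quot)) id_functor)"
proof (rule localisation_equivalence)
  show "is_functor P.quot Q.quot id_functor"
    using inclusion_additive by (simp add: additive_functor_def)
  show "bij_betw (FMor id_functor V W) (Hom P.quot V W) (Hom Q.quot (FObj id_functor V) (FObj id_functor W))"
    if "V \<in> Obj P.quot" "W \<in> Obj P.quot" for V W
    using that P_Hom unfolding P_Obj by (auto simp: bij_betw_def inj_on_def)
  fix X Y \<phi> assume S: "(X, Y, \<phi>) \<in> regular_morphisms Q.quot"
  then have mono: "is_mono Q.quot X Y \<phi>" and X: "X \<in> Obj C" and Y: "Y \<in> Obj C"
    by (simp_all add: regular_morphisms_def)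
  then show "X \<in> Obj Q.quot \<and> Y \<in> Obj Q.quot \<and> \<phi> \<in> Hom Q.quot X Y" by (simp add: is_mono_def)
  then obtain f where f: "f \<in> Hom C X Y" "\<phi> = Q.cls X Y f" by (auto simp: Q.quotient_Hom)
  have iso: "R_iso X Y f" using S regular_iff[OF f(1) X Y] f(2) by simp
  fix W assume "W \<in> Obj P.quot"
  then have W: "W \<in> two_term C R" using P_Obj by simp
  have Wo: "W \<in> Obj C" using two_term_Obj[OF W] .
  have "\<psi> \<in> Comp Q.quot W X Y \<phi> ` Hom Q.quot W X" if \<psi>: "\<psi> \<in> Hom Q.quot W Y" for \<psi>
  proof -
    obtain g where g: "g \<in> Hom C W Y" "\<psi> = Q.cls W Y g" using \<psi> by (auto simp: Q.quotient_Hom)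
    obtain h where h: "h \<in> Hom C W X"
      "\<And>t. t \<in> Hom C R W \<Longrightarrow> Comp C R W Y (Comp C W X Y f h) t = Comp C R W Y g t"
      using two_term_lift[OF W f(1) X Y iso g(1)] by blast
    have "Comp Q.quot W X Y \<phi> (Q.cls W X h) = \<psi>"
      using Q.quotient_Comp[OF h(1) f(1) Wo X Y] Q_cls_eq_iff[OF Comp_Hom[OF h(1) f(1) Wo X Y] g(1) Wo Y]
        h(2) f(2) g(2) by simp
    then show ?thesis using Q.cls_Hom[OF h(1)] by blast
  qed
  moreover have "Comp Q.quot W X Y \<phi> \<psi> \<in> Hom Q.quot W Y" if "\<psi> \<in> Hom Q.quot W X" for \<psi>
    using category_Comp[OF Q.is_category_quotient that] mono X Y Wo by (simp add: is_mono_def)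
  ultimately show "bij_betw (Comp Q.quot (FObj id_functor W) X Y \<phi>) (Hom Q.quot (FObj id_functor W) X)
      (Hom Q.quot (FObj id_functor W) Y)"
    using mono Wo unfolding bij_betw_def inj_on_def is_mono_def id_functor_simps by auto
next
  fix X assume "X \<in> Obj Q.quot"
  then have X: "X \<in> Obj C" by simp
  obtain X' s where X': "X' \<in> two_term C R" and s: "s \<in> Hom C X' X" "R_iso X' X s"
    using two_term_coreflection[OF X] .
  have "(X', X, Q.cls X' X s) \<in> regular_morphisms Q.quot"
    using regular_iff[OF s(1) two_term_Obj[OF X'] X] s(2) by simp
  then show "\<exists>V\<in>Obj P.quot. \<exists>s. (FObj id_functor V, X, s) \<in> regular_morphisms Q.quot"
    using X' unfolding P_Obj id_functor_simps by blast
qed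

end

theorem theorem5p6:
  fixes K :: "'k ring" and C :: "('o, 'm, 'k) tricat" and R :: 'o
  assumes "field K"
    and "triangulated_category K C"
    and "hom_finite K C"
    and "krull_schmidt C"
    and "\<exists>\<nu>. serre_functor K C \<nu>"
    and "rigid C R"
  defines "Q \<equiv> quotient_category C (hom_perp C R)"
    and "P \<equiv> quotient_category (full_subcategory C (two_term C R)) (add_closure C (SObj C R))"
  shows "\<exists>F. additive_functor P Q F \<and>
           is_equivalence P (localisation Q (regular_morphisms Q))
             (comp_functor (localisation_functor Q (regular_morphisms Q)) F)"
proof -
  interpret rigid_object C K R
    using assms(2,3,6) by unfold_locales (simp_all add: triangulated_category_def linear_category_def)
  show ?thesis
    unfolding Q_def P_def using inclusion_additive localised_inclusion_equivalence by blast
qed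

end
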